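(* Let $0 \leq \delta \leq 2$ be a constant and let $\mathbb{F}_q$ be a finite field. Then for every constant $\varepsilon > 0$ there is a deterministic algorithm for $\mathrm{MMV}_{\mathbb{F}_q}^{n^\delta}$ that runs in $n^{\omega(1,1,\delta/2) + \varepsilon} \cdot \mathrm{poly}(\log q)$ time.
   Context: For a ring $R$ and sparsity parameter $t = t(n) \geq 0$, the problem $\mathrm{MMV}_R^t$ is: given matrices $A, B, C \in R^{n\times n}$ (for some $n \in \mathbb{Z}^+$) with the promise that $AB - C$ has at most $t$ non-zero entries, decide whether $AB = C$. For $\alpha,\beta,\gamma\in[0,1]$, $\omega(\alpha,\beta,\gamma)$ is the infimum over $\omega'>0$ such that the product of an $n^\alpha\times n^\beta$ matrix and an $n^\beta\times n^\gamma$ matrix can be computed using $O(n^{\omega'})$ arithmetic operations. *)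

theory Defs
  imports
    Complex_Main
    "HOL-Library.FuncSet"
    "HOL-Library.Log_Nat"
    "HOL-Library.Poly_Mapping"
    "HOL-Computational_Algebra.Polynomial"
    "HOL-Algebra.Ring"
begin

section \<open>Arithmetic operations and the rectangular matrix multiplication exponent\<close>

text \<open>
  Straight-line programs with ring operations. Each instruction appends its value to the list of
  slots, which initially holds the inputs; hence the length of a program is the number of
  arithmetic operations it performs. Integer constants may be used as operands free of charge.
\<close>

datatype operand = Const int | Slot nat

datatype arith = Add | Sub | Mul

type_synonym slp = "(arith \<times> operand \<times> operand) list"

fun operand_val :: "'r::comm_ring_1 list \<Rightarrow> operand \<Rightarrow> 'r" where
  "operand_val vs (Const c) = of_int c"
| "operand_val vs (Slot i) = vs ! i"

fun arith_val :: "arith \<Rightarrow> 'r::comm_ring_1 \<Rightarrow> 'r \<Rightarrow> 'r" where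
  "arith_val Add x y = x + y"
| "arith_val Sub x y = x - y"
| "arith_val Mul x y = x * y"

fun slp_run :: "'r::comm_ring_1 list \<Rightarrow> slp \<Rightarrow> 'r list" where
  "slp_run vs [] = vs"
| "slp_run vs ((f, a, b) # S) =
     slp_run (vs @ [arith_val f (operand_val vs a) (operand_val vs b)]) S"

fun operand_ok :: "nat \<Rightarrow> operand \<Rightarrow> bool" where
  "operand_ok m (Const c) = True"
| "operand_ok m (Slot i) = (i < m)"

fun slp_ok :: "nat \<Rightarrow> slp \<Rightarrow> bool" where
  "slp_ok m [] = True"
| "slp_ok m ((f, a, b) # S) = (operand_ok m a \<and> operand_ok m b \<and> slp_ok (Suc m) S)"

type_synonym int_mpoly = "(nat \<Rightarrow>\<^sub>0 nat) \<Rightarrow>\<^sub>0 int"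

definition Var :: "nat \<Rightarrow> int_mpoly" where
  "Var i = Poly_Mapping.single (Poly_Mapping.single i 1) 1"

definition eq_over :: "'a ring \<Rightarrow> int_mpoly \<Rightarrow> int_mpoly \<Rightarrow> bool" where
  "eq_over F f g \<longleftrightarrow>
     (\<forall>m. [Poly_Mapping.lookup f m] \<cdot>\<^bsub>F\<^esub> \<one>\<^bsub>F\<^esub> = [Poly_Mapping.lookup g m] \<cdot>\<^bsub>F\<^esub> \<one>\<^bsub>F\<^esub>)"

text \<open>
  The program \<open>S\<close> with output operands \<open>outs\<close> multiplies an \<open>a \<times> b\<close> matrix by a
  \<open>b \<times> c\<close> matrix over each of the fields in \<open>\<F>\<close>. As usual in algebraic complexity, the
  entries of the two matrices are indeterminates (\<open>X\<^sub>i\<^sub>j\<close> is \<open>Var (i * b + j)\<close> and \<open>Y\<^sub>j\<^sub>l\<close> is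
  \<open>Var (a * b + j * c + l)\<close>) and the outputs must be correct as polynomials over the field. Since
  all constants are integers, the program is run over the integers and its results are compared
  after mapping the coefficients to the field.
\<close>

definition computes_matmul ::
  "'a ring set \<Rightarrow> nat \<Rightarrow> nat \<Rightarrow> nat \<Rightarrow> slp \<Rightarrow> operand list \<Rightarrow> bool" where
  "computes_matmul \<F> a b c S outs \<longleftrightarrow>
     slp_ok (a * b + b * c) S \<and>
     length outs = a * c \<and> (\<forall>x\<in>set outs. operand_ok (a * b + b * c + length S) x) \<and>
     (\<forall>F\<in>\<F>. \<forall>i<a. \<forall>l<c.
        eq_over F
          (operand_val (slp_run (map Var [0..<a * b + b * c]) S) (outs ! (i * c + l)))
          (\<Sum>j<b. Var (i * b + j) * Var (a * b + j * c + l)))"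

definition dim_pow :: "nat \<Rightarrow> real \<Rightarrow> nat" where
  "dim_pow n x = nat \<lceil>real n powr x\<rceil>"

text \<open>
  \<open>\<omega>(\<alpha>, \<beta>, \<gamma>)\<close> for arithmetic algorithms that work over all fields of the family \<open>\<F>\<close>. A singleton
  family gives the exponent of a single field, the family of all finite fields an exponent
  that does not refer to a field.
\<close>

definition omega :: "'a ring set \<Rightarrow> real \<Rightarrow> real \<Rightarrow> real \<Rightarrow> real" where
  "omega \<F> \<alpha> \<beta> \<gamma> = Inf {w. w > 0 \<and>
     (\<exists>K. \<forall>n\<ge>1. \<exists>S outs.
        computes_matmul \<F> (dim_pow n \<alpha>) (dim_pow n \<beta>) (dim_pow n \<gamma>) S outs \<and>
        real (length S) \<le> K * real n powr w)}"


section \<open>Deterministic algorithms with logarithmic cost\<close>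

text \<open>
  Structured programs of a random access machine whose memory consists of unbounded arrays of
  natural numbers, one for each of the finitely many names occurring in the program. The cost is
  logarithmic: every constant, operand, address and stored value is charged its binary length.
  Subtraction truncates at \<open>0\<close>; a condition holds if its value is nonzero.
\<close>

datatype aexp =
    Lit nat
  | Cell string aexp
  | Plus aexp aexp
  | Minus aexp aexp
  | Times aexp aexp
  | Quot aexp aexp
  | Rem aexp aexp

datatype com =
    Skip
  | Assign string aexp aexp
  | Seq com com
  | If aexp com com
  | While aexp com

type_synonym state = "string \<Rightarrow> nat \<Rightarrow> nat"

definition len :: "nat \<Rightarrow> nat" where
  "len v = Suc (floorlog 2 v)"

fun aval :: "aexp \<Rightarrow> state \<Rightarrow> nat" where
  "aval (Lit c) s = c"
| "aval (Cell x e) s = s x (aval e s)"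
| "aval (Plus a b) s = aval a s + aval b s"
| "aval (Minus a b) s = aval a s - aval b s"
| "aval (Times a b) s = aval a s * aval b s"
| "aval (Quot a b) s = aval a s div aval b s"
| "aval (Rem a b) s = aval a s mod aval b s"

fun acost :: "aexp \<Rightarrow> state \<Rightarrow> nat" where
  "acost (Lit c) s = len c"
| "acost (Cell x e) s = acost e s + len (aval e s) + len (aval (Cell x e) s)"
| "acost (Plus a b) s = acost a s + acost b s + len (aval a s) + len (aval b s)"
| "acost (Minus a b) s = acost a s + acost b s + len (aval a s) + len (aval b s)"
| "acost (Times a b) s = acost a s + acost b s + len (aval a s) + len (aval b s)"
| "acost (Quot a b) s = acost a s + acost b s + len (aval a s) + len (aval b s)"
| "acost (Rem a b) s = acost a s + acost b s + len (aval a s) + len (aval b s)"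

text \<open>\<open>exec c s t s'\<close>: started in state \<open>s\<close>, \<open>c\<close> terminates in state \<open>s'\<close> after time \<open>t\<close>.\<close>

inductive exec :: "com \<Rightarrow> state \<Rightarrow> nat \<Rightarrow> state \<Rightarrow> bool" where
  Skip: "exec Skip s 1 s"
| Assign: "exec (Assign x a e) s
     (acost a s + acost e s + len (aval a s) + len (aval e s))
     (s(x := (s x)(aval a s := aval e s)))"
| Seq: "exec c1 s t1 s1 \<Longrightarrow> exec c2 s1 t2 s2 \<Longrightarrow> exec (Seq c1 c2) s (t1 + t2) s2"
| IfTrue: "aval b s \<noteq> 0 \<Longrightarrow> exec c1 s t s' \<Longrightarrow> exec (If b c1 c2) s (acost b s + t) s'"
| IfFalse: "aval b s = 0 \<Longrightarrow> exec c2 s t s' \<Longrightarrow> exec (If b c1 c2) s (acost b s + t) s'"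
| WhileFalse: "aval b s = 0 \<Longrightarrow> exec (While b c) s (acost b s) s"
| WhileTrue: "aval b s \<noteq> 0 \<Longrightarrow> exec c s t1 s1 \<Longrightarrow> exec (While b c) s1 t2 s2 \<Longrightarrow>
     exec (While b c) s (acost b s + t1 + t2) s2"

inductive_cases SkipE: "exec Skip s t s'"
inductive_cases AssignE: "exec (Assign x a e) s t s'"
inductive_cases SeqE: "exec (Seq c1 c2) s t s'"
inductive_cases IfE: "exec (If b c1 c2) s t s'"
inductive_cases WhileE: "exec (While b c) s t s'"

lemma exec_deterministic:
  "exec c s t s' \<Longrightarrow> exec c s u s'' \<Longrightarrow> u = t \<and> s'' = s'"
proof (induction arbitrary: u s'' rule: exec.induct)
  case (Skip s)
  then show ?case by (rule SkipE) simp
next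
  case (Assign x a s e)
  then show ?case by (rule AssignE) simp
next
  case (Seq c1 s t1 s1 c2 t2 s2)
  from Seq.prems show ?case by (rule SeqE) (auto dest!: Seq.IH)
next
  case (IfTrue b s c1 t s' c2)
  from IfTrue.prems show ?case by (rule IfE) (auto simp: IfTrue.hyps(1) dest: IfTrue.IH)
next
  case (IfFalse b s c2 t s' c1)
  from IfFalse.prems show ?case by (rule IfE) (auto simp: IfFalse.hyps(1) dest: IfFalse.IH)
next
  case (WhileFalse b s c)
  from WhileFalse.prems show ?case by (rule WhileE) (use WhileFalse.hyps in simp_all)
next
  case (WhileTrue b s c t1 s1 t2 s2)
  from WhileTrue.prems show ?case by (rule WhileE) (auto simp: WhileTrue.hyps(1) dest!: WhileTrue.IH)
qed


section \<open>Matrix multiplication verification over finite fields\<close>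

definition mat_entries :: "'a ring \<Rightarrow> nat \<Rightarrow> (nat \<Rightarrow> nat \<Rightarrow> 'a) \<Rightarrow> bool" where
  "mat_entries R n A \<longleftrightarrow> (\<forall>i<n. \<forall>j<n. A i j \<in> carrier R)"

definition mat_prod :: "'a ring \<Rightarrow> nat \<Rightarrow> (nat \<Rightarrow> nat \<Rightarrow> 'a) \<Rightarrow> (nat \<Rightarrow> nat \<Rightarrow> 'a) \<Rightarrow> nat \<Rightarrow> nat \<Rightarrow> 'a"
  where "mat_prod R n A B i j = (\<Oplus>\<^bsub>R\<^esub>k\<in>{..<n}. A i k \<otimes>\<^bsub>R\<^esub> B k j)"

definition mmv_instance :: "'a ring \<Rightarrow> (nat \<Rightarrow> real) \<Rightarrow> nat \<Rightarrow>
    (nat \<Rightarrow> nat \<Rightarrow> 'a) \<Rightarrow> (nat \<Rightarrow> nat \<Rightarrow> 'a) \<Rightarrow> (nat \<Rightarrow> nat \<Rightarrow> 'a) \<Rightarrow> bool" where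
  "mmv_instance R t n A B C \<longleftrightarrow>
     n \<ge> 1 \<and> mat_entries R n A \<and> mat_entries R n B \<and> mat_entries R n C \<and>
     real (card {(i, j). i < n \<and> j < n \<and> mat_prod R n A B i j \<ominus>\<^bsub>R\<^esub> C i j \<noteq> \<zero>\<^bsub>R\<^esub>}) \<le> t n"

definition mmv_yes :: "'a ring \<Rightarrow> nat \<Rightarrow>
    (nat \<Rightarrow> nat \<Rightarrow> 'a) \<Rightarrow> (nat \<Rightarrow> nat \<Rightarrow> 'a) \<Rightarrow> (nat \<Rightarrow> nat \<Rightarrow> 'a) \<Rightarrow> bool" where
  "mmv_yes R n A B C \<longleftrightarrow> (\<forall>i<n. \<forall>j<n. mat_prod R n A B i j = C i j)"

text \<open>
  The standard presentation of a field with \<open>p\<^sup>k\<close> elements as \<open>\<F>\<^sub>p[x]/(x\<^sup>k - \<Sum>i<k. f\<^sub>i x\<^sup>i)\<close>, where \<open>\<theta>\<close> is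
  the class of \<open>x\<close>: every element is uniquely of the form \<open>\<Sum>i<k. c\<^sub>i \<theta>\<^sup>i\<close> with digits \<open>c\<^sub>i < p\<close>.
  The modulus is given by the digits \<open>f\<^sub>i\<close> of \<open>\<theta>\<^sup>k\<close>; it is irreducible because \<open>F\<close> is a field.
\<close>

definition from_digits :: "'a ring \<Rightarrow> nat \<Rightarrow> 'a \<Rightarrow> (nat \<Rightarrow> nat) \<Rightarrow> 'a" where
  "from_digits F k \<theta> c = (\<Oplus>\<^bsub>F\<^esub>i\<in>{..<k}. [c i] \<cdot>\<^bsub>F\<^esub> (\<theta> [^]\<^bsub>F\<^esub> i))"

definition presents :: "'a ring \<Rightarrow> nat \<Rightarrow> nat \<Rightarrow> 'a \<Rightarrow> bool" where
  "presents F p k \<theta> \<longleftrightarrow>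
     prime p \<and> \<theta> \<in> carrier F \<and>
     bij_betw (from_digits F k \<theta>) ({..<k} \<rightarrow>\<^sub>E {..<p}) (carrier F)"

definition digits :: "'a ring \<Rightarrow> nat \<Rightarrow> nat \<Rightarrow> 'a \<Rightarrow> 'a \<Rightarrow> nat \<Rightarrow> nat" where
  "digits F p k \<theta> = the_inv_into ({..<k} \<rightarrow>\<^sub>E {..<p}) (from_digits F k \<theta>)"

text \<open>
  The input consists of \<open>n\<close>, the presentation \<open>p\<close>, \<open>k\<close>, \<open>f\<close> of the field, and the three matrices
  in row-major order with \<open>k\<close> consecutive digits per entry. All other memory cells are \<open>0\<close>.
\<close>

definition mat_cells :: "'a ring \<Rightarrow> nat \<Rightarrow> nat \<Rightarrow> 'a \<Rightarrow> nat \<Rightarrow> (nat \<Rightarrow> nat \<Rightarrow> 'a) \<Rightarrow> nat \<Rightarrow> nat" where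
  "mat_cells F p k \<theta> n A i =
     (if i < n * n * k then digits F p k \<theta> (A (i div k div n) (i div k mod n)) (i mod k) else 0)"

definition mmv_input :: "'a ring \<Rightarrow> nat \<Rightarrow> nat \<Rightarrow> 'a \<Rightarrow> nat \<Rightarrow>
    (nat \<Rightarrow> nat \<Rightarrow> 'a) \<Rightarrow> (nat \<Rightarrow> nat \<Rightarrow> 'a) \<Rightarrow> (nat \<Rightarrow> nat \<Rightarrow> 'a) \<Rightarrow> state" where
  "mmv_input F p k \<theta> n A B C = (\<lambda>_ _. 0)
     (''n'' := (\<lambda>_. 0)(0 := n),
      ''p'' := (\<lambda>_. 0)(0 := p),
      ''k'' := (\<lambda>_. 0)(0 := k),
      ''f'' := (\<lambda>i. if i < k then digits F p k \<theta> (\<theta> [^]\<^bsub>F\<^esub> k) i else 0),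
      ''A'' := mat_cells F p k \<theta> n A,
      ''B'' := mat_cells F p k \<theta> n B,
      ''C'' := mat_cells F p k \<theta> n C)"

definition solves_mmv_in_time ::
  "com \<Rightarrow> 'a ring \<Rightarrow> (nat \<Rightarrow> real) \<Rightarrow> (nat \<Rightarrow> real) \<Rightarrow> bool" where
  "solves_mmv_in_time P F t T \<longleftrightarrow>
     (\<forall>p k \<theta> n A B C. presents F p k \<theta> \<longrightarrow> mmv_instance F t n A B C \<longrightarrow>
        (\<exists>m s. exec P (mmv_input F p k \<theta> n A B C) m s \<and> real m \<le> T n \<and>
           s ''out'' 0 = (if mmv_yes F n A B C then 1 else 0)))"

end

theory Submission
  imports
    Defs
    "HOL-Number_Theory.Cong"
    "HOL-Algebra.Multiplicative_Group"
    "HOL-Real_Asymp.Real_Asymp"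
begin

text \<open>
  A straight-line program \<open>S\<close> for the product of an \<open>N \<times> N\<close> and an \<open>N \<times> M\<close> matrix yields a
  bilinear identity with \<open>R \<le> 2 |S|\<close> products, because in degree two every multiplication
  contributes only two products of linear forms. The \<open>r\<close>-th tensor power of this identity
  multiplies an \<open>N\<^sup>r \<times> N\<^sup>r\<close> and an \<open>N\<^sup>r \<times> M\<^sup>r\<close> matrix, and Yates' algorithm evaluates it in time
  about \<open>R\<^sup>r\<close>. Here \<open>N\<close> is a constant depending on \<open>\<epsilon>\<close>, \<open>M\<close> is \<open>N\<close> to the \<open>\<delta> / 2\<close> rounded up, and \<open>r\<close> is
  least with \<open>n \<le> N\<^sup>r\<close>; all factors \<open>K\<^sup>r\<close> with \<open>K\<close> small compared to a power of \<open>N\<close> are absorbed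
  by \<open>\<epsilon>\<close>.

  If \<open>A B - C\<close> is nonzero and sparse, then some nonzero row or column of it has at most \<open>M\<^sup>r\<close>
  nonzero entries. By a counting argument there are sets \<open>T\<^sub>j \<subseteq> {..<N}\<close> with weights \<open>w\<^sub>j\<close>, few of each
  weight, such that every nonempty \<open>X \<subseteq> {..<N}\<close> meets some \<open>T\<^sub>j\<close> with \<open>w\<^sub>j \<le> |X|\<close> in exactly one
  point. Applied to one coordinate after the other, this shows that a nonzero vector with at most
  \<open>M\<^sup>r\<close> nonzero entries over a field of any characteristic is not orthogonal to some row of weight
  at most \<open>M\<^sup>r\<close> of the \<open>r\<close>-th tensor power of the incidence matrix of the \<open>T\<^sub>j\<close>. There are little more
  than \<open>M\<^sup>r\<close> such rows; with these as the columns of \<open>H\<close>, it suffices to compare \<open>A (B H)\<close> with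
  \<open>C H\<close> in blocks of \<open>M\<^sup>r\<close> columns, and likewise for the transposed matrices.
\<close>

section \<open>Tensor powers of bilinear algorithms\<close>

text \<open>The obstacle is uniformity: \<open>omega\<close> only provides, for each size
  separately, some straight-line program, and nothing says how to find it, whereas one fixed
  \<open>com\<close> must serve all \<open>n\<close> and all fields of the family. Hence only
  finitely much is hard-coded, one bilinear identity and one isolating family at the constant size
  \<open>N\<close>, and tensor powers produce every larger size from these. Counting products
  instead of program steps preserves the exponent: products multiply under tensor powers, and the
  linear maps around them cost little more. All hard-coded coefficients are integers used modulo
  \<open>p\<close>, and each detection leaves a single entry with coefficient 1, so no step depends
  on the characteristic. An element of a field with \<open>p ^ k\<close> elements is treated as
  \<open>k\<close> digits, with one copy of the left factor for each power of \<theta>; this costs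
  powers of \<open>k\<close> only. The four quarters of \<epsilon> pay for the gap between an
  attained exponent and the infimum, for the constant of the program, for the number of rows of
  bounded weight, and for the factors \<open>r + 1\<close>.\<close>

text \<open>Indices of Kronecker powers are digit strings, with the least significant digit first.\<close>

primrec tpow :: "(nat \<Rightarrow> nat \<Rightarrow> int) \<Rightarrow> nat \<Rightarrow> nat \<Rightarrow> nat \<Rightarrow> nat \<Rightarrow> nat \<Rightarrow> int" where
  "tpow f D E 0 \<rho> d = 1"
| "tpow f D E (Suc t) \<rho> d = f (\<rho> mod E) (d mod D) * tpow f D E t (\<rho> div E) (d div D)"

lemma sum_lessThan_mult:
  fixes h :: "nat \<Rightarrow> 'a::comm_monoid_add"
  shows "(\<Sum>x<m * n. h x) = (\<Sum>y<m. \<Sum>a<n. h (y * n + a))"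
proof -
  have "(\<Sum>x<m * n. h x) = (\<Sum>y<m. sum h {y * n..<y * n + n})"
    by (rule sum.nat_group [symmetric])
  also have "\<dots> = (\<Sum>y<m. \<Sum>a<n. h (y * n + a))"
  proof (rule sum.cong [OF refl])
    fix y
    show "sum h {y * n..<y * n + n} = (\<Sum>a<n. h (y * n + a))"
      using sum.atLeastLessThan_shift_bounds [of h 0 "y * n" n]
      by (simp add: lessThan_atLeast0 add.commute)
  qed
  finally show ?thesis .
qed

lemma mult_add_less:
  fixes q d D m :: nat
  assumes "q < m" "d < D"
  shows "q * D + d < m * D"
proof -
  have "q * D + d < Suc q * D" using assms by simp
  also have "\<dots> \<le> m * D" using assms by (intro mult_right_mono) auto
  finally show ?thesis .
qed

lemma div_mod_mult_add:
  fixes x y D :: nat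
  assumes "y < D"
  shows "(x * D + y) div D = x" "(x * D + y) mod D = y"
  using assms by (simp_all add: div_mult_self3)

text \<open>The last transformation runs from products to output entries, so the program applies the
  transpose of \<open>\<gamma>\<close>, while the tensor identity keeps \<open>\<gamma>\<close>
  indexed by the product first.\<close>

lemma tpow_transpose: "tpow (\<lambda>x y. f y x) E D t d \<rho> = tpow f D E t \<rho> d"
  by (induction t arbitrary: d \<rho>) auto

text \<open>
  One step consumes the most significant digit of the old index and appends the new digit at the
  least significant end.
\<close>

lemma yates_step:
  fixes V V' V0 :: "nat \<Rightarrow> int"
  assumes IH: "\<And>y \<rho>. y < Z * D ^ Suc m \<Longrightarrow> \<rho> < E ^ t \<Longrightarrow>
      [V (y * E ^ t + \<rho>) = (\<Sum>d<D ^ t. tpow f D E t \<rho> d * V0 (d * (Z * D ^ Suc m) + y))] (mod p)"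
    and step: "\<And>y \<rho>. y < Z * D ^ m * E ^ t \<Longrightarrow> \<rho> < E \<Longrightarrow>
      [V' (y * E + \<rho>) = (\<Sum>d<D. f \<rho> d * V (d * (Z * D ^ m * E ^ t) + y))] (mod p)"
    and y: "y < Z * D ^ m" and \<rho>: "\<rho> < E ^ Suc t"
  shows "[V' (y * E ^ Suc t + \<rho>) =
    (\<Sum>d<D ^ Suc t. tpow f D E (Suc t) \<rho> d * V0 (d * (Z * D ^ m) + y))] (mod p)"
proof -
  have E: "E > 0" using \<rho> by (cases E) auto
  define \<rho>1 where "\<rho>1 = \<rho> div E"
  define \<rho>0 where "\<rho>0 = \<rho> mod E"
  have \<rho>0: "\<rho>0 < E" using E by (simp add: \<rho>0_def)
  have \<rho>1: "\<rho>1 < E ^ t" using \<rho> E by (simp add: \<rho>1_def less_mult_imp_div_less mult.commute)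
  have "\<rho> = \<rho>1 * E + \<rho>0" by (simp add: \<rho>0_def \<rho>1_def)
  then have idx: "y * E ^ Suc t + \<rho> = (y * E ^ t + \<rho>1) * E + \<rho>0"
    by (simp add: algebra_simps)
  have lt: "y * E ^ t + \<rho>1 < Z * D ^ m * E ^ t" using y \<rho>1 by (rule mult_add_less)
  have "[V' (y * E ^ Suc t + \<rho>) =
      (\<Sum>d<D. f \<rho>0 d * V (d * (Z * D ^ m * E ^ t) + (y * E ^ t + \<rho>1)))] (mod p)"
    unfolding idx by (rule step [OF lt \<rho>0])
  also have "[(\<Sum>d<D. f \<rho>0 d * V (d * (Z * D ^ m * E ^ t) + (y * E ^ t + \<rho>1))) =
     (\<Sum>d<D. f \<rho>0 d * (\<Sum>d'<D ^ t. tpow f D E t \<rho>1 d' * V0 ((d' * D + d) * (Z * D ^ m) + y)))] (mod p)"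
  proof (intro cong_sum cong_mult cong_refl)
    fix d assume "d \<in> {..<D}"
    then have d: "d < D" by simp
    \<comment> \<open>The position read by \<open>step\<close> regroups as
      \<open>(d * (Z * D ^ m) + y) * E ^ t + \<rho>1\<close>: the digit \<open>d\<close> about to be
      consumed heads the part of the index that is still untransformed, where \<open>IH\<close>
      applies.\<close>
    have lt': "d * (Z * D ^ m) + y < Z * D ^ Suc m"
      using mult_add_less [OF d y] by (simp add: mult_ac)
    have "[V ((d * (Z * D ^ m) + y) * E ^ t + \<rho>1) =
        (\<Sum>d'<D ^ t. tpow f D E t \<rho>1 d' * V0 (d' * (Z * D ^ Suc m) + (d * (Z * D ^ m) + y)))] (mod p)"
      by (rule IH [OF lt' \<rho>1])
    then show "[V (d * (Z * D ^ m * E ^ t) + (y * E ^ t + \<rho>1)) =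
        (\<Sum>d'<D ^ t. tpow f D E t \<rho>1 d' * V0 ((d' * D + d) * (Z * D ^ m) + y))] (mod p)"
      by (simp add: algebra_simps)
  qed
  also have "(\<Sum>d<D. f \<rho>0 d * (\<Sum>d'<D ^ t. tpow f D E t \<rho>1 d' * V0 ((d' * D + d) * (Z * D ^ m) + y))) =
     (\<Sum>d'<D ^ t. \<Sum>d<D. f \<rho>0 d * tpow f D E t \<rho>1 d' * V0 ((d' * D + d) * (Z * D ^ m) + y))"
    by (subst sum.swap) (simp add: sum_distrib_left mult.assoc)
  also have "\<dots> = (\<Sum>d'<D ^ t. \<Sum>d<D. tpow f D E (Suc t) \<rho> (d' * D + d) * V0 ((d' * D + d) * (Z * D ^ m) + y))"
    by (intro sum.cong refl) (simp add: \<rho>0_def \<rho>1_def)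
  also have "\<dots> = (\<Sum>d<D ^ t * D. tpow f D E (Suc t) \<rho> d * V0 (d * (Z * D ^ m) + y))"
    by (rule sum_lessThan_mult [symmetric])
  finally show ?thesis by (simp add: mult.commute)
qed

section \<open>Splitting a matrix index into row and column digit by digit\<close>

text \<open>A digit in base \<open>b c\<close> encodes a digit in base \<open>b\<close> and one in base \<open>c\<close>.\<close>

primrec row_part :: "nat \<Rightarrow> nat \<Rightarrow> nat \<Rightarrow> nat \<Rightarrow> nat" where
  "row_part b c 0 x = 0"
| "row_part b c (Suc t) x = x mod (b * c) div c + b * row_part b c t (x div (b * c))"

primrec col_part :: "nat \<Rightarrow> nat \<Rightarrow> nat \<Rightarrow> nat \<Rightarrow> nat" where
  "col_part b c 0 x = 0"
| "col_part b c (Suc t) x = x mod c + c * col_part b c t (x div (b * c))"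

lemma row_part_0: "row_part b c t 0 = 0"
  by (induction t) auto

lemma col_part_0: "col_part b c t 0 = 0"
  by (induction t) auto

text \<open>The additional digit is a leading zero. The program fills the table of row parts by the
  recurrence for \<open>Suc t\<close> from an earlier entry of the same table, and this equation
  makes that correct.\<close>

lemma row_part_Suc: "x < (b * c) ^ t \<Longrightarrow> row_part b c (Suc t) x = row_part b c t x"
proof (induction t arbitrary: x)
  case (Suc t)
  then have "x div (b * c) < (b * c) ^ t" by (intro less_mult_imp_div_less) (simp add: mult.commute)
  from Suc.IH [OF this] show ?case by (simp only: row_part.simps(2))
qed simp

lemma col_part_Suc: "x < (b * c) ^ t \<Longrightarrow> col_part b c (Suc t) x = col_part b c t x"
proof (induction t arbitrary: x)
  case (Suc t)
  then have "x div (b * c) < (b * c) ^ t" by (intro less_mult_imp_div_less) (simp add: mult.commute)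
  from Suc.IH [OF this] show ?case by (simp only: col_part.simps(2))
qed simp

text \<open>Both parts together form a bijection onto pairs, stated as a change of variables in
  sums. \<open>h\<close> stays arbitrary in the induction: the step applies the hypothesis to the
  function that has already summed over the lowest digit.\<close>

lemma sum_parts:
  fixes h :: "nat \<Rightarrow> nat \<Rightarrow> 'a::comm_monoid_add"
  assumes c: "c > 0"
  shows "(\<Sum>x<(b * c) ^ t. h (row_part b c t x) (col_part b c t x)) = (\<Sum>i<b ^ t. \<Sum>j<c ^ t. h i j)"
proof (induction t arbitrary: h)
  case (Suc t)
  have "(\<Sum>x<(b * c) ^ Suc t. h (row_part b c (Suc t) x) (col_part b c (Suc t) x)) =
      (\<Sum>x<(b * c) ^ t * (b * c). h (row_part b c (Suc t) x) (col_part b c (Suc t) x))"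
    by (simp add: mult.commute)
  also have "\<dots> = (\<Sum>x<(b * c) ^ t. \<Sum>y<b * c. h (y div c + b * row_part b c t x) (y mod c + c * col_part b c t x))"
  proof (subst sum_lessThan_mult, intro sum.cong refl)
    fix x y assume "y \<in> {..<b * c}"
    then have y: "y < b * c" by simp
    note div_mod_mult_add [OF y, of x]
    moreover have "(x * (b * c) + y) mod c = y mod c"
      using mod_mult_self3 [of "x * b" c y] by (simp add: mult_ac)
    ultimately show "h (row_part b c (Suc t) (x * (b * c) + y)) (col_part b c (Suc t) (x * (b * c) + y)) =
        h (y div c + b * row_part b c t x) (y mod c + c * col_part b c t x)"
      by simp
  qed
  also have "\<dots> = (\<Sum>i<b ^ t. \<Sum>j<c ^ t. \<Sum>y<b * c. h (y div c + b * i) (y mod c + c * j))"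
    by (rule Suc.IH)
  also have "\<dots> = (\<Sum>i<b ^ t. \<Sum>j<c ^ t. \<Sum>k<b. \<Sum>l<c. h (k + b * i) (l + c * j))"
    using c by (simp add: sum_lessThan_mult)
  also have "\<dots> = (\<Sum>i<b ^ t. \<Sum>k<b. \<Sum>j<c ^ t. \<Sum>l<c. h (i * b + k) (j * c + l))"
    by (rule sum.cong [OF refl], subst sum.swap) (simp add: mult.commute add.commute)
  also have "\<dots> = (\<Sum>i<b ^ t * b. \<Sum>j<c ^ t * c. h i j)"
    by (simp add: sum_lessThan_mult)
  finally show ?case by (simp add: mult.commute)
qed simp

lemma part_less: "x < (b * c) ^ t \<Longrightarrow> row_part b c t x < b ^ t \<and> col_part b c t x < c ^ t"
proof (induction t arbitrary: x)
  case (Suc t)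
  have pos: "b * c > 0" using Suc.prems by (cases "b * c") auto
  have "x div (b * c) < (b * c) ^ t"
    using Suc.prems by (intro less_mult_imp_div_less) (simp add: mult.commute)
  then have "row_part b c t (x div (b * c)) < b ^ t" "col_part b c t (x div (b * c)) < c ^ t"
    using Suc.IH by blast+
  moreover have "x mod (b * c) div c < b" using pos by (intro less_mult_imp_div_less) simp
  moreover have "x mod c < c" using pos by simp
  ultimately show ?case
    using mult_add_less [of "row_part b c t (x div (b * c))" "b ^ t" "x mod (b * c) div c" b]
      mult_add_less [of "col_part b c t (x div (b * c))" "c ^ t" "x mod c" c]
    by (simp add: algebra_simps)
qed simp

lemmas row_part_less = part_less [THEN conjunct1]
lemmas col_part_less = part_less [THEN conjunct2]

text \<open>These are Brent's equations for the multiplication of an \<open>N\<close> by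
  \<open>N\<close> and an \<open>N\<close> by \<open>M\<close> matrix with \<open>R\<close>
  products, modulo \<open>p\<close>. Coefficients in the prime field suffice for its extensions
  too.\<close>

definition bilinear_matmul :: "int \<Rightarrow> nat \<Rightarrow> nat \<Rightarrow> nat \<Rightarrow>
    (nat \<Rightarrow> nat \<Rightarrow> int) \<Rightarrow> (nat \<Rightarrow> nat \<Rightarrow> int) \<Rightarrow> (nat \<Rightarrow> nat \<Rightarrow> int) \<Rightarrow> bool" where
  "bilinear_matmul p N M R \<alpha> \<beta> \<gamma> \<longleftrightarrow>
     (\<forall>i<N. \<forall>j<N. \<forall>j'<N. \<forall>l<M. \<forall>i'<N. \<forall>l'<M.
        [(\<Sum>\<rho><R. \<alpha> \<rho> (i * N + j) * \<beta> \<rho> (j' * M + l) * \<gamma> \<rho> (i' * M + l')) =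
           of_bool (j = j' \<and> i = i' \<and> l = l')] (mod p))"

text \<open>The sum over products factors over the digits, and the index conditions for all digits
  together amount to equality of the composed indices.\<close>

lemma bilinear_matmul_tpow:
  assumes bil: "bilinear_matmul p N M R \<alpha> \<beta> \<gamma>"
    and xa: "xa < (N * N) ^ t" and xb: "xb < (N * M) ^ t" and xc: "xc < (N * M) ^ t"
  shows "[(\<Sum>\<rho><R ^ t. tpow \<alpha> (N * N) R t \<rho> xa * tpow \<beta> (N * M) R t \<rho> xb * tpow \<gamma> (N * M) R t \<rho> xc) =
     of_bool (col_part N N t xa = row_part N M t xb \<and> row_part N N t xa = row_part N M t xc \<and>
       col_part N M t xb = col_part N M t xc)] (mod p)"
  using xa xb xc
proof (induction t arbitrary: xa xb xc)
  case (Suc t)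
  have pos: "N > 0" "M > 0" using Suc.prems by (auto intro!: gr0I)
  define a where "a = xa mod (N * N)"
  define a' where "a' = xa div (N * N)"
  define b where "b = xb mod (N * M)"
  define b' where "b' = xb div (N * M)"
  define c where "c = xc mod (N * M)"
  define c' where "c' = xc div (N * M)"
  have a': "a' < (N * N) ^ t" and b': "b' < (N * M) ^ t" and c': "c' < (N * M) ^ t"
    unfolding a'_def b'_def c'_def using Suc.prems by (auto intro!: less_mult_imp_div_less simp: mult.commute)
  have lt: "a < N * N" "b < N * M" "c < N * M" using pos by (auto simp: a_def b_def c_def)
  let ?F = "\<lambda>t \<rho> a b c. tpow \<alpha> (N * N) R t \<rho> a * tpow \<beta> (N * M) R t \<rho> b * tpow \<gamma> (N * M) R t \<rho> c"
  have "(\<Sum>\<rho><R ^ Suc t. ?F (Suc t) \<rho> xa xb xc) = (\<Sum>\<rho><R ^ t * R. ?F (Suc t) \<rho> xa xb xc)"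
    by (simp add: mult.commute)
  also have "\<dots> = (\<Sum>\<rho><R ^ t. \<Sum>\<sigma><R. ?F t \<rho> a' b' c' * (\<alpha> \<sigma> a * \<beta> \<sigma> b * \<gamma> \<sigma> c))"
    unfolding sum_lessThan_mult
    by (intro sum.cong refl) (simp add: a_def b_def c_def a'_def b'_def c'_def)
  also have "\<dots> = (\<Sum>\<rho><R ^ t. ?F t \<rho> a' b' c') * (\<Sum>\<sigma><R. \<alpha> \<sigma> a * \<beta> \<sigma> b * \<gamma> \<sigma> c)"
    by (simp add: sum_product)
  also have "[\<dots> = of_bool (col_part N N t a' = row_part N M t b' \<and> row_part N N t a' = row_part N M t c' \<and>
       col_part N M t b' = col_part N M t c') * of_bool (a mod N = b div M \<and> a div N = c div M \<and> b mod M = c mod M)] (mod p)"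
  proof (rule cong_mult [OF Suc.IH [OF a' b' c']])
    have "a div N < N" "b div M < N" "c div M < N" using lt by (auto intro: less_mult_imp_div_less)
    moreover have "a mod N < N" "b mod M < M" "c mod M < M" using pos by auto
    ultimately have "[(\<Sum>\<sigma><R. \<alpha> \<sigma> (a div N * N + a mod N) * \<beta> \<sigma> (b div M * M + b mod M) * \<gamma> \<sigma> (c div M * M + c mod M)) =
         of_bool (a mod N = b div M \<and> a div N = c div M \<and> b mod M = c mod M)] (mod p)"
      using bil unfolding bilinear_matmul_def by blast
    then show "[(\<Sum>\<sigma><R. \<alpha> \<sigma> a * \<beta> \<sigma> b * \<gamma> \<sigma> c) =
         of_bool (a mod N = b div M \<and> a div N = c div M \<and> b mod M = c mod M)] (mod p)"
      by simp
  qed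
  also have "of_bool (col_part N N t a' = row_part N M t b' \<and> row_part N N t a' = row_part N M t c' \<and>
       col_part N M t b' = col_part N M t c') * of_bool (a mod N = b div M \<and> a div N = c div M \<and> b mod M = c mod M)
     = (of_bool (col_part N N (Suc t) xa = row_part N M (Suc t) xb \<and> row_part N N (Suc t) xa = row_part N M (Suc t) xc \<and>
       col_part N M (Suc t) xb = col_part N M (Suc t) xc) :: int)"
  proof -
    have eq: "(x + n * y = x' + n * y') \<longleftrightarrow> (x = x' \<and> y = y')" if "x < n" "x' < n" for x y x' y' n :: nat
    proof
      assume *: "x + n * y = x' + n * y'"
      have "(x + n * y) mod n = (x' + n * y') mod n" by (simp only: *)
      then have "x = x'" using that by simp
      with * that show "x = x' \<and> y = y'" by simp
    qed simp
    have "xa mod N = a mod N" "xb mod M = b mod M" "xc mod M = c mod M"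
      by (simp_all add: a_def b_def c_def mod_mod_cancel)
    moreover have "a div N < N" "b div M < N" "c div M < N" using lt by (auto intro: less_mult_imp_div_less)
    moreover have "a mod N < N" "b mod M < M" "c mod M < M" using pos by auto
    ultimately show ?thesis
      by (auto simp: eq a'_def [symmetric] b'_def [symmetric] c'_def [symmetric]
          a_def [symmetric] b_def [symmetric] c_def [symmetric])
  qed
  finally show ?case .
qed (simp add: of_bool_def)

lemma sum_of_bool_parts:
  fixes h :: "nat \<Rightarrow> nat \<Rightarrow> int"
  assumes "c > 0" "i < b ^ t" "j < c ^ t"
  shows "(\<Sum>x<(b * c) ^ t. of_bool (row_part b c t x = i \<and> col_part b c t x = j) * h (row_part b c t x) (col_part b c t x)) = h i j"
proof -
  have "(\<Sum>x<(b * c) ^ t. of_bool (row_part b c t x = i \<and> col_part b c t x = j) * h (row_part b c t x) (col_part b c t x)) =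
     (\<Sum>i'<b ^ t. \<Sum>j'<c ^ t. of_bool (i' = i \<and> j' = j) * h i' j')"
    using sum_parts [OF assms(1), of "\<lambda>i' j'. of_bool (i' = i \<and> j' = j) * h i' j'" b t] .
  also have "\<dots> = (\<Sum>i'<b ^ t. if i' = i then h i j else 0)"
  proof (rule sum.cong [OF refl])
    fix i'
    have "(\<Sum>j'<c ^ t. of_bool (i' = i \<and> j' = j) * h i' j') = (\<Sum>j'<c ^ t. if j' = j then (if i' = i then h i j else 0) else 0)"
      by (intro sum.cong) auto
    then show "(\<Sum>j'<c ^ t. of_bool (i' = i \<and> j' = j) * h i' j') = (if i' = i then h i j else 0)"
      using assms by simp
  qed
  also have "\<dots> = h i j" using assms by simp
  finally show ?thesis .
qed

text \<open>\<open>v\<close> is summed between the pointwise products and the output map: the latter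
  is linear, so \<open>k\<close> matrix products are added at the price of a single decoding.
  Multiplication in an extension field needs exactly such sums.\<close>

lemma matmul_via_tpow:
  fixes A B :: "nat \<Rightarrow> nat \<Rightarrow> nat \<Rightarrow> int"
  assumes bil: "bilinear_matmul p N M R \<alpha> \<beta> \<gamma>" and pos: "N > 0" "M > 0" and x: "x < (N * M) ^ t"
  shows "[(\<Sum>\<rho><R ^ t. tpow (\<lambda>x \<rho>. \<gamma> \<rho> x) R (N * M) t x \<rho> * (\<Sum>v<k.
      (\<Sum>a<(N * N) ^ t. tpow \<alpha> (N * N) R t \<rho> a * A v (row_part N N t a) (col_part N N t a)) *
      (\<Sum>b<(N * M) ^ t. tpow \<beta> (N * M) R t \<rho> b * B v (row_part N M t b) (col_part N M t b)))) =
    (\<Sum>v<k. \<Sum>j<N ^ t. A v (row_part N M t x) j * B v j (col_part N M t x))] (mod p)"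
    (is "[?lhs = _] (mod p)")
proof -
  let ?G = "tpow \<gamma> (N * M) R t" and ?Al = "tpow \<alpha> (N * N) R t" and ?Be = "tpow \<beta> (N * M) R t"
  let ?A = "\<lambda>v a. A v (row_part N N t a) (col_part N N t a)"
  let ?B = "\<lambda>v b. B v (row_part N M t b) (col_part N M t b)"
  let ?i = "row_part N M t x" and ?l = "col_part N M t x"
  have "?lhs = (\<Sum>\<rho><R ^ t. \<Sum>v<k. \<Sum>a<(N * N) ^ t. \<Sum>b<(N * M) ^ t. ?Al \<rho> a * ?Be \<rho> b * ?G \<rho> x * (?A v a * ?B v b))"
    unfolding tpow_transpose [of \<gamma>] sum_product unfolding sum_distrib_left
    by (intro sum.cong refl) (simp add: mult_ac)
  also have "\<dots> = (\<Sum>v<k. \<Sum>\<rho><R ^ t. \<Sum>a<(N * N) ^ t. \<Sum>b<(N * M) ^ t. ?Al \<rho> a * ?Be \<rho> b * ?G \<rho> x * (?A v a * ?B v b))"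
    by (rule sum.swap)
  also have "\<dots> = (\<Sum>v<k. \<Sum>a<(N * N) ^ t. \<Sum>\<rho><R ^ t. \<Sum>b<(N * M) ^ t. ?Al \<rho> a * ?Be \<rho> b * ?G \<rho> x * (?A v a * ?B v b))"
    by (intro sum.cong refl sum.swap)
  also have "\<dots> = (\<Sum>v<k. \<Sum>a<(N * N) ^ t. \<Sum>b<(N * M) ^ t. \<Sum>\<rho><R ^ t. ?Al \<rho> a * ?Be \<rho> b * ?G \<rho> x * (?A v a * ?B v b))"
    by (intro sum.cong refl sum.swap)
  also have "\<dots> = (\<Sum>v<k. \<Sum>a<(N * N) ^ t. \<Sum>b<(N * M) ^ t. (\<Sum>\<rho><R ^ t. ?Al \<rho> a * ?Be \<rho> b * ?G \<rho> x) * (?A v a * ?B v b))"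
    (is "_ = ?S1")
    by (simp only: sum_distrib_right)
  finally have 1: "?lhs = ?S1" .
  have 2: "[?S1 = (\<Sum>v<k. \<Sum>a<(N * N) ^ t. \<Sum>b<(N * M) ^ t.
      of_bool (col_part N N t a = row_part N M t b \<and> row_part N N t a = ?i \<and> col_part N M t b = ?l) * (?A v a * ?B v b))] (mod p)"
    using x by (intro cong_sum cong_mult cong_refl bilinear_matmul_tpow [OF bil]) auto
  have 3: "(\<Sum>v<k. \<Sum>a<(N * N) ^ t. \<Sum>b<(N * M) ^ t.
      of_bool (col_part N N t a = row_part N M t b \<and> row_part N N t a = ?i \<and> col_part N M t b = ?l) * (?A v a * ?B v b)) =
      (\<Sum>v<k. \<Sum>j<N ^ t. A v ?i j * B v j ?l)"
  proof (rule sum.cong [OF refl])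
    fix v assume "v \<in> {..<k}"
    have "(\<Sum>a<(N * N) ^ t. \<Sum>b<(N * M) ^ t.
        of_bool (col_part N N t a = row_part N M t b \<and> row_part N N t a = ?i \<and> col_part N M t b = ?l) * (?A v a * ?B v b)) =
      (\<Sum>a<(N * N) ^ t. of_bool (row_part N N t a = ?i) * ?A v a * (\<Sum>b<(N * M) ^ t.
        of_bool (row_part N M t b = col_part N N t a \<and> col_part N M t b = ?l) * ?B v b))"
    proof (intro sum.cong refl)
      fix a
      have "(\<Sum>b<(N * M) ^ t. of_bool (row_part N M t b = col_part N N t a \<and> col_part N M t b = ?l) * ?B v b) =
          (\<Sum>b<(N * M) ^ t. of_bool (col_part N N t a = row_part N M t b) * of_bool (col_part N M t b = ?l) * ?B v b)"
        unfolding of_bool_conj by (intro sum.cong refl) (simp only: eq_commute [of "col_part N N t a"])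
      then show "(\<Sum>b<(N * M) ^ t.
          of_bool (col_part N N t a = row_part N M t b \<and> row_part N N t a = ?i \<and> col_part N M t b = ?l) * (?A v a * ?B v b)) =
        of_bool (row_part N N t a = ?i) * ?A v a * (\<Sum>b<(N * M) ^ t.
          of_bool (row_part N M t b = col_part N N t a \<and> col_part N M t b = ?l) * ?B v b)"
        by (simp only: of_bool_conj sum_distrib_left mult_ac)
    qed
    also have "\<dots> = (\<Sum>a<(N * N) ^ t. of_bool (row_part N N t a = ?i) * ?A v a * B v (col_part N N t a) ?l)"
    proof (intro sum.cong refl)
      fix a assume "a \<in> {..<(N * N) ^ t}"
      then have "col_part N N t a < N ^ t" by (simp add: col_part_less)
      from sum_of_bool_parts [OF pos(2) this col_part_less [OF x], of "B v"]
      show "of_bool (row_part N N t a = ?i) * ?A v a * (\<Sum>b<(N * M) ^ t.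
          of_bool (row_part N M t b = col_part N N t a \<and> col_part N M t b = ?l) * ?B v b) =
        of_bool (row_part N N t a = ?i) * ?A v a * B v (col_part N N t a) ?l"
        by simp
    qed
    also have "\<dots> = (\<Sum>i<N ^ t. \<Sum>j<N ^ t. of_bool (i = ?i) * A v i j * B v j ?l)"
      using sum_parts [of N "\<lambda>i j. of_bool (i = ?i) * A v i j * B v j ?l" N t] pos by simp
    also have "\<dots> = (\<Sum>j<N ^ t. \<Sum>i<N ^ t. if i = ?i then A v ?i j * B v j ?l else 0)"
      by (subst sum.swap) (intro sum.cong refl, auto)
    also have "\<dots> = (\<Sum>j<N ^ t. A v ?i j * B v j ?l)"
      using row_part_less [OF x] by simp
    finally show "(\<Sum>a<(N * N) ^ t. \<Sum>b<(N * M) ^ t.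
        of_bool (col_part N N t a = row_part N M t b \<and> row_part N N t a = ?i \<and> col_part N M t b = ?l) * (?A v a * ?B v b)) =
      (\<Sum>j<N ^ t. A v ?i j * B v j ?l)" .
  qed
  show ?thesis unfolding 1 using 2 unfolding 3 .
qed

section \<open>Isolating families\<close>

text \<open>The ratio is at most the \<open>m\<close>-th power of exp (1 / (b - 1)), hence at most e
  because \<open>m\<close> is at most \<open>b - 1\<close>; 4 is an integer above e.\<close>

lemma power_le_4_mult_power:
  fixes b m :: nat
  assumes "m < b" "2 \<le> b"
  shows "b ^ m \<le> 4 * (b - 1) ^ m"
proof -
  have pos: "real (b - 1) > 0" using assms by simp
  have "(real b / real (b - 1)) ^ m = (1 + 1 / real (b - 1)) ^ m"
    using assms by (simp add: field_simps of_nat_diff)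
  also have "\<dots> \<le> exp (1 / real (b - 1)) ^ m"
    using pos by (intro power_mono exp_ge_add_one_self) (auto simp: add_nonneg_nonneg)
  also have "\<dots> = exp (real m / real (b - 1))" by (simp add: exp_of_nat_mult [symmetric])
  also have "\<dots> \<le> exp 1" using assms pos by (simp add: field_simps)
  also have "\<dots> \<le> 3" by (rule exp_le)
  finally have "real b ^ m \<le> 3 * real (b - 1) ^ m"
    using pos by (simp add: power_divide field_simps)
  also have "\<dots> \<le> 4 * real (b - 1) ^ m" by (intro mult_right_mono) auto
  finally have "real (b ^ m) \<le> real (4 * (b - 1) ^ m)" by simp
  then show ?thesis by (simp only: of_nat_le_iff)
qed

text \<open>A random map to \<open>b\<close> colours isolates \<open>X\<close> in colour \<open>0\<close> with probability at least \<open>1/8\<close>.\<close>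

lemma card_isolating_maps:
  fixes N b :: nat
  assumes X: "X \<subseteq> {..<N}" "card X \<le> b" "b \<le> 2 * card X" and b: "2 \<le> b"
  shows "b ^ N \<le> 8 * card {f \<in> {..<N} \<rightarrow>\<^sub>E {..<b}. card {x \<in> X. f x = 0} = 1}"
proof -
  define m where "m = card X - 1"
  have fin: "finite X" using X(1) finite_subset by blast
  have card: "card X = Suc m" using X(3) b by (simp add: m_def)
  \<comment> \<open>\<open>S x\<close> contains the maps whose only zero on \<open>X\<close> is
    \<open>x\<close>; distinct \<open>x\<close> give disjoint sets, so their sizes add up.\<close>
  define S where "S x = (\<Pi>\<^sub>E y\<in>{..<N}. if y = x then {0} else if y \<in> X then {1..<b} else {..<b})" for x
  have finS: "finite (S x)" for x unfolding S_def by (intro finite_PiE) auto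
  have cardS: "card (S x) = (b - 1) ^ m * b ^ (N - Suc m)" if x: "x \<in> X" for x
  proof -
    have "card (S x) = (\<Prod>y\<in>{..<N}. if y = x then 1 else if y \<in> X then b - 1 else b)"
      unfolding S_def by (subst card_PiE) (auto intro!: prod.cong)
    also have "{..<N} = insert x ((X - {x}) \<union> ({..<N} - X))" using x X by auto
    also have "(\<Prod>y\<in>insert x ((X - {x}) \<union> ({..<N} - X)). if y = x then 1 else if y \<in> X then b - 1 else b) =
        (\<Prod>y\<in>(X - {x}) \<union> ({..<N} - X). if y = x then 1 else if y \<in> X then b - 1 else b)"
      using fin x by (subst prod.insert) auto
    also have "\<dots> = (\<Prod>y\<in>X - {x}. if y = x then 1 else if y \<in> X then b - 1 else b) *
        (\<Prod>y\<in>{..<N} - X. if y = x then 1 else if y \<in> X then b - 1 else b)"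
      using fin by (intro prod.union_disjoint) auto
    also have "(\<Prod>y\<in>X - {x}. if y = x then 1 else if y \<in> X then b - 1 else b) = (\<Prod>y\<in>X - {x}. b - 1)"
      by (intro prod.cong) auto
    also have "(\<Prod>y\<in>{..<N} - X. if y = x then 1 else if y \<in> X then b - 1 else b) = (\<Prod>y\<in>{..<N} - X. b)"
      using x by (intro prod.cong) auto
    also have "card ({..<N} - X) = N - Suc m" using X(1) fin card by (simp add: card_Diff_subset)
    ultimately show ?thesis using card x fin by (simp add: card_Diff_subset)
  qed
  have disj: "S x \<inter> S y = {}" if "x \<in> X" "y \<in> X" "x \<noteq> y" for x y
  proof (rule ccontr)
    assume "S x \<inter> S y \<noteq> {}"
    then obtain f where f: "f \<in> S x" "f \<in> S y" by blast
    have "x \<in> {..<N}" using that X(1) by blast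
    from PiE_mem [OF f(1) [unfolded S_def] this] PiE_mem [OF f(2) [unfolded S_def] this] that
    show False by simp
  qed
  have sub: "(\<Union>x\<in>X. S x) \<subseteq> {f \<in> {..<N} \<rightarrow>\<^sub>E {..<b}. card {x \<in> X. f x = 0} = 1}"
  proof (rule UN_least, rule subsetI, rule CollectI, rule conjI)
    fix x f assume x: "x \<in> X" and f: "f \<in> S x"
    have val: "f y \<in> (if y = x then {0} else if y \<in> X then {1..<b} else {..<b})" if "y < N" for y
      using PiE_mem [OF f [unfolded S_def], of y] that by simp
    have "f y \<in> {..<b}" if "y < N" for y
      using val [OF that] b by (auto split: if_splits)
    moreover have "f y = undefined" if "\<not> y < N" for y
      using PiE_arb [OF f [unfolded S_def], of y] that by simp
    ultimately show "f \<in> {..<N} \<rightarrow>\<^sub>E {..<b}" by (auto intro!: PiE_I)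
  next
    fix x f assume x: "x \<in> X" and f: "f \<in> S x"
    have val: "f y \<in> (if y = x then {0} else if y \<in> X then {1..<b} else {..<b})" if "y < N" for y
      using PiE_mem [OF f [unfolded S_def], of y] that by simp
    have "{y \<in> X. f y = 0} = {x}"
    proof safe
      fix y assume "y \<in> X" "f y = 0"
      moreover have "y < N" using \<open>y \<in> X\<close> X(1) by auto
      ultimately show "y = x" using val [of y] by (auto split: if_splits)
    next
      show "x \<in> X" by (rule x)
      show "f x = 0" using val [of x] x X(1) by auto
    qed
    then show "card {y \<in> X. f y = 0} = 1" by simp
  qed
  have fin': "finite {f \<in> {..<N} \<rightarrow>\<^sub>E {..<b}. card {x \<in> X. f x = 0} = 1}"
    by (rule finite_subset [OF _ finite_PiE [of "{..<N}" "\<lambda>_. {..<b}"]]) auto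
  have N: "N = Suc m + (N - Suc m)"
    using card_mono [OF _ X(1)] card by simp
  have "b ^ N = b * b ^ m * b ^ (N - Suc m)"
    by (subst N) (simp add: power_add)
  \<comment> \<open>The first factor \<open>b\<close> is at most \<open>2 * card X\<close>, and 4
    comes from \<open>power_le_4_mult_power\<close>; their product is the 8 of the claim.\<close>
  also have "\<dots> \<le> (2 * Suc m) * (4 * (b - 1) ^ m) * b ^ (N - Suc m)"
    using X b card by (intro mult_mono power_le_4_mult_power) auto
  also have "\<dots> = 8 * (\<Sum>x\<in>X. card (S x))"
    using cardS card by (simp add: algebra_simps)
  also have "(\<Sum>x\<in>X. card (S x)) = card (\<Union>x\<in>X. S x)"
    using fin finS disj by (intro card_UN_disjoint [symmetric]) auto
  also have "\<dots> \<le> card {f \<in> {..<N} \<rightarrow>\<^sub>E {..<b}. card {x \<in> X. f x = 0} = 1}"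
    using sub fin' by (rule card_mono [rotated])
  finally show ?thesis by simp
qed

text \<open>Averaging: every member of \<open>\<X>\<close> is isolated by at least one eighth of all
  colourings, so some colouring isolates at least one eighth of \<open>\<X>\<close>; its colour
  class 0 is \<open>T\<close>.\<close>

lemma ex_isolating_set:
  fixes N b :: nat
  assumes fin: "finite \<X>" and b: "2 \<le> b"
    and X: "\<And>X. X \<in> \<X> \<Longrightarrow> X \<subseteq> {..<N} \<and> card X \<le> b \<and> b \<le> 2 * card X"
  shows "\<exists>T. card \<X> \<le> 8 * card {X \<in> \<X>. card (T \<inter> X) = 1}"
proof (rule ccontr)
  assume neg: "\<not> ?thesis"
  define F where "F = ({..<N} \<rightarrow>\<^sub>E {..<b})"
  have finF: "finite F" by (simp add: F_def finite_PiE)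
  have cardF: "card F = b ^ N" by (simp add: F_def card_PiE)
  have set_eq: "{y. f y = 0} \<inter> X = {y \<in> X. f y = 0}" for f :: "nat \<Rightarrow> nat" and X by auto
  have lt: "8 * card {X \<in> \<X>. card {y \<in> X. f y = 0} = 1} < card \<X>" for f :: "nat \<Rightarrow> nat"
  proof -
    have "\<not> card \<X> \<le> 8 * card {X \<in> \<X>. card ({y. f y = 0} \<inter> X) = 1}"
      using neg by blast
    then show ?thesis unfolding set_eq by simp
  qed
  have "card \<X> * b ^ N = (\<Sum>X\<in>\<X>. b ^ N)" by simp
  also have "\<dots> \<le> (\<Sum>X\<in>\<X>. 8 * card {f \<in> F. card {x \<in> X. f x = 0} = 1})"
    unfolding F_def using X b by (intro sum_mono card_isolating_maps) auto
  also have "\<dots> = 8 * (\<Sum>f\<in>F. card {X \<in> \<X>. card {x \<in> X. f x = 0} = 1})"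
  proof -
    have "(\<Sum>X\<in>\<X>. card {f \<in> F. card {x \<in> X. f x = 0} = 1}) =
        (\<Sum>X\<in>\<X>. \<Sum>f\<in>F. of_bool (card {x \<in> X. f x = 0} = 1))"
      using finF by (simp add: Collect_conj_eq)
    also have "\<dots> = (\<Sum>f\<in>F. \<Sum>X\<in>\<X>. of_bool (card {x \<in> X. f x = 0} = 1))"
      by (rule sum.swap)
    also have "\<dots> = (\<Sum>f\<in>F. card {X \<in> \<X>. card {x \<in> X. f x = 0} = 1})"
      using fin by (simp add: Collect_conj_eq)
    finally show ?thesis by (simp only: sum_distrib_left [symmetric])
  qed
  also have "\<dots> = (\<Sum>f\<in>F. 8 * card {X \<in> \<X>. card {x \<in> X. f x = 0} = 1})"
    by (rule sum_distrib_left)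
  also have "\<dots> < (\<Sum>f\<in>F. card \<X>)"
    using lt finF cardF b by (intro sum_strict_mono) (auto simp: card_gt_0_iff)
  also have "\<dots> = card \<X> * b ^ N" using cardF by simp
  finally show False by simp
qed

text \<open>Greedy choice: each new set leaves at most seven eighths of the members unserved, and
  the last hypothesis says that fewer than one is left after \<open>r\<close> rounds.\<close>

lemma ex_isolating_list:
  fixes N b :: nat
  assumes "finite \<X>" "2 \<le> b" "\<And>X. X \<in> \<X> \<Longrightarrow> X \<subseteq> {..<N} \<and> card X \<le> b \<and> b \<le> 2 * card X"
    and "card \<X> * 7 ^ r < 8 ^ r"
  shows "\<exists>Ts :: nat set list. length Ts = r \<and> (\<forall>X\<in>\<X>. \<exists>T\<in>set Ts. card (T \<inter> X) = 1)"
  using assms(1,3,4)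
proof (induction r arbitrary: \<X>)
  case 0
  then show ?case by auto
next
  case (Suc r)
  obtain T where T: "card \<X> \<le> 8 * card {X \<in> \<X>. card (T \<inter> X) = 1}"
    using ex_isolating_set [OF Suc.prems(1) assms(2) Suc.prems(2)] by blast
  define \<Y> where "\<Y> = {X \<in> \<X>. card (T \<inter> X) \<noteq> 1}"
  have Y: "finite \<Y>" "\<Y> \<subseteq> \<X>" using Suc.prems(1) by (auto simp: \<Y>_def)
  have "\<X> = {X \<in> \<X>. card (T \<inter> X) = 1} \<union> \<Y>" by (auto simp: \<Y>_def)
  moreover have "card ({X \<in> \<X>. card (T \<inter> X) = 1} \<union> \<Y>) = card {X \<in> \<X>. card (T \<inter> X) = 1} + card \<Y>"
    using Suc.prems(1) by (intro card_Un_disjoint) (auto simp: \<Y>_def)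
  ultimately have "card \<X> = card {X \<in> \<X>. card (T \<inter> X) = 1} + card \<Y>" by metis
  with T have "8 * card \<Y> \<le> 7 * card \<X>" by linarith
  then have "8 * card \<Y> * 7 ^ r \<le> 7 * card \<X> * 7 ^ r" by (intro mult_right_mono) auto
  also have "\<dots> = card \<X> * 7 ^ Suc r" by simp
  also have "\<dots> < 8 ^ Suc r" by (rule Suc.prems(3))
  finally have "card \<Y> * 7 ^ r < 8 ^ r" by simp
  then obtain Ts where "length Ts = r" "\<forall>X\<in>\<Y>. \<exists>T\<in>set Ts. card (T \<inter> X) = 1"
    using Suc.IH [OF Y(1)] Suc.prems(2) Y(2) by (metis subsetD)
  then have "length (T # Ts) = Suc r \<and> (\<forall>X\<in>\<X>. \<exists>T'\<in>set (T # Ts). card (T' \<inter> X) = 1)"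
    by (auto simp: \<Y>_def)
  then show ?case by blast
qed

text \<open>Every such \<open>X\<close> is the image of a map from \<open>{..<b}\<close> to
  \<open>{..<N}\<close>; surplus arguments repeat one element, which is where nonemptiness
  enters.\<close>

lemma card_small_subsets_le:
  fixes N b :: nat
  shows "card {X. X \<subseteq> {..<N} \<and> X \<noteq> {} \<and> card X \<le> b} \<le> N ^ b"
proof -
  have "{X. X \<subseteq> {..<N} \<and> X \<noteq> {} \<and> card X \<le> b} \<subseteq> (\<lambda>f. f ` {..<b}) ` ({..<b} \<rightarrow>\<^sub>E {..<N})"
  proof
    fix X assume "X \<in> {X. X \<subseteq> {..<N} \<and> X \<noteq> {} \<and> card X \<le> b}"
    then have X: "X \<subseteq> {..<N}" "X \<noteq> {}" "card X \<le> b" by auto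
    have fin: "finite X" using X(1) finite_subset by blast
    then obtain h where h: "bij_betw h {0..<card X} X" using ex_bij_betw_nat_finite by blast
    have pos: "0 < card X" using fin X(2) by (simp add: card_gt_0_iff)
    define f where "f = (\<lambda>y. if y < b then (if y < card X then h y else h 0) else undefined)"
    have hX: "h ` {0..<card X} = X" using h by (simp add: bij_betw_def)
    have "f ` {..<b} = X"
    proof safe
      fix y assume "y < b" then show "f y \<in> X" using hX pos by (auto simp: f_def)
    next
      fix x assume "x \<in> X"
      then obtain y where "y < card X" "x = h y" using hX by (metis atLeastLessThan_iff imageE)
      then show "x \<in> f ` {..<b}" using X(3) by (intro image_eqI [of _ _ y]) (auto simp: f_def)
    qed
    moreover have "f \<in> {..<b} \<rightarrow>\<^sub>E {..<N}"
    proof (intro PiE_I)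
      fix y assume "y \<in> {..<b}"
      then have "f y \<in> f ` {..<b}" by blast
      then show "f y \<in> {..<N}" using \<open>f ` {..<b} = X\<close> X(1) by blast
    qed (simp add: f_def)
    ultimately show "X \<in> (\<lambda>f. f ` {..<b}) ` ({..<b} \<rightarrow>\<^sub>E {..<N})" by blast
  qed
  then have "card {X. X \<subseteq> {..<N} \<and> X \<noteq> {} \<and> card X \<le> b} \<le> card ((\<lambda>f. f ` {..<b}) ` ({..<b} \<rightarrow>\<^sub>E {..<N}))"
    by (intro card_mono finite_imageI finite_PiE) auto
  also have "\<dots> \<le> card ({..<b} \<rightarrow>\<^sub>E {..<N})" by (intro card_image_le finite_PiE) auto
  also have "\<dots> = N ^ b" by (simp add: card_PiE)
  finally show ?thesis .
qed

text \<open>With \<open>b = 2 ^ Suc i\<close> there are at most \<open>2 ^ (l * b)\<close> sets to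
  isolate, and \<open>6 * (l * b)\<close> greedy rounds suffice because 2 * 7^6 < 8^6. This is the
  origin of \<open>12 * l * 2 ^ i\<close>.\<close>

lemma ex_isolating_level:
  fixes l i :: nat
  assumes l: "l \<ge> 1"
  shows "\<exists>Ts :: nat set list. length Ts = 12 * l * 2 ^ i \<and>
    (\<forall>X. X \<subseteq> {..<2 ^ l} \<and> 2 ^ i \<le> card X \<and> card X < 2 ^ Suc i \<longrightarrow> (\<exists>T\<in>set Ts. card (T \<inter> X) = 1))"
proof -
  define b :: nat where "b = 2 ^ Suc i"
  define \<X> where "\<X> = {X. X \<subseteq> {..<(2::nat) ^ l} \<and> 2 ^ i \<le> card X \<and> card X < 2 ^ Suc i}"
  have fin: "finite \<X>" unfolding \<X>_def by (rule finite_subset [of _ "Pow {..<2 ^ l}"]) auto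
  have "\<X> \<subseteq> {X. X \<subseteq> {..<2 ^ l} \<and> X \<noteq> {} \<and> card X \<le> b}"
    by (auto simp: \<X>_def b_def)
  then have "card \<X> \<le> card {X. X \<subseteq> {..<(2::nat) ^ l} \<and> X \<noteq> {} \<and> card X \<le> b}"
    by (intro card_mono) (rule finite_subset [of _ "Pow {..<2 ^ l}"], auto)
  also have "\<dots> \<le> (2 ^ l) ^ b" by (rule card_small_subsets_le)
  finally have le: "card \<X> \<le> 2 ^ (l * b)" by (simp add: power_mult)
  have lb: "l * b > 0" using l by (simp add: b_def)
  have "card \<X> * 7 ^ (6 * (l * b)) \<le> 2 ^ (l * b) * 7 ^ (6 * (l * b))" using le by (rule mult_right_mono) simp
  also have "\<dots> = (2 * 7 ^ 6) ^ (l * b)"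
    by (simp only: power_mult_distrib power_mult [of 7 6 "l * b"])
  also have "\<dots> < (8 ^ 6) ^ (l * b)" using lb by (intro power_strict_mono) auto
  also have "\<dots> = 8 ^ (6 * (l * b))" by (rule power_mult [symmetric])
  finally have lt: "card \<X> * 7 ^ (6 * (l * b)) < 8 ^ (6 * (l * b))" .
  have X: "X \<subseteq> {..<2 ^ l} \<and> card X \<le> b \<and> b \<le> 2 * card X" if "X \<in> \<X>" for X
    using that by (auto simp: \<X>_def b_def)
  have "2 \<le> b" by (simp add: b_def)
  from ex_isolating_list [OF fin this X lt]
  obtain Ts where Ts: "length Ts = 6 * (l * b)" "\<forall>X\<in>\<X>. \<exists>T\<in>set Ts. card (T \<inter> X) = 1" by blast
  then show ?thesis by (intro exI [of _ Ts]) (auto simp: \<X>_def b_def)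
qed

text \<open>The sets of level \<open>i\<close> get weight \<open>2 ^ i\<close>, which is at most the
  size of every \<open>X\<close> they serve; as there are \<open>12 * l * 2 ^ i\<close> of them,
  each of the \<open>l + 1\<close> levels contributes \<open>12 * l\<close> to the sum of
  reciprocals. Weight 1 at index 0 lets leading zeros of a digit string leave its weight
  unchanged.\<close>

lemma ex_isolating_family:
  fixes l :: nat
  assumes l: "l \<ge> 1"
  shows "\<exists>G (w :: nat \<Rightarrow> nat) (T :: nat \<Rightarrow> nat set).
    w 0 = 1 \<and> 2 \<le> G \<and> (\<forall>j<G. 1 \<le> w j \<and> w j \<le> 2 ^ l) \<and>
    (\<Sum>j<G. 1 / real (w j)) \<le> 12 * real l * (real l + 1) \<and>
    (\<forall>X. X \<subseteq> {..<2 ^ l} \<and> X \<noteq> {} \<longrightarrow> (\<exists>j<G. w j \<le> card X \<and> card (T j \<inter> X) = 1))"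
proof -
  obtain Ts :: "nat \<Rightarrow> nat set list" where len: "\<And>i. length (Ts i) = 12 * l * 2 ^ i"
    and iso: "\<And>i X. X \<subseteq> {..<2 ^ l} \<and> 2 ^ i \<le> card X \<and> card X < 2 ^ Suc i \<Longrightarrow> (\<exists>T\<in>set (Ts i). card (T \<inter> X) = 1)"
    using ex_isolating_level [OF l] by metis
  define Rs :: "(nat \<times> nat set) list" where "Rs = concat (map (\<lambda>i. map (\<lambda>T. (2 ^ i, T)) (Ts i)) [0..<Suc l])"
  \<comment> \<open>Level 0 is split off to show that the first member has weight 1.\<close>
  have Rs_eq: "Rs = map (\<lambda>T. (1, T)) (Ts 0) @ concat (map (\<lambda>i. map (\<lambda>T. (2 ^ i, T)) (Ts i)) [Suc 0..<Suc l])"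
    unfolding Rs_def by (subst upt_conv_Cons) auto
  have "length (Ts 0) \<ge> 2" using l by (simp add: len)
  then have Rs_0: "fst (Rs ! 0) = 1" "2 \<le> length Rs"
    unfolding Rs_eq by (cases "Ts 0"; simp)+
  have setRs: "set Rs = {(2 ^ i, T) | i T. i \<le> l \<and> T \<in> set (Ts i)}"
    unfolding Rs_def by fastforce
  have "(\<Sum>j<length Rs. 1 / real (fst (Rs ! j))) = (\<Sum>x\<leftarrow>Rs. 1 / real (fst x))"
    by (simp add: sum_list_sum_nth lessThan_atLeast0)
  also have "\<dots> = (\<Sum>i\<leftarrow>[0..<Suc l]. \<Sum>x\<leftarrow>map (\<lambda>T. (2 ^ i, T)) (Ts i). 1 / real (fst x))"
    unfolding Rs_def by (induction l) auto
  also have "\<dots> = (\<Sum>i\<leftarrow>[0..<Suc l]. 12 * real l)"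
    by (intro arg_cong [of _ _ sum_list] map_cong refl) (simp add: o_def sum_list_triv len)
  also have "\<dots> = 12 * real l * (real l + 1)" by (simp add: sum_list_triv algebra_simps)
  finally have sum: "(\<Sum>j<length Rs. 1 / real (fst (Rs ! j))) = 12 * real l * (real l + 1)" .
  have bounds: "1 \<le> fst (Rs ! j) \<and> fst (Rs ! j) \<le> 2 ^ l" if "j < length Rs" for j
  proof -
    from that have "Rs ! j \<in> set Rs" by (rule nth_mem)
    then show ?thesis unfolding setRs by auto
  qed
  have "\<exists>j<length Rs. fst (Rs ! j) \<le> card X \<and> card (snd (Rs ! j) \<inter> X) = 1"
    if X: "X \<subseteq> {..<2 ^ l}" "X \<noteq> {}" for X
  proof -
    have fin: "finite X" using X(1) finite_subset by blast
    then have "1 \<le> card X" using X(2) by (simp add: Suc_le_eq card_gt_0_iff)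
    then obtain i where i: "2 ^ i \<le> card X" "card X < 2 ^ (i + 1)"
      using ex_power_ivl1 [of 2 "card X"] by auto
    have "card X \<le> 2 ^ l" using card_mono [OF _ X(1)] by simp
    then have "(2::nat) ^ i \<le> 2 ^ l" using i by linarith
    then have "i \<le> l" by simp
    moreover obtain T where "T \<in> set (Ts i)" "card (T \<inter> X) = 1" using iso [of X i] X(1) i by auto
    ultimately have "(2 ^ i, T) \<in> set Rs" unfolding setRs by blast
    then obtain j where "j < length Rs" "Rs ! j = (2 ^ i, T)" by (auto simp: in_set_conv_nth)
    then show ?thesis using i \<open>card (T \<inter> X) = 1\<close> by (intro exI [of _ j]) auto
  qed
  then show ?thesis using sum bounds Rs_0
    by (intro exI [of _ "length Rs"] exI [of _ "\<lambda>j. fst (Rs ! j)"] exI [of _ "\<lambda>j. snd (Rs ! j)"]) simp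
qed

section \<open>Weights and detection in tensor powers of an isolating family\<close>

primrec weight :: "(nat \<Rightarrow> nat) \<Rightarrow> nat \<Rightarrow> nat \<Rightarrow> nat \<Rightarrow> nat" where
  "weight w G 0 j = 1"
| "weight w G (Suc t) j = w (j mod G) * weight w G t (j div G)"

text \<open>Each counted \<open>j\<close> contributes at least 1 to \<open>S\<close> times the sum
  of reciprocal weights, and that sum over all digit strings factors into a \<open>t\<close>-th
  power.\<close>

lemma card_weight_le:
  fixes w :: "nat \<Rightarrow> nat"
  assumes w: "\<And>j. j < G \<Longrightarrow> 1 \<le> w j"
  shows "real (card {j. j < G ^ t \<and> weight w G t j \<le> S}) \<le> real S * (\<Sum>j<G. 1 / real (w j)) ^ t"
proof -
  have pos: "weight w G t j > 0" if "j < G ^ t" for t j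
    using that
  proof (induction t arbitrary: j)
    case (Suc t)
    then have "G > 0" by (cases G) auto
    moreover have "j div G < G ^ t" using Suc.prems by (intro less_mult_imp_div_less) (simp add: mult.commute)
    ultimately show ?case using Suc.IH w [of "j mod G"] by simp
  qed simp
  have sum: "(\<Sum>j<G ^ t. 1 / real (weight w G t j)) = (\<Sum>j<G. 1 / real (w j)) ^ t" for t
  proof (induction t)
    case (Suc t)
    have "(\<Sum>j<G ^ Suc t. 1 / real (weight w G (Suc t) j)) = (\<Sum>j<G ^ t * G. 1 / real (weight w G (Suc t) j))"
      by (simp add: mult.commute)
    also have "\<dots> = (\<Sum>j<G ^ t. \<Sum>a<G. 1 / real (weight w G t j) * (1 / real (w a)))"
      unfolding sum_lessThan_mult by (intro sum.cong refl) (simp add: div_mod_mult_add)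
    also have "\<dots> = (\<Sum>j<G ^ t. 1 / real (weight w G t j)) * (\<Sum>a<G. 1 / real (w a))"
      by (rule sum_product [symmetric])
    finally show ?case using Suc.IH by simp
  qed simp
  have "real (card {j. j < G ^ t \<and> weight w G t j \<le> S}) = (\<Sum>j\<in>{j. j < G ^ t \<and> weight w G t j \<le> S}. 1)"
    by simp
  also have "\<dots> \<le> (\<Sum>j\<in>{j. j < G ^ t \<and> weight w G t j \<le> S}. real S * (1 / real (weight w G t j)))"
    using pos by (intro sum_mono) (auto simp: field_simps)
  also have "\<dots> \<le> (\<Sum>j<G ^ t. real S * (1 / real (weight w G t j)))"
    by (intro sum_mono2) auto
  also have "\<dots> = real S * (\<Sum>j<G. 1 / real (w j)) ^ t"
    by (simp only: sum_distrib_left [symmetric] sum)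
  finally show ?thesis .
qed

text \<open>Split \<open>v\<close> into blocks of \<open>N\<close> consecutive entries. For the
  nonzero block \<open>y0\<close> of smallest support \<open>X y0\<close> choose an isolating
  \<open>T j0\<close>; contracting every block with it gives a vector \<open>u\<close> that is
  nonzero at \<open>y0\<close> and supported in the set \<open>Y\<close> of nonzero blocks. Since
  \<open>card (X y0) * card Y\<close> is at most the size of the support of \<open>v\<close>, the
  weight of \<open>j0\<close> and the weight found recursively for \<open>u\<close> multiply within
  the bound.\<close>

lemma tpow_detects:
  fixes v :: "nat \<Rightarrow> int" and p :: int
  assumes iso: "\<And>X. X \<subseteq> {..<N} \<Longrightarrow> X \<noteq> {} \<Longrightarrow> \<exists>j<G. w j \<le> card X \<and> card (T j \<inter> X) = 1"
    and ne: "{x. x < N ^ t \<and> \<not> p dvd v x} \<noteq> {}"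
  shows "\<exists>j<G ^ t. weight w G t j \<le> card {x. x < N ^ t \<and> \<not> p dvd v x} \<and>
    \<not> p dvd (\<Sum>x<N ^ t. tpow (\<lambda>j x. of_bool (x \<in> T j)) N G t j x * v x)"
  using ne
proof (induction t arbitrary: v)
  case 0
  then have *: "{x. x < N ^ 0 \<and> \<not> p dvd v x} = {0}" by auto
  then have "\<not> p dvd v 0" by blast
  then show ?case unfolding * by (auto simp: lessThan_Suc)
next
  case (Suc t)
  let ?g = "\<lambda>j x. of_bool (x \<in> T j) :: int"
  define X where "X y = {a. a < N \<and> \<not> p dvd v (y * N + a)}" for y
  define Y where "Y = {y. y < N ^ t \<and> X y \<noteq> {}}"
  define S where "S = {x. x < N ^ Suc t \<and> \<not> p dvd v x}"
  have N: "N > 0" using Suc.prems by (cases N) auto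
  have finX: "finite (X y)" for y by (simp add: X_def)
  have finY: "finite Y" by (simp add: Y_def)
  have finS: "finite S" by (simp add: S_def)
  have S_eq: "S = (\<lambda>(y, a). y * N + a) ` (SIGMA y:Y. X y)"
  proof safe
    fix x assume "x \<in> S"
    then have x: "x < N ^ Suc t" "\<not> p dvd v x" by (auto simp: S_def)
    have "x mod N \<in> X (x div N)" using x N by (simp add: X_def)
    moreover have "x div N < N ^ t" using x by (intro less_mult_imp_div_less) (simp add: mult.commute)
    ultimately have "(x div N, x mod N) \<in> (SIGMA y:Y. X y)" by (auto simp: Y_def)
    then show "x \<in> (\<lambda>(y, a). y * N + a) ` (SIGMA y:Y. X y)"
      by (intro image_eqI [of _ _ "(x div N, x mod N)"]) auto
  next
    fix y a assume "y \<in> Y" "a \<in> X y"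
    then show "y * N + a \<in> S" using mult_add_less [of y "N ^ t" a N]
      by (auto simp: S_def X_def Y_def mult.commute)
  qed
  have inj: "inj_on (\<lambda>(y, a). y * N + a) (SIGMA y:Y. X y)"
  proof (rule inj_onI, clarsimp)
    fix y a y' a' assume "a \<in> X y" "a' \<in> X y'" and eq: "y * N + a = y' * N + a'"
    then have "a < N" "a' < N" by (auto simp: X_def)
    then show "y = y' \<and> a = a'" using div_mod_mult_add eq by metis
  qed
  have cardS: "card S = (\<Sum>y\<in>Y. card (X y))"
    unfolding S_eq using inj finY finX by (simp add: card_image)
  have "S \<noteq> {}" using Suc.prems by (simp add: S_def)
  then have "Y \<noteq> {}" unfolding S_eq by auto
  define y0 where "y0 = arg_min_on (\<lambda>y. card (X y)) Y"
  have y0: "y0 \<in> Y" unfolding y0_def using finY \<open>Y \<noteq> {}\<close> by (rule arg_min_if_finite)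
  have min: "card (X y0) \<le> card (X y)" if "y \<in> Y" for y
    unfolding y0_def using finY \<open>Y \<noteq> {}\<close> that by (rule arg_min_least)
  have "X y0 \<subseteq> {..<N}" "X y0 \<noteq> {}" using y0 by (auto simp: X_def Y_def)
  then obtain j0 where j0: "j0 < G" "w j0 \<le> card (X y0)" "card (T j0 \<inter> X y0) = 1"
    using iso by blast
  define u where "u y = (\<Sum>a<N. ?g j0 a * v (y * N + a))" for y
  have u0: "p dvd u y" if "X y = {}" for y
    unfolding u_def using that by (intro dvd_sum dvd_mult) (auto simp: X_def)
  \<comment> \<open>All terms but one vanish modulo \<open>p\<close>, and the remaining one has
    coefficient 1; hence the argument works for every \<open>p\<close>.\<close>
  have u1: "\<not> p dvd u y0"
  proof -
    obtain a where a: "T j0 \<inter> X y0 = {a}" using j0(3) by (auto simp: card_1_singleton_iff)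
    have "a < N" "\<not> p dvd v (y0 * N + a)" "a \<in> T j0" using a by (auto simp: X_def)
    have "u y0 = v (y0 * N + a) + (\<Sum>b\<in>{..<N} - {a}. ?g j0 b * v (y0 * N + b))"
      unfolding u_def using \<open>a < N\<close> \<open>a \<in> T j0\<close> by (subst sum.remove [of _ a]) auto
    moreover have "p dvd (\<Sum>b\<in>{..<N} - {a}. ?g j0 b * v (y0 * N + b))"
    proof (rule dvd_sum)
      fix b assume b: "b \<in> {..<N} - {a}"
      then have "b \<notin> T j0 \<or> p dvd v (y0 * N + b)" using a by (auto simp: X_def)
      then show "p dvd ?g j0 b * v (y0 * N + b)" by auto
    qed
    ultimately show ?thesis using \<open>\<not> p dvd v (y0 * N + a)\<close> by (simp add: dvd_add_left_iff)
  qed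
  define U where "U = {y. y < N ^ t \<and> \<not> p dvd u y}"
  have "U \<subseteq> Y" using u0 by (auto simp: U_def Y_def)
  have "y0 \<in> U" using y0 u1 by (auto simp: U_def Y_def)
  then have "{y. y < N ^ t \<and> \<not> p dvd u y} \<noteq> {}" by (auto simp: U_def)
  from Suc.IH [OF this] obtain j where j: "j < G ^ t" "weight w G t j \<le> card U"
    "\<not> p dvd (\<Sum>y<N ^ t. tpow ?g N G t j y * u y)" by (auto simp: U_def)
  have "w j0 * weight w G t j \<le> card (X y0) * card Y"
    using j0 j(2) card_mono [OF finY \<open>U \<subseteq> Y\<close>] by (intro mult_mono) auto
  also have "\<dots> = (\<Sum>y\<in>Y. card (X y0))" by simp
  also have "\<dots> \<le> card S" unfolding cardS by (intro sum_mono min)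
  finally have 1: "weight w G (Suc t) (j * G + j0) \<le> card S"
    using j0(1) by (simp add: div_mod_mult_add)
  have 2: "j * G + j0 < G ^ Suc t" using mult_add_less [OF j(1) j0(1)] by (simp add: mult.commute)
  have 3: "(\<Sum>x<N ^ Suc t. tpow ?g N G (Suc t) (j * G + j0) x * v x) = (\<Sum>y<N ^ t. tpow ?g N G t j y * u y)"
  proof -
    have "(\<Sum>x<N ^ Suc t. tpow ?g N G (Suc t) (j * G + j0) x * v x) =
       (\<Sum>x<N ^ t * N. tpow ?g N G (Suc t) (j * G + j0) x * v x)" by (simp add: mult.commute)
    also have "\<dots> = (\<Sum>y<N ^ t. \<Sum>a<N. tpow ?g N G t j y * (?g j0 a * v (y * N + a)))"
      unfolding sum_lessThan_mult using j0(1)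
      by (intro sum.cong refl) (simp add: div_mod_mult_add del: sum_of_bool_mult_eq sum_mult_of_bool_eq)
    finally show ?thesis unfolding u_def sum_distrib_left .
  qed
  show ?case
  proof (intro exI conjI)
    show "j * G + j0 < G ^ Suc t" by (rule 2)
    show "weight w G (Suc t) (j * G + j0) \<le> card {x. x < N ^ Suc t \<and> \<not> p dvd v x}"
      using 1 unfolding S_def .
    show "\<not> p dvd (\<Sum>x<N ^ Suc t. tpow ?g N G (Suc t) (j * G + j0) x * v x)"
      unfolding 3 by (rule j(3))
  qed
qed

section \<open>Straight-line programs\<close>

abbreviation xvar :: "nat \<Rightarrow> nat \<Rightarrow>\<^sub>0 nat" where
  "xvar i \<equiv> Poly_Mapping.single i 1"

abbreviation coeff2 :: "int_mpoly \<Rightarrow> nat \<Rightarrow> nat \<Rightarrow> int" where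
  "coeff2 f x y \<equiv> Poly_Mapping.lookup f (xvar x + xvar y)"

lemma add_eq_xvar2:
  assumes eq: "l + q = xvar x + xvar y" and ne: "x \<noteq> y"
  shows "l \<in> {0, xvar x, xvar y, xvar x + xvar y}"
proof -
  have val: "Poly_Mapping.lookup l z + Poly_Mapping.lookup q z = (if z = x \<or> z = y then 1 else 0)" for z
  proof -
    have "Poly_Mapping.lookup (l + q) z = Poly_Mapping.lookup (xvar x + xvar y) z" by (simp only: eq)
    then show ?thesis using ne by (auto simp: lookup_add lookup_single when_def)
  qed
  have l: "l = (if Poly_Mapping.lookup l x = 0 then 0 else xvar x) + (if Poly_Mapping.lookup l y = 0 then 0 else xvar y)"
  proof (rule poly_mapping_eqI)
    fix z
    show "Poly_Mapping.lookup l z = Poly_Mapping.lookup ((if Poly_Mapping.lookup l x = 0 then 0 else xvar x) +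
        (if Poly_Mapping.lookup l y = 0 then 0 else xvar y)) z"
      using val [of x] val [of y] val [of z] ne by (auto simp: lookup_add lookup_single when_def)
  qed
  show ?thesis by (subst l) auto
qed

text \<open>The four terms are the four ways to split a product of two distinct variables. Those
  with a constant coefficient of one factor only rescale the quadratic part of the other, so only
  the last two are new products.\<close>

lemma coeff2_times:
  fixes f g :: int_mpoly
  assumes ne: "x \<noteq> y"
  shows "coeff2 (f * g) x y =
    Poly_Mapping.lookup f 0 * coeff2 g x y + coeff2 f x y * Poly_Mapping.lookup g 0 +
    Poly_Mapping.lookup f (xvar x) * Poly_Mapping.lookup g (xvar y) +
    Poly_Mapping.lookup f (xvar y) * Poly_Mapping.lookup g (xvar x)"
proof -
  let ?k = "xvar x + xvar y"
  let ?h = "\<lambda>l. Poly_Mapping.lookup f l * (\<Sum>q. Poly_Mapping.lookup g q when ?k = l + q)"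
  have h0: "?h 0 = Poly_Mapping.lookup f 0 * Poly_Mapping.lookup g ?k" by simp
  have h1: "?h (xvar x) = Poly_Mapping.lookup f (xvar x) * Poly_Mapping.lookup g (xvar y)" by simp
  have "?k = xvar y + q \<longleftrightarrow> xvar x = q" for q by (metis add.commute add_left_cancel)
  then have h2: "?h (xvar y) = Poly_Mapping.lookup f (xvar y) * Poly_Mapping.lookup g (xvar x)" by simp
  have "?k = ?k + q \<longleftrightarrow> 0 = q" for q by (metis add.right_neutral add_left_cancel)
  then have h3: "?h ?k = Poly_Mapping.lookup f ?k * Poly_Mapping.lookup g 0" by simp
  have v: "xvar x \<noteq> xvar y" "xvar x \<noteq> 0" "xvar y \<noteq> 0"
    using ne by (metis lookup_single_eq lookup_single_not_eq zero_neq_one lookup_zero)+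
  have "coeff2 (f * g) x y = Sum_any ?h" by (rule lookup_mult)
  also have "\<dots> = sum ?h {0, xvar x, xvar y, ?k}"
  proof (rule Sum_any.expand_superset)
    show "{l. ?h l \<noteq> 0} \<subseteq> {0, xvar x, xvar y, ?k}"
    proof
      fix l assume "l \<in> {l. ?h l \<noteq> 0}"
      then have "(\<Sum>q. Poly_Mapping.lookup g q when ?k = l + q) \<noteq> 0" by auto
      then obtain q where "?k = l + q" by (rule Sum_any.not_neutral_obtains_not_neutral) (auto simp: when_def split: if_splits)
      then show "l \<in> {0, xvar x, xvar y, ?k}" using add_eq_xvar2 [OF _ ne, of l q] by simp
    qed
  qed simp
  also have "\<dots> = ?h 0 + (?h (xvar x) + (?h (xvar y) + ?h ?k))"
  proof -
    have "?k \<noteq> 0" "?k \<noteq> xvar x" "?k \<noteq> xvar y"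
      using v by (metis add.right_neutral add_left_cancel add.commute add_eq_0_iff_both_eq_0
          lookup_add lookup_single_eq lookup_zero zero_neq_one)+
    then show ?thesis using v by (simp del: Sum_any_when_equal Sum_any_when_equal' Sum_any_right_distrib)
  qed
  finally show ?thesis unfolding h0 h1 h2 h3 by simp
qed

text \<open>Only mixed coefficients count, one variable from the left matrix (below
  \<open>m\<close>) and one from the right; terms of any other shape are ignored. The pairs in
  \<open>Ps\<close> are linear forms given by their coefficients, and the integer multipliers
  \<gamma> may depend on \<open>f\<close>.\<close>

definition spanned :: "nat \<Rightarrow> nat \<Rightarrow> ((nat \<Rightarrow> int) \<times> (nat \<Rightarrow> int)) list \<Rightarrow> int_mpoly \<Rightarrow> bool" where
  "spanned m n Ps f \<longleftrightarrow> (\<exists>\<gamma>. \<forall>x<m. \<forall>y\<in>{m..<n}.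
     coeff2 f x y = (\<Sum>r<length Ps. fst (Ps ! r) x * snd (Ps ! r) y * \<gamma> r))"

lemma spannedI:
  assumes "\<And>x y. x < m \<Longrightarrow> m \<le> y \<Longrightarrow> y < n \<Longrightarrow> coeff2 f x y = (\<Sum>r<length Ps. fst (Ps ! r) x * snd (Ps ! r) y * \<gamma> r)"
  shows "spanned m n Ps f"
  unfolding spanned_def using assms by auto

lemma spannedE:
  assumes "spanned m n Ps f"
  obtains \<gamma> where "\<And>x y. x < m \<Longrightarrow> m \<le> y \<Longrightarrow> y < n \<Longrightarrow> coeff2 f x y = (\<Sum>r<length Ps. fst (Ps ! r) x * snd (Ps ! r) y * \<gamma> r)"
  using assms unfolding spanned_def by auto

lemma spanned_append:
  assumes "spanned m n Ps f"
  shows "spanned m n (Ps @ Qs) f"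
proof -
  from assms obtain \<gamma> where \<gamma>: "\<And>x y. x < m \<Longrightarrow> m \<le> y \<Longrightarrow> y < n \<Longrightarrow> coeff2 f x y = (\<Sum>r<length Ps. fst (Ps ! r) x * snd (Ps ! r) y * \<gamma> r)"
    by (rule spannedE) blast
  show ?thesis
  proof (rule spannedI)
    fix x y assume xy: "x < m" "m \<le> y" "y < n"
    have "(\<Sum>r<length (Ps @ Qs). fst ((Ps @ Qs) ! r) x * snd ((Ps @ Qs) ! r) y * (if r < length Ps then \<gamma> r else 0)) =
       (\<Sum>r<length Ps. fst ((Ps @ Qs) ! r) x * snd ((Ps @ Qs) ! r) y * (if r < length Ps then \<gamma> r else 0))"
      by (rule sum.mono_neutral_right) auto
    then show "coeff2 f x y = (\<Sum>r<length (Ps @ Qs). fst ((Ps @ Qs) ! r) x * snd ((Ps @ Qs) ! r) y * (if r < length Ps then \<gamma> r else 0))"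
      unfolding \<gamma> [OF xy] by (simp add: nth_append)
  qed
qed

lemma spanned_add:
  assumes "spanned m n Ps f" "spanned m n Ps g"
  shows "spanned m n Ps (f + g)"
proof -
  obtain \<gamma> where "\<And>x y. x < m \<Longrightarrow> m \<le> y \<Longrightarrow> y < n \<Longrightarrow> coeff2 f x y = (\<Sum>r<length Ps. fst (Ps ! r) x * snd (Ps ! r) y * \<gamma> r)"
    using assms(1) by (rule spannedE) blast
  moreover obtain \<gamma>' where "\<And>x y. x < m \<Longrightarrow> m \<le> y \<Longrightarrow> y < n \<Longrightarrow> coeff2 g x y = (\<Sum>r<length Ps. fst (Ps ! r) x * snd (Ps ! r) y * \<gamma>' r)"
    using assms(2) by (rule spannedE) blast
  ultimately show ?thesis
    by (intro spannedI [where \<gamma> = "\<lambda>r. \<gamma> r + \<gamma>' r"]) (simp add: lookup_add distrib_left sum.distrib)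
qed

lemma spanned_diff:
  assumes "spanned m n Ps f" "spanned m n Ps g"
  shows "spanned m n Ps (f - g)"
proof -
  obtain \<gamma> where "\<And>x y. x < m \<Longrightarrow> m \<le> y \<Longrightarrow> y < n \<Longrightarrow> coeff2 f x y = (\<Sum>r<length Ps. fst (Ps ! r) x * snd (Ps ! r) y * \<gamma> r)"
    using assms(1) by (rule spannedE) blast
  moreover obtain \<gamma>' where "\<And>x y. x < m \<Longrightarrow> m \<le> y \<Longrightarrow> y < n \<Longrightarrow> coeff2 g x y = (\<Sum>r<length Ps. fst (Ps ! r) x * snd (Ps ! r) y * \<gamma>' r)"
    using assms(2) by (rule spannedE) blast
  ultimately show ?thesis
    by (intro spannedI [where \<gamma> = "\<lambda>r. \<gamma> r - \<gamma>' r"]) (simp add: lookup_minus right_diff_distrib sum_subtractf)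
qed

text \<open>In degree 2, a product of two slots contributes two products of linear forms (Strassen).\<close>

lemma spanned_times:
  assumes "spanned m n Ps f" "spanned m n Ps g"
  shows "\<exists>Qs. length Qs = 2 \<and> spanned m n (Ps @ Qs) (f * g)"
proof -
  obtain \<gamma> where \<gamma>: "\<And>x y. x < m \<Longrightarrow> m \<le> y \<Longrightarrow> y < n \<Longrightarrow> coeff2 f x y = (\<Sum>r<length Ps. fst (Ps ! r) x * snd (Ps ! r) y * \<gamma> r)"
    using assms(1) by (rule spannedE) blast
  obtain \<gamma>' where \<gamma>': "\<And>x y. x < m \<Longrightarrow> m \<le> y \<Longrightarrow> y < n \<Longrightarrow> coeff2 g x y = (\<Sum>r<length Ps. fst (Ps ! r) x * snd (Ps ! r) y * \<gamma>' r)"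
    using assms(2) by (rule spannedE) blast
  let ?f1 = "\<lambda>x. Poly_Mapping.lookup f (xvar x)" and ?g1 = "\<lambda>x. Poly_Mapping.lookup g (xvar x)"
  let ?f0 = "Poly_Mapping.lookup f 0" and ?g0 = "Poly_Mapping.lookup g 0"
  \<comment> \<open>In a mixed monomial the left variable may come from either factor, hence the two
    orders.\<close>
  define Qs where "Qs = [(?f1, ?g1), (?g1, ?f1)]"
  define \<eta> where "\<eta> r = (if r < length Ps then ?f0 * \<gamma>' r + ?g0 * \<gamma> r else 1)" for r
  have "spanned m n (Ps @ Qs) (f * g)"
  proof (rule spannedI)
    fix x y assume xy: "x < m" "m \<le> y" "y < n"
    then have ne: "x \<noteq> y" by simp
    have "(\<Sum>r<length (Ps @ Qs). fst ((Ps @ Qs) ! r) x * snd ((Ps @ Qs) ! r) y * \<eta> r) =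
       (\<Sum>r<length Ps. fst (Ps ! r) x * snd (Ps ! r) y * (?f0 * \<gamma>' r + ?g0 * \<gamma> r)) + ?f1 x * ?g1 y + ?g1 x * ?f1 y"
      by (simp add: Qs_def \<eta>_def nth_append)
    also have "(\<Sum>r<length Ps. fst (Ps ! r) x * snd (Ps ! r) y * (?f0 * \<gamma>' r + ?g0 * \<gamma> r)) =
       ?f0 * coeff2 g x y + ?g0 * coeff2 f x y"
      unfolding \<gamma> [OF xy] \<gamma>' [OF xy] by (simp add: distrib_left sum.distrib sum_distrib_left mult_ac)
    finally show "coeff2 (f * g) x y = (\<Sum>r<length (Ps @ Qs). fst ((Ps @ Qs) ! r) x * snd ((Ps @ Qs) ! r) y * \<eta> r)"
      unfolding coeff2_times [OF ne] by (simp only: mult_ac add_ac)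
  qed
  then show ?thesis by (intro exI [of _ Qs]) (simp add: Qs_def)
qed

lemma coeff2_of_int: "coeff2 (of_int c) x y = 0"
proof -
  have "(of_int c :: int_mpoly) = Poly_Mapping.single 0 c"
    by (induction c rule: int_induct [of _ 0]) (simp_all flip: single_one add: single_add single_diff)
  moreover have "xvar x + xvar y \<noteq> 0"
    by (metis add_eq_0_iff_both_eq_0 lookup_add lookup_single_eq lookup_zero zero_neq_one)
  ultimately show ?thesis by (simp add: lookup_single when_def)
qed

lemma coeff2_Var: "coeff2 (Var i) x y = 0"
proof -
  have "xvar i \<noteq> xvar x + xvar y"
  proof
    assume eq: "xvar i = xvar x + xvar y"
    have "Poly_Mapping.lookup (xvar i) x = Poly_Mapping.lookup (xvar x + xvar y) x"
      "Poly_Mapping.lookup (xvar i) y = Poly_Mapping.lookup (xvar x + xvar y) y" by (simp_all only: eq)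
    then show False by (auto simp: lookup_add lookup_single when_def split: if_splits)
  qed
  then show ?thesis by (simp add: Var_def lookup_single when_def)
qed

text \<open>The list of pairs only grows, so earlier slots remain in its span; sums and differences
  need no new pair, a product needs two.\<close>

lemma spanned_slp_run:
  assumes "slp_ok (length vs) S" "\<And>v. v \<in> set vs \<Longrightarrow> spanned m n Ps v"
  shows "\<exists>Qs. length Qs \<le> 2 * length S \<and> (\<forall>v\<in>set (slp_run vs S). spanned m n (Ps @ Qs) v)"
  using assms
proof (induction S arbitrary: vs Ps)
  case Nil
  then show ?case by (intro exI [of _ "[]"]) simp
next
  case (Cons ins S)
  obtain f a b where ins: "ins = (f, a, b)" by (cases ins) auto
  have op: "spanned m n Ps (operand_val vs x)" if "operand_ok (length vs) x" for x
  proof (cases x)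
    case (Const c)
    then show ?thesis by (intro spannedI [where \<gamma> = "\<lambda>_. 0"]) (simp only: coeff2_of_int operand_val.simps mult_zero_right sum.neutral_const)
  next
    case (Slot i)
    then show ?thesis using that Cons.prems(2) by simp
  qed
  have ab: "spanned m n Ps (operand_val vs a)" "spanned m n Ps (operand_val vs b)"
    using Cons.prems(1) by (simp_all add: ins op)
  have "\<exists>Qs. length Qs \<le> 2 \<and> spanned m n (Ps @ Qs) (arith_val f (operand_val vs a) (operand_val vs b))"
  proof (cases f)
    case Mul
    obtain Qs where "length Qs = 2" "spanned m n (Ps @ Qs) (operand_val vs a * operand_val vs b)"
      using spanned_times [OF ab] by blast
    then show ?thesis using Mul by (intro exI [of _ Qs]) simp
  qed (use spanned_add [OF ab] spanned_diff [OF ab] in \<open>auto intro!: exI [of _ "[]"]\<close>)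
  then obtain Qs where Qs: "length Qs \<le> 2" "spanned m n (Ps @ Qs) (arith_val f (operand_val vs a) (operand_val vs b))"
    by blast
  have "spanned m n (Ps @ Qs) v" if "v \<in> set (vs @ [arith_val f (operand_val vs a) (operand_val vs b)])" for v
    using that Cons.prems(2) Qs(2) spanned_append by auto
  moreover have "slp_ok (length (vs @ [arith_val f (operand_val vs a) (operand_val vs b)])) S"
    using Cons.prems(1) by (simp add: ins)
  ultimately obtain Qs' where "length Qs' \<le> 2 * length S"
      "\<forall>v\<in>set (slp_run (vs @ [arith_val f (operand_val vs a) (operand_val vs b)]) S). spanned m n ((Ps @ Qs) @ Qs') v"
    using Cons.IH by blast
  then show ?case using Qs(1) by (intro exI [of _ "Qs @ Qs'"]) (simp add: ins)
qed

section \<open>From a straight-line program to a bilinear identity\<close>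

lemma length_slp_run: "length (slp_run vs S) = length vs + length S"
  by (induction vs S rule: slp_run.induct) auto

text \<open>Left and right variables have disjoint numbers, and different index pairs give different
  variables, so at most one summand contains the monomial.\<close>

lemma coeff2_matmul:
  assumes lt: "i < a" "j < b" "j' < b" "l < c" "i' < a" "l' < c"
  shows "coeff2 (\<Sum>j<b. Var (i' * b + j) * Var (a * b + j * c + l')) (i * b + j) (a * b + (j' * c + l)) =
    of_bool (j = j' \<and> i = i' \<and> l = l')"
proof -
  have eq: "xvar m + xvar m' = xvar x + xvar y \<longleftrightarrow> m = x \<and> m' = y"
    if "m < a * b" "x < a * b" "a * b \<le> m'" "a * b \<le> y" for m m' x y
  proof
    assume eq: "xvar m + xvar m' = xvar x + xvar y"
    have "Poly_Mapping.lookup (xvar m + xvar m') m = Poly_Mapping.lookup (xvar x + xvar y) m"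
      "Poly_Mapping.lookup (xvar m + xvar m') m' = Poly_Mapping.lookup (xvar x + xvar y) m'" by (simp_all only: eq)
    then show "m = x \<and> m' = y" using that by (auto simp: lookup_add lookup_single when_def split: if_splits)
  qed simp
  have uniq: "q * b + s = q' * b + s' \<longleftrightarrow> q = q' \<and> s = s'" if "s < b" "s' < b" for q s q' s' b :: nat
    using div_mod_mult_add [OF that(1), of q] div_mod_mult_add [OF that(2), of q'] by metis
  have "coeff2 (\<Sum>j<b. Var (i' * b + j) * Var (a * b + j * c + l')) (i * b + j) (a * b + (j' * c + l)) =
     (\<Sum>k<b. coeff2 (Var (i' * b + k) * Var (a * b + k * c + l')) (i * b + j) (a * b + (j' * c + l)))"
    by (rule lookup_sum)
  also have "\<dots> = (\<Sum>k<b. if k = j then of_bool (j = j' \<and> i = i' \<and> l = l') else 0)"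
  proof (rule sum.cong [OF refl])
    fix k assume k: "k \<in> {..<b}"
    have "coeff2 (Var (i' * b + k) * Var (a * b + k * c + l')) (i * b + j) (a * b + (j' * c + l)) =
        of_bool (xvar (i' * b + k) + xvar (a * b + k * c + l') = xvar (i * b + j) + xvar (a * b + (j' * c + l)))"
      by (simp add: Var_def mult_single lookup_single when_def)
    also have "\<dots> = of_bool (i' * b + k = i * b + j \<and> k * c + l' = j' * c + l)"
      using k lt by (subst eq) (auto intro: mult_add_less)
    also have "\<dots> = (if k = j then of_bool (j = j' \<and> i = i' \<and> l = l') else 0)"
      using k lt by (auto simp: uniq)
    finally show "coeff2 (Var (i' * b + k) * Var (a * b + k * c + l')) (i * b + j) (a * b + (j' * c + l)) =
       (if k = j then of_bool (j = j' \<and> i = i' \<and> l = l') else 0)" .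
  qed
  also have "\<dots> = of_bool (j = j' \<and> i = i' \<and> l = l')" using lt by simp
  finally show ?thesis .
qed

text \<open>\<alpha> and \<beta> are the collected linear forms on the two groups of variables,
  \<gamma> the coefficients that express the outputs. All of this happens over the integers and only
  the final comparison passes to \<open>F\<close>, so one triple serves the whole family.\<close>

lemma computes_matmul_bilinear:
  assumes "computes_matmul \<F> a b c S outs"
  shows "\<exists>R (\<alpha> :: nat \<Rightarrow> nat \<Rightarrow> int) (\<beta> :: nat \<Rightarrow> nat \<Rightarrow> int) (\<gamma> :: nat \<Rightarrow> nat \<Rightarrow> int). R \<le> 2 * length S \<and> (\<forall>F\<in>\<F>. \<forall>i<a. \<forall>j<b. \<forall>j'<b. \<forall>l<c. \<forall>i'<a. \<forall>l'<c.
     [(\<Sum>\<rho><R. \<alpha> \<rho> (i * b + j) * \<beta> \<rho> (j' * c + l) * \<gamma> \<rho> (i' * c + l'))] \<cdot>\<^bsub>F\<^esub> \<one>\<^bsub>F\<^esub> =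
     [(of_bool (j = j' \<and> i = i' \<and> l = l') :: int)] \<cdot>\<^bsub>F\<^esub> \<one>\<^bsub>F\<^esub>)"
proof -
  let ?vs = "map Var [0..<a * b + b * c]"
  let ?run = "slp_run ?vs S"
  from assms have ok: "slp_ok (length ?vs) S" and len: "length outs = a * c"
    and outs: "\<forall>x\<in>set outs. operand_ok (a * b + b * c + length S) x"
    and eq: "\<And>F i l. F \<in> \<F> \<Longrightarrow> i < a \<Longrightarrow> l < c \<Longrightarrow> eq_over F (operand_val ?run (outs ! (i * c + l)))
          (\<Sum>j<b. Var (i * b + j) * Var (a * b + j * c + l))"
    by (simp_all add: computes_matmul_def)
  have "spanned (a * b) (a * b + b * c) [] v" if "v \<in> set ?vs" for v
    using that by (intro spannedI) (clarsimp simp del: One_nat_def, rule coeff2_Var)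
  from spanned_slp_run [OF ok this] obtain Ps where Ps: "length Ps \<le> 2 * length S"
    "\<forall>v\<in>set ?run. spanned (a * b) (a * b + b * c) Ps v" by auto
  have "\<exists>\<gamma>. \<forall>x<a * b. \<forall>y<b * c. coeff2 (operand_val ?run (outs ! z)) x (a * b + y) =
      (\<Sum>r<length Ps. fst (Ps ! r) x * snd (Ps ! r) (a * b + y) * \<gamma> r)" if z: "z < a * c" for z
  proof -
    have "spanned (a * b) (a * b + b * c) Ps (operand_val ?run (outs ! z))"
    proof (cases "outs ! z")
      case (Const k)
      then show ?thesis by (intro spannedI [where \<gamma> = "\<lambda>_. 0"]) (simp only: coeff2_of_int operand_val.simps mult_zero_right sum.neutral_const)
    next
      case (Slot i)
      have "outs ! z \<in> set outs" using z len by simp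
      then have "i < length ?run" using outs Slot by (auto simp: length_slp_run)
      then show ?thesis using Ps(2) Slot by simp
    qed
    then show ?thesis by (rule spannedE) (rule exI, auto)
  qed
  then have "\<forall>z. \<exists>\<gamma>. z < a * c \<longrightarrow> (\<forall>x<a * b. \<forall>y<b * c. coeff2 (operand_val ?run (outs ! z)) x (a * b + y) =
      (\<Sum>r<length Ps. fst (Ps ! r) x * snd (Ps ! r) (a * b + y) * \<gamma> r))" by blast
  from choice [OF this] obtain \<gamma> where \<gamma>: "\<And>z x y. z < a * c \<Longrightarrow> x < a * b \<Longrightarrow> y < b * c \<Longrightarrow>
      coeff2 (operand_val ?run (outs ! z)) x (a * b + y) =
      (\<Sum>r<length Ps. fst (Ps ! r) x * snd (Ps ! r) (a * b + y) * \<gamma> z r)" by blast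
  show ?thesis
  proof (rule exI [of _ "length Ps"], rule exI [of _ "\<lambda>\<rho>. fst (Ps ! \<rho>)"],
      rule exI [of _ "\<lambda>\<rho> y. snd (Ps ! \<rho>) (a * b + y)"], rule exI [of _ "\<lambda>\<rho> z. \<gamma> z \<rho>"],
      intro conjI ballI allI impI)
    show "length Ps \<le> 2 * length S" by (rule Ps)
    fix F i j j' l i' l'
    assume F: "F \<in> \<F>" and lt: "i < a" "j < b" "j' < b" "l < c" "i' < a" "l' < c"
    have "[coeff2 (operand_val ?run (outs ! (i' * c + l'))) (i * b + j) (a * b + (j' * c + l))] \<cdot>\<^bsub>F\<^esub> \<one>\<^bsub>F\<^esub> =
       [coeff2 (\<Sum>j<b. Var (i' * b + j) * Var (a * b + j * c + l')) (i * b + j) (a * b + (j' * c + l))] \<cdot>\<^bsub>F\<^esub> \<one>\<^bsub>F\<^esub>"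
      using eq [OF F lt(5,6)] unfolding eq_over_def by blast
    then show "[(\<Sum>\<rho><length Ps. fst (Ps ! \<rho>) (i * b + j) * snd (Ps ! \<rho>) (a * b + (j' * c + l)) * \<gamma> (i' * c + l') \<rho>)] \<cdot>\<^bsub>F\<^esub> \<one>\<^bsub>F\<^esub> =
       [(of_bool (j = j' \<and> i = i' \<and> l = l') :: int)] \<cdot>\<^bsub>F\<^esub> \<one>\<^bsub>F\<^esub>"
      unfolding coeff2_matmul [OF lt] using lt by (subst (asm) \<gamma>) (auto intro: mult_add_less)
  qed
qed

text \<open>With fewer than \<open>N\<^sup>2\<close> products, two different left factors would have the same values of all forms \<open>\<alpha>\<close>.\<close>

lemma bilinear_matmul_rank_ge:
  assumes bil: "bilinear_matmul (int p) N M R \<alpha> \<beta> \<gamma>" and p: "p > 1" and M: "M > 0"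
  shows "N * N \<le> R"
proof (rule ccontr)
  assume neg: "\<not> N * N \<le> R"
  define V where "V = ({..<N * N} \<rightarrow>\<^sub>E {..<p})"
  define W where "W = ({..<R} \<rightarrow>\<^sub>E {..<p})"
  define \<phi> where "\<phi> v = (\<lambda>\<rho>\<in>{..<R}. nat ((\<Sum>a<N * N. \<alpha> \<rho> a * int (v a)) mod int p))" for v :: "nat \<Rightarrow> nat"
  have "\<phi> ` V \<subseteq> W"
    unfolding \<phi>_def W_def using p by (intro image_subsetI restrict_PiE_iff [THEN iffD2]) (auto simp: nat_less_iff)
  moreover have "finite W" by (simp add: W_def finite_PiE)
  ultimately have "card (\<phi> ` V) \<le> card W" by (intro card_mono)
  moreover have "card W < card V" using neg p by (simp add: V_def W_def card_PiE)
  ultimately have "\<not> inj_on \<phi> V" using card_image [of \<phi> V] by linarith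
  then obtain v v' where v: "v \<in> V" "v' \<in> V" "\<phi> v = \<phi> v'" "v \<noteq> v'" by (auto simp: inj_on_def)
  then obtain a0 where a0: "a0 < N * N" "v a0 \<noteq> v' a0"
    unfolding V_def by (metis PiE_ext lessThan_iff)
  define d where "d a = int (v a) - int (v' a)" for a
  have zero: "int p dvd (\<Sum>a<N * N. \<alpha> \<rho> a * d a)" if "\<rho> < R" for \<rho>
  proof -
    have "\<phi> v \<rho> = \<phi> v' \<rho>" using v(3) by simp
    then have "(\<Sum>a<N * N. \<alpha> \<rho> a * int (v a)) mod int p = (\<Sum>a<N * N. \<alpha> \<rho> a * int (v' a)) mod int p"
      using that p by (simp add: \<phi>_def nat_eq_iff)
    then show ?thesis
      by (simp add: d_def right_diff_distrib sum_subtractf mod_eq_dvd_iff)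
  qed
  define i where "i = a0 div N"
  define j where "j = a0 mod N"
  have N: "N > 0" using a0 by (cases N) auto
  have ij: "i < N" "j < N" "a0 = i * N + j" using a0 N by (auto simp: i_def j_def less_mult_imp_div_less)
  \<comment> \<open>Pairing with the entry \<open>(j, 0)\<close> of the right factor and
    \<open>(i, 0)\<close> of the output extracts the coordinate \<open>a0\<close>, where
    \<open>v\<close> and \<open>v'\<close> differ, while the sum is divisible by \<open>p\<close>
    because all forms \<alpha> agree on \<open>v\<close> and \<open>v'\<close>.\<close>
  have "[(\<Sum>\<rho><R. (\<Sum>a<N * N. \<alpha> \<rho> a * d a) * (\<beta> \<rho> (j * M + 0) * \<gamma> \<rho> (i * M + 0))) = d a0] (mod int p)"
  proof -
    have "(\<Sum>\<rho><R. (\<Sum>a<N * N. \<alpha> \<rho> a * d a) * (\<beta> \<rho> (j * M + 0) * \<gamma> \<rho> (i * M + 0))) =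
       (\<Sum>\<rho><R. \<Sum>a<N * N. d a * (\<alpha> \<rho> a * \<beta> \<rho> (j * M + 0) * \<gamma> \<rho> (i * M + 0)))"
      unfolding sum_distrib_right by (intro sum.cong refl) (simp add: mult_ac)
    also have "\<dots> = (\<Sum>a<N * N. d a * (\<Sum>\<rho><R. \<alpha> \<rho> a * \<beta> \<rho> (j * M + 0) * \<gamma> \<rho> (i * M + 0)))"
      by (subst sum.swap) (simp add: sum_distrib_left)
    also have "[\<dots> = (\<Sum>a<N * N. d a * of_bool (a = a0))] (mod int p)"
    proof (rule cong_sum, rule cong_mult [OF cong_refl])
      fix a assume "a \<in> {..<N * N}"
      then have a: "a div N < N" "a mod N < N" using N by (auto intro: less_mult_imp_div_less)
      have "[(\<Sum>\<rho><R. \<alpha> \<rho> (a div N * N + a mod N) * \<beta> \<rho> (j * M + 0) * \<gamma> \<rho> (i * M + 0)) =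
          of_bool (a mod N = j \<and> a div N = i \<and> (0::nat) = 0)] (mod int p)"
        by (rule bil [unfolded bilinear_matmul_def, rule_format, OF a ij(2) M ij(1) M])
      moreover have "(a mod N = j \<and> a div N = i) = (a = a0)"
      proof
        assume "a mod N = j \<and> a div N = i"
        then show "a = a0" using ij(3) div_mult_mod_eq [of a N] by simp
      qed (simp add: i_def j_def)
      ultimately show "[(\<Sum>\<rho><R. \<alpha> \<rho> a * \<beta> \<rho> (j * M + 0) * \<gamma> \<rho> (i * M + 0)) = of_bool (a = a0)] (mod int p)"
        by simp
    qed
    also have "(\<Sum>a<N * N. d a * of_bool (a = a0)) = (\<Sum>a<N * N. if a = a0 then d a0 else 0)"
      by (intro sum.cong) auto
    also have "\<dots> = d a0" using a0 by simp
    finally show ?thesis .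
  qed
  moreover have "int p dvd (\<Sum>\<rho><R. (\<Sum>a<N * N. \<alpha> \<rho> a * d a) * (\<beta> \<rho> (j * M + 0) * \<gamma> \<rho> (i * M + 0)))"
    by (rule dvd_sum, rule dvd_mult2, rule zero) simp
  ultimately have "int p dvd d a0" by (simp add: cong_dvd_iff)
  moreover have "v a0 < p" "v' a0 < p" using v a0 by (auto simp: V_def PiE_iff)
  then have "\<bar>d a0\<bar> < int p" by (auto simp: d_def)
  moreover have "d a0 \<noteq> 0" using a0 by (simp add: d_def)
  ultimately show False using zdvd_not_zless [of "\<bar>d a0\<bar>" "int p"] by simp
qed

section \<open>The cubic algorithm as a straight-line program\<close>

lemma slp_run_append: "slp_run vs (S @ T) = slp_run (slp_run vs S) T"
  by (induction vs S rule: slp_run.induct) auto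

lemma slp_ok_append: "slp_ok m (S @ T) \<longleftrightarrow> slp_ok m S \<and> slp_ok (m + length S) T"
  by (induction m S rule: slp_ok.induct) auto

lemma slp_run_nth: "i < length vs \<Longrightarrow> slp_run vs S ! i = vs ! i"
  by (induction vs S rule: slp_run.induct) (auto simp: nth_append)

lemma operand_ok_mono: "operand_ok m x \<Longrightarrow> m \<le> n \<Longrightarrow> operand_ok n x"
  by (cases x) auto

lemma operand_val_slp_run: "operand_ok (length vs) x \<Longrightarrow> operand_val (slp_run vs S) x = operand_val vs x"
  by (cases x) (auto simp: slp_run_nth)

lemma ex_slp_inner_product:
  fixes vs :: "'r::comm_ring_1 list"
  assumes "\<forall>(u, v)\<in>set g. u < length vs \<and> v < length vs"
  shows "\<exists>S out. slp_ok (length vs) S \<and> operand_ok (length vs + length S) out \<and> length S = 2 * length g \<and>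
    operand_val (slp_run vs S) out = (\<Sum>(u, v)\<leftarrow>g. vs ! u * vs ! v)"
  using assms
proof (induction g rule: rev_induct)
  case Nil
  show ?case by (intro exI [of _ "[]"] exI [of _ "Const 0"]) simp
next
  case (snoc uv g)
  obtain u v where uv: "uv = (u, v)" by (cases uv)
  from snoc obtain S out where S: "slp_ok (length vs) S" "operand_ok (length vs + length S) out"
    "length S = 2 * length g" "operand_val (slp_run vs S) out = (\<Sum>(u, v)\<leftarrow>g. vs ! u * vs ! v)" by auto
  have lt: "u < length vs" "v < length vs" using snoc.prems by (auto simp: uv)
  let ?k = "length vs + length S"
  let ?T = "[(Mul, Slot u, Slot v), (Add, out, Slot ?k)]"
  have out: "operand_val (slp_run vs S @ [z]) out = operand_val (slp_run vs S) out" for z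
    using S(2) by (cases out) (auto simp: nth_append length_slp_run)
  have "operand_val (slp_run vs (S @ ?T)) (Slot (Suc ?k)) = (\<Sum>(u, v)\<leftarrow>g @ [uv]. vs ! u * vs ! v)"
    using lt S(4) by (simp add: slp_run_append nth_append length_slp_run slp_run_nth uv out)
  moreover have "slp_ok (length vs) (S @ ?T)" "operand_ok (length vs + length (S @ ?T)) (Slot (Suc ?k))"
    using S(1,2) lt operand_ok_mono [OF S(2)] by (auto simp: slp_ok_append)
  ultimately show ?case using S(3) by (intro exI [of _ "S @ ?T"] exI [of _ "Slot (Suc ?k)"]) auto
qed

lemma ex_slp_inner_products:
  fixes vs :: "'r::comm_ring_1 list"
  assumes "\<forall>g\<in>set gs. length g = b \<and> (\<forall>(u, v)\<in>set g. u < length vs \<and> v < length vs)"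
  shows "\<exists>S outs. slp_ok (length vs) S \<and> (\<forall>x\<in>set outs. operand_ok (length vs + length S) x) \<and>
    length S = 2 * length gs * b \<and>
    map (operand_val (slp_run vs S)) outs = map (\<lambda>g. \<Sum>(u, v)\<leftarrow>g. vs ! u * vs ! v) gs"
  using assms
proof (induction gs rule: rev_induct)
  case Nil
  show ?case by (intro exI [of _ "[]"]) simp
next
  case (snoc g gs)
  then obtain S outs where S: "slp_ok (length vs) S" "\<forall>x\<in>set outs. operand_ok (length vs + length S) x"
    "length S = 2 * length gs * b"
    "map (operand_val (slp_run vs S)) outs = map (\<lambda>g. \<Sum>(u, v)\<leftarrow>g. vs ! u * vs ! v) gs" by auto
  have g: "length g = b" "\<forall>(u, v)\<in>set g. u < length vs \<and> v < length vs" using snoc.prems by auto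
  then have "\<forall>(u, v)\<in>set g. u < length (slp_run vs S) \<and> v < length (slp_run vs S)"
    by (auto simp: length_slp_run)
  from ex_slp_inner_product [OF this] obtain T out where T: "slp_ok (length vs + length S) T"
    "operand_ok (length vs + length S + length T) out" "length T = 2 * b"
    "operand_val (slp_run (slp_run vs S) T) out = (\<Sum>(u, v)\<leftarrow>g. slp_run vs S ! u * slp_run vs S ! v)"
    by (auto simp: length_slp_run g)
  have "(\<Sum>(u, v)\<leftarrow>g. slp_run vs S ! u * slp_run vs S ! v) = (\<Sum>(u, v)\<leftarrow>g. vs ! u * vs ! v)"
    using g(2) by (intro arg_cong [of _ _ sum_list] map_cong) (auto simp: slp_run_nth)
  moreover have "operand_val (slp_run vs (S @ T)) x = operand_val (slp_run vs S) x" if "x \<in> set outs" for x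
    unfolding slp_run_append using that S(2) by (intro operand_val_slp_run) (simp add: length_slp_run)
  then have "map (operand_val (slp_run vs (S @ T))) outs = map (operand_val (slp_run vs S)) outs" by simp
  ultimately have "map (operand_val (slp_run vs (S @ T))) (outs @ [out]) =
      map (\<lambda>g. \<Sum>(u, v)\<leftarrow>g. vs ! u * vs ! v) (gs @ [g])"
    using S(4) T(4) by (simp add: slp_run_append)
  moreover have "\<forall>x\<in>set (outs @ [out]). operand_ok (length vs + length (S @ T)) x"
    using S(2) T(2) by (auto intro: operand_ok_mono simp: add.assoc)
  ultimately show ?case using S(1,3) T(1,3)
    by (intro exI [of _ "S @ T"] exI [of _ "outs @ [out]"]) (simp add: slp_ok_append algebra_simps)
qed

text \<open>Ensures that the set of admissible exponents in \<open>omega\<close> is nonempty,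
  without which its infimum would be unspecified.\<close>

lemma ex_naive_matmul:
  "\<exists>S outs. computes_matmul \<F> a b c S outs \<and> length S = 2 * (a * c) * b"
proof -
  define vs where "vs = map Var [0..<a * b + b * c]"
  define gs where "gs = map (\<lambda>z. map (\<lambda>j. (z div c * b + j, a * b + j * c + z mod c)) [0..<b]) [0..<a * c]"
  have vs_nth: "vs ! u = Var u" if "u < a * b + b * c" for u using that by (simp add: vs_def)
  have lt: "z div c * b + j < a * b + b * c \<and> a * b + j * c + z mod c < a * b + b * c"
    if "z < a * c" "j < b" for z j
  proof -
    have c: "c > 0" using that by (cases c) auto
    have "z div c < a" using that by (simp add: less_mult_imp_div_less)
    from mult_add_less [OF this that(2)] mult_add_less [OF that(2), of "z mod c" c] c
    show ?thesis by simp
  qed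
  have "\<forall>g\<in>set gs. length g = b \<and> (\<forall>(u, v)\<in>set g. u < length vs \<and> v < length vs)"
    using lt by (auto simp: gs_def vs_def)
  from ex_slp_inner_products [OF this] obtain S outs where S: "slp_ok (length vs) S"
    "\<forall>x\<in>set outs. operand_ok (length vs + length S) x" "length S = 2 * length gs * b"
    "map (operand_val (slp_run vs S)) outs = map (\<lambda>g. \<Sum>(u, v)\<leftarrow>g. vs ! u * vs ! v) gs" by blast
  have len: "length outs = a * c" using arg_cong [OF S(4), of length] by (simp add: gs_def)
  have "operand_val (slp_run vs S) (outs ! (i * c + l)) = (\<Sum>j<b. Var (i * b + j) * Var (a * b + j * c + l))"
    if il: "i < a" "l < c" for i l
  proof -
    have z: "i * c + l < a * c" using il by (rule mult_add_less)
    have "operand_val (slp_run vs S) (outs ! (i * c + l)) = map (operand_val (slp_run vs S)) outs ! (i * c + l)"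
      using z len by simp
    also have "\<dots> = (\<Sum>(u, v)\<leftarrow>map (\<lambda>j. (i * b + j, a * b + j * c + l)) [0..<b]. vs ! u * vs ! v)"
      unfolding S(4) using z il by (simp add: gs_def div_mod_mult_add)
    also have "\<dots> = (\<Sum>j\<leftarrow>[0..<b]. vs ! (i * b + j) * vs ! (a * b + j * c + l))"
      by (simp add: o_def)
    also have "\<dots> = (\<Sum>j<b. vs ! (i * b + j) * vs ! (a * b + j * c + l))"
      by (simp add: interv_sum_list_conv_sum_set_nat lessThan_atLeast0)
    also have "\<dots> = (\<Sum>j<b. Var (i * b + j) * Var (a * b + j * c + l))"
    proof (rule sum.cong [OF refl])
      fix j assume "j \<in> {..<b}"
      then have "i * b + j < a * b + b * c" "a * b + j * c + l < a * b + b * c"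
        using mult_add_less [OF il(1), of j b] mult_add_less [of j b l c] il by auto
      then show "vs ! (i * b + j) * vs ! (a * b + j * c + l) = Var (i * b + j) * Var (a * b + j * c + l)"
        by (simp only: vs_nth)
    qed
    finally show ?thesis .
  qed
  then have "computes_matmul \<F> a b c S outs"
    using S(1,2) len by (simp add: computes_matmul_def eq_over_def vs_def)
  then show ?thesis using S(3) by (intro exI [of _ S] exI [of _ outs]) (simp add: gs_def)
qed

section \<open>Exponents close to the infimum\<close>

lemma dim_pow_1: "dim_pow n 1 = n"
proof (cases "n = 0")
  case False
  then show ?thesis by (simp only: dim_pow_def powr_one of_nat_0_le_iff ceiling_of_nat nat_int)
qed (simp add: dim_pow_def)

lemma dim_pow_le:
  assumes "n \<ge> 1" "0 \<le> x" "x \<le> 1"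
  shows "dim_pow n x \<le> n" "1 \<le> dim_pow n x"
proof -
  have "real n powr x \<le> real n powr 1" using assms by (intro powr_mono) auto
  then show "dim_pow n x \<le> n" using assms by (simp add: dim_pow_def nat_le_iff ceiling_le_iff)
  have "1 \<le> real n powr x" using assms by (simp add: ge_one_powr_ge_zero)
  then show "1 \<le> dim_pow n x" using assms by (simp add: dim_pow_def le_nat_iff le_ceiling_iff)
qed

text \<open>An exponent arbitrarily close to the infimum is attained because the set contains 3 and
  is bounded below by 0. Nonnegativity is used later, where powers with such an exponent must be
  monotone in the base.\<close>

lemma omega_approx:
  assumes d: "0 \<le> \<delta>" "\<delta> \<le> 2" and \<eta>: "\<eta> > 0"
  shows "\<exists>w K. 0 < w \<and> w < omega \<F> 1 1 (\<delta> / 2) + \<eta> \<and>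
    (\<forall>n\<ge>1. \<exists>S outs. computes_matmul \<F> n n (dim_pow n (\<delta> / 2)) S outs \<and> real (length S) \<le> K * real n powr w)"
    (is ?approx) and "omega \<F> 1 1 (\<delta> / 2) \<ge> 0" (is ?nonneg)
proof -
  let ?P = "\<lambda>w K. \<forall>n\<ge>1. \<exists>S outs. computes_matmul \<F> n n (dim_pow n (\<delta> / 2)) S outs \<and> real (length S) \<le> K * real n powr w"
  let ?W = "{w. w > 0 \<and> (\<exists>K. ?P w K)}"
  have om: "omega \<F> 1 1 (\<delta> / 2) = Inf ?W"
    by (simp add: omega_def dim_pow_1)
  have "?P 3 2"
  proof (intro allI impI)
    fix n :: nat assume n: "n \<ge> 1"
    define c where "c = dim_pow n (\<delta> / 2)"
    obtain S outs where S: "computes_matmul \<F> n n c S outs" "length S = 2 * (n * c) * n"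
      using ex_naive_matmul by blast
    have "c \<le> n" unfolding c_def using n d by (intro dim_pow_le) auto
    then have "length S \<le> 2 * (n * n) * n" unfolding S(2) by (intro mult_mono) auto
    then have "real (length S) \<le> real (2 * (n * n) * n)" by (simp only: of_nat_le_iff)
    also have "\<dots> = 2 * real n powr 3" using n by (simp add: powr_numeral power3_eq_cube)
    finally show "\<exists>S outs. computes_matmul \<F> n n (dim_pow n (\<delta> / 2)) S outs \<and> real (length S) \<le> 2 * real n powr 3"
      using S(1) unfolding c_def by blast
  qed
  then have "3 \<in> ?W" by (intro CollectI conjI exI [of _ 2]) auto
  then have ne: "?W \<noteq> {}" by blast
  have bdd: "bdd_below ?W" by (rule bdd_belowI [of _ 0]) auto
  show ?nonneg unfolding om using ne by (intro cInf_greatest) auto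
  have "Inf ?W < omega \<F> 1 1 (\<delta> / 2) + \<eta>" unfolding om using \<eta> by simp
  then obtain w where "w \<in> ?W" "w < omega \<F> 1 1 (\<delta> / 2) + \<eta>" using cInf_lessD [OF ne] by blast
  then show ?approx by blast
qed

section \<open>Running times\<close>

abbreviation C0 :: "string \<Rightarrow> aexp" where "C0 x \<equiv> Cell x (Lit 0)"

text \<open>An upper bound in place of the exact time, so that costs can be rounded up to uniform
  multiples.\<close>

definition runs :: "com \<Rightarrow> state \<Rightarrow> nat \<Rightarrow> state \<Rightarrow> bool" where
  "runs c s T s' \<longleftrightarrow> (\<exists>t\<le>T. exec c s t s')"

lemma runs_Seq:
  assumes "runs c1 s T1 s1" "runs c2 s1 T2 s2"
  shows "runs (Seq c1 c2) s (T1 + T2) s2"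
  using assms unfolding runs_def by (meson add_mono exec.Seq)

lemma runs_mono: "runs c s T s' \<Longrightarrow> T \<le> T' \<Longrightarrow> runs c s T' s'"
  unfolding runs_def by (meson order_trans)

section \<open>Cost of expressions when all cells are bounded\<close>

definition bounded :: "nat \<Rightarrow> state \<Rightarrow> bool" where
  "bounded b s \<longleftrightarrow> (\<forall>x i. s x i < 2 ^ b)"

text \<open>With all cells below \<open>2\<^sup>b\<close>, an expression of size \<open>m\<close> is below \<open>2\<close> to the \<open>m b\<close>.\<close>

fun esize :: "aexp \<Rightarrow> nat" where
  "esize (Lit c) = len c"
| "esize (Cell x e) = esize e"
| "esize (Plus a b) = esize a + esize b"
| "esize (Minus a b) = esize a + esize b"
| "esize (Times a b) = esize a + esize b"
| "esize (Quot a b) = esize a + esize b"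
| "esize (Rem a b) = esize a + esize b"

text \<open>The factor of \<open>b\<close> in a bound for \<open>acost\<close>. A value below
  \<open>2 ^ (m * b)\<close> is charged \<open>2 * m * b\<close>, which covers the
  \<open>Suc\<close> in \<open>len\<close>.\<close>

fun ecost :: "aexp \<Rightarrow> nat" where
  "ecost (Lit c) = len c"
| "ecost (Cell x e) = ecost e + 2 * esize e + 2"
| "ecost (Plus a b) = ecost a + ecost b + 2 * esize a + 2 * esize b"
| "ecost (Minus a b) = ecost a + ecost b + 2 * esize a + 2 * esize b"
| "ecost (Times a b) = ecost a + ecost b + 2 * esize a + 2 * esize b"
| "ecost (Quot a b) = ecost a + ecost b + 2 * esize a + 2 * esize b"
| "ecost (Rem a b) = ecost a + ecost b + 2 * esize a + 2 * esize b"

lemma esize_pos: "esize e > 0"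
  by (induction e) (auto simp: len_def)

lemma less_power_len: "v < 2 ^ len v"
proof -
  have "v < 2 ^ floorlog 2 v" using floorlog_bounds [of v 2] by (cases "v = 0") auto
  also have "\<dots> \<le> 2 ^ len v" unfolding len_def by (rule power_increasing) auto
  finally show ?thesis .
qed

lemma len_le:
  assumes "v < 2 ^ (m * b)" "b \<ge> 1" "m \<ge> 1"
  shows "len v \<le> 2 * m * b"
proof -
  have "floorlog 2 v \<le> m * b" using assms(1) by (subst floorlog_le_iff) auto
  moreover have "1 \<le> m * b" using assms by (simp add: Suc_le_eq)
  ultimately have "len v \<le> 2 * (m * b)" unfolding len_def by linarith
  then show ?thesis by (simp only: mult.assoc)
qed

lemma aval_less:
  assumes "bounded b s" and b: "b \<ge> 1"
  shows "aval e s < 2 ^ (esize e * b)"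
proof (induction e)
  case (Lit c)
  have "c < 2 ^ len c" by (rule less_power_len)
  also have "\<dots> \<le> 2 ^ (len c * b)" using b by (intro power_increasing) auto
  finally show ?case by simp
next
  case (Cell x e)
  have "s x (aval e s) < 2 ^ b" using assms by (simp add: bounded_def)
  also have "\<dots> \<le> 2 ^ (esize e * b)" using esize_pos [of e] by (intro power_increasing) auto
  finally show ?case by simp
next
  case (Plus e1 e2)
  have "1 \<le> esize e1 * b" "1 \<le> esize e2 * b" using esize_pos b by (simp_all add: Suc_le_eq)
  then have two: "(2::nat) ^ 1 \<le> 2 ^ (esize e1 * b)" "(2::nat) ^ 1 \<le> 2 ^ (esize e2 * b)"
    by (simp_all only: power_increasing_iff)
  have le: "x + y \<le> x * y" if "2 \<le> x" "2 \<le> y" for x y :: nat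
  proof -
    obtain x' y' where "x = x' + 2" "y = y' + 2" using \<open>2 \<le> x\<close> \<open>2 \<le> y\<close> by (metis add.commute le_Suc_ex)
    then show ?thesis by simp
  qed
  have "aval (Plus e1 e2) s < 2 ^ (esize e1 * b) + 2 ^ (esize e2 * b)" using Plus by simp
  also have "\<dots> \<le> 2 ^ (esize e1 * b) * 2 ^ (esize e2 * b)" using two by (intro le) auto
  finally show ?case by (simp add: power_add distrib_right)
next
  case (Minus e1 e2)
  have "aval (Minus e1 e2) s < 2 ^ (esize e1 * b)" using Minus by simp
  also have "\<dots> \<le> 2 ^ (esize (Minus e1 e2) * b)" by (intro power_increasing) auto
  finally show ?case .
next
  case (Times e1 e2)
  then have "aval (Times e1 e2) s < 2 ^ (esize e1 * b) * 2 ^ (esize e2 * b)"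
    by (simp add: mult_strict_mono')
  then show ?case by (simp add: power_add distrib_right)
next
  case (Quot e1 e2)
  have "aval (Quot e1 e2) s \<le> aval e1 s" by simp
  also have "\<dots> < 2 ^ (esize e1 * b)" using Quot by simp
  also have "\<dots> \<le> 2 ^ (esize (Quot e1 e2) * b)" by (intro power_increasing) auto
  finally show ?case .
next
  case (Rem e1 e2)
  have "aval (Rem e1 e2) s \<le> aval e1 s" by simp
  also have "\<dots> < 2 ^ (esize e1 * b)" using Rem by simp
  also have "\<dots> \<le> 2 ^ (esize (Rem e1 e2) * b)" by (intro power_increasing) auto
  finally show ?case .
qed

lemma len_aval_le:
  assumes "bounded b s" "b \<ge> 1"
  shows "len (aval e s) \<le> 2 * esize e * b"
  using aval_less [OF assms, of e] assms(2) esize_pos [of e] by (intro len_le) auto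

lemma acost_le:
  assumes "bounded b s" "b \<ge> 1"
  shows "acost e s \<le> ecost e * b"
proof (induction e)
  case (Lit c)
  then show ?case using assms by simp
next
  case (Cell x e)
  have "s x (aval e s) < 2 ^ (1 * b)" using assms by (simp add: bounded_def)
  from len_le [OF this assms(2)] have "len (s x (aval e s)) \<le> 2 * b" by simp
  then show ?case using Cell len_aval_le [OF assms, of e] by (simp add: algebra_simps)
next
  case (Plus a b')
  then show ?case using len_aval_le [OF assms, of a] len_aval_le [OF assms, of b'] by (simp add: algebra_simps)
next
  case (Minus a b')
  then show ?case using len_aval_le [OF assms, of a] len_aval_le [OF assms, of b'] by (simp add: algebra_simps)
next
  case (Times a b')
  then show ?case using len_aval_le [OF assms, of a] len_aval_le [OF assms, of b'] by (simp add: algebra_simps)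
next
  case (Quot a b')
  then show ?case using len_aval_le [OF assms, of a] len_aval_le [OF assms, of b'] by (simp add: algebra_simps)
next
  case (Rem a b')
  then show ?case using len_aval_le [OF assms, of a] len_aval_le [OF assms, of b'] by (simp add: algebra_simps)
qed

definition assign_cost :: "aexp \<Rightarrow> aexp \<Rightarrow> nat" where
  "assign_cost a e = ecost a + ecost e + 2 * esize a + 2 * esize e"

lemma runs_Assign:
  assumes "bounded b s" "b \<ge> 1"
  shows "runs (Assign x a e) s (assign_cost a e * b) (s(x := (s x)(aval a s := aval e s)))"
proof -
  have "acost a s + acost e s + len (aval a s) + len (aval e s) \<le> assign_cost a e * b"
    using acost_le [OF assms, of a] acost_le [OF assms, of e] len_aval_le [OF assms, of a] len_aval_le [OF assms, of e]
    by (simp add: assign_cost_def algebra_simps)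
  then show ?thesis unfolding runs_def using exec.Assign by blast
qed

lemma bounded_upd:
  assumes "bounded b s" "v < 2 ^ b"
  shows "bounded b (s(x := (s x)(i := v)))"
  using assms by (simp add: bounded_def)

section \<open>Counting loops\<close>

lemma runs_While:
  assumes step: "\<And>t s. t < m \<Longrightarrow> I t s \<Longrightarrow> aval e s \<noteq> 0 \<and> (\<exists>s'. runs c s T s' \<and> I (Suc t) s')"
    and stop: "\<And>s. I m s \<Longrightarrow> aval e s = 0"
    and bnd: "\<And>t s. t \<le> m \<Longrightarrow> I t s \<Longrightarrow> bounded b s" and b: "b \<ge> 1"
    and init: "I 0 s"
  shows "\<exists>s'. runs (While e c) s (m * T + (m + 1) * (ecost e * b)) s' \<and> I m s'"
proof -
  have "\<exists>s'. runs (While e c) s (k * T + (k + 1) * (ecost e * b)) s' \<and> I m s'"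
    if "k \<le> m" "I (m - k) s" for k s
    using that
  proof (induction k arbitrary: s)
    case 0
    then have "exec (While e c) s (acost e s) s" by (intro exec.WhileFalse stop) simp
    moreover have "acost e s \<le> ecost e * b" using 0 bnd [of m s] b by (intro acost_le) auto
    ultimately show ?case using 0 unfolding runs_def by auto
  next
    case (Suc k)
    then have "m - Suc k < m" by simp
    from step [OF this Suc.prems(2)] obtain s1 where s1: "aval e s \<noteq> 0" "runs c s T s1" "I (Suc (m - Suc k)) s1"
      by blast
    have "Suc (m - Suc k) = m - k" using Suc.prems(1) by simp
    with s1(3) Suc.IH [of s1] Suc.prems(1) obtain s2 where
      s2: "runs (While e c) s1 (k * T + (k + 1) * (ecost e * b)) s2" "I m s2" by auto
    from s1(2) obtain t1 where t1: "t1 \<le> T" "exec c s t1 s1" by (auto simp: runs_def)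
    from s2(1) obtain t2 where t2: "t2 \<le> k * T + (k + 1) * (ecost e * b)" "exec (While e c) s1 t2 s2"
      by (auto simp: runs_def)
    have "acost e s \<le> ecost e * b" using bnd [of "m - Suc k" s] Suc.prems(2) b by (intro acost_le) auto
    then have "acost e s + t1 + t2 \<le> Suc k * T + (Suc k + 1) * (ecost e * b)"
      using t1(1) t2(1) by simp
    then show ?case using exec.WhileTrue [OF s1(1) t1(2) t2(2)] s2(2) unfolding runs_def by blast
  qed
  from this [of m s] init show ?thesis by simp
qed

text \<open>The loop from which almost the whole program is built. The right-hand side may read the
  counter \<open>''i''\<close>; quotients and remainders of it replace nested loops.\<close>

definition fill :: "string \<Rightarrow> aexp \<Rightarrow> aexp \<Rightarrow> com" where
  "fill x n e = Seq (Assign ''i'' (Lit 0) (Lit 0))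
     (While (Minus n (C0 ''i'')) (Seq (Assign x (C0 ''i'') e) (Assign ''i'' (Lit 0) (Plus (C0 ''i'') (Lit 1)))))"

definition fill_cost :: "aexp \<Rightarrow> aexp \<Rightarrow> nat" where
  "fill_cost n e = assign_cost (Lit 0) (Lit 0) + assign_cost (C0 ''i'') e +
     assign_cost (Lit 0) (Plus (C0 ''i'') (Lit 1)) + 2 * ecost (Minus n (C0 ''i''))"

definition fill_state :: "state \<Rightarrow> string \<Rightarrow> (nat \<Rightarrow> nat) \<Rightarrow> nat \<Rightarrow> state" where
  "fill_state s x g t = s(''i'' := (s ''i'')(0 := t), x := (\<lambda>y. if y < t then g y else s x y))"

lemma fill_state_apply:
  assumes "x \<noteq> ''i''"
  shows "fill_state s x g t ''i'' 0 = t"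
    and "fill_state s x g t x y = (if y < t then g y else s x y)"
    and "z \<noteq> ''i'' \<Longrightarrow> z \<noteq> x \<Longrightarrow> fill_state s x g t z = s z"
  using assms by (auto simp: fill_state_def)

text \<open>The right-hand side may refer to entries of the array that were filled before.\<close>

lemma runs_fill:
  assumes bnd: "bounded b s" "b \<ge> 1" and x: "x \<noteq> ''i''"
    and N: "\<And>t. t \<le> N \<Longrightarrow> aval n (fill_state s x g t) = N" and Nb: "N < 2 ^ b"
    and e: "\<And>t. t < N \<Longrightarrow> aval e (fill_state s x g t) = g t"
    and gb: "\<And>t. t < N \<Longrightarrow> g t < 2 ^ b"
  shows "runs (fill x n e) s ((N + 1) * (fill_cost n e * b)) (fill_state s x g N) \<and> bounded b (fill_state s x g N)"
proof
  have bs: "bounded b (fill_state s x g t)" if "t \<le> N" for t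
    using bnd(1) that Nb gb by (auto simp: fill_state_def bounded_def intro: le_less_trans)
  from bs [of N] show "bounded b (fill_state s x g N)" by simp
  define T where "T = assign_cost (C0 ''i'') e * b + assign_cost (Lit 0) (Plus (C0 ''i'') (Lit 1)) * b"
  let ?w = "Minus n (C0 ''i'')"
  have "\<exists>s'. runs (While ?w (Seq (Assign x (C0 ''i'') e) (Assign ''i'' (Lit 0) (Plus (C0 ''i'') (Lit 1)))))
      (fill_state s x g 0) (N * T + (N + 1) * (ecost ?w * b)) s' \<and> s' = fill_state s x g N"
  proof (rule runs_While)
    fix t s' assume t: "t < N" "s' = fill_state s x g t"
    have b': "bounded b s'" using bs t by simp
    have v0: "aval ?w s' \<noteq> 0" using t N [of t] by (simp add: fill_state_apply x)
    let ?s1 = "s'(x := (s' x)(aval (C0 ''i'') s' := aval e s'))"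
    have r1: "runs (Assign x (C0 ''i'') e) s' (assign_cost (C0 ''i'') e * b) ?s1"
      using b' bnd(2) by (rule runs_Assign)
    have "aval e s' = g t" using e t by simp
    then have b1: "bounded b ?s1" using b' gb t(1) by (intro bounded_upd) auto
    let ?s2 = "?s1(''i'' := (?s1 ''i'')(aval (Lit 0) ?s1 := aval (Plus (C0 ''i'') (Lit 1)) ?s1))"
    have r2: "runs (Assign ''i'' (Lit 0) (Plus (C0 ''i'') (Lit 1))) ?s1
        (assign_cost (Lit 0) (Plus (C0 ''i'') (Lit 1)) * b) ?s2"
      using b1 bnd(2) by (rule runs_Assign)
    have "?s2 = fill_state s x g (Suc t)"
      using x \<open>aval e s' = g t\<close> unfolding t(2) by (auto simp: fill_state_def fun_eq_iff less_Suc_eq)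
    then show "aval ?w s' \<noteq> 0 \<and> (\<exists>s''. runs (Seq (Assign x (C0 ''i'') e) (Assign ''i'' (Lit 0) (Plus (C0 ''i'') (Lit 1)))) s' T s''
        \<and> s'' = fill_state s x g (Suc t))"
      using v0 runs_Seq [OF r1 r2] unfolding T_def by auto
  next
    fix s' assume "s' = fill_state s x g N"
    then show "aval ?w s' = 0" using N [of N] x by (simp add: fill_state_apply)
  next
    fix t s' assume "t \<le> N" "s' = fill_state s x g t"
    then show "bounded b s'" using bs by simp
  qed (use bnd in auto)
  then have r: "runs (While ?w (Seq (Assign x (C0 ''i'') e) (Assign ''i'' (Lit 0) (Plus (C0 ''i'') (Lit 1)))))
      (fill_state s x g 0) (N * T + (N + 1) * (ecost ?w * b)) (fill_state s x g N)" by blast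
  have "runs (Assign ''i'' (Lit 0) (Lit 0)) s (assign_cost (Lit 0) (Lit 0) * b) (s(''i'' := (s ''i'')(0 := 0)))"
    using runs_Assign [OF bnd, of "''i''" "Lit 0" "Lit 0"] by simp
  moreover have "s(''i'' := (s ''i'')(0 := 0)) = fill_state s x g 0" using x by (auto simp: fill_state_def)
  ultimately have "runs (fill x n e) s (assign_cost (Lit 0) (Lit 0) * b + (N * T + (N + 1) * (ecost ?w * b))) (fill_state s x g N)"
    unfolding fill_def using runs_Seq [OF _ r] by simp
  moreover have "assign_cost (Lit 0) (Lit 0) * b + (N * T + (N + 1) * (ecost ?w * b)) \<le> (N + 1) * (fill_cost n e * b)"
    by (simp add: T_def fill_cost_def algebra_simps)
  ultimately show "runs (fill x n e) s ((N + 1) * (fill_cost n e * b)) (fill_state s x g N)" by (rule runs_mono)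
qed

section \<open>Expressions for sums, tests and tables\<close>

primrec Sum :: "nat \<Rightarrow> (nat \<Rightarrow> aexp) \<Rightarrow> aexp" where
  "Sum 0 f = Lit 0"
| "Sum (Suc n) f = Plus (Sum n f) (f n)"

lemma aval_Sum: "aval (Sum n f) s = (\<Sum>a<n. aval (f a) s)"
  by (induction n) auto

text \<open>Truncated subtraction turns \<open>1 - v\<close> into a test for \<open>v = 0\<close>.\<close>

definition Is0 :: "aexp \<Rightarrow> aexp" where "Is0 e = Minus (Lit 1) e"

definition Eq :: "aexp \<Rightarrow> aexp \<Rightarrow> aexp" where
  "Eq a b = Is0 (Plus (Minus a b) (Minus b a))"

definition Less :: "aexp \<Rightarrow> aexp \<Rightarrow> aexp" where
  "Less a b = Is0 (Minus (Plus a (Lit 1)) b)"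

lemma aval_tests [simp]:
  "aval (Is0 e) s = of_bool (aval e s = 0)"
  "aval (Eq a c) s = of_bool (aval a s = aval c s)"
  "aval (Less a c) s = of_bool (aval a s < aval c s)"
  by (auto simp: Is0_def Eq_def Less_def)

text \<open>An integer coefficient, up to a multiple of \<open>p\<close>.\<close>

definition Coef :: "int \<Rightarrow> aexp" where
  "Coef c = (if c \<ge> 0 then Lit (nat c) else Times (Lit (nat (- c))) (Minus (C0 ''p'') (Lit 1)))"

definition coef_val :: "nat \<Rightarrow> int \<Rightarrow> nat" where
  "coef_val p c = (if c \<ge> 0 then nat c else nat (- c) * (p - 1))"

lemma aval_Coef: "aval (Coef c) s = coef_val (s ''p'' 0) c"
  by (simp add: Coef_def coef_val_def)

lemma cong_coef_val:
  assumes "p \<ge> 1"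
  shows "[int (coef_val p c) = c] (mod int p)"
proof (cases "c \<ge> 0")
  case False
  then have "int (coef_val p c) = c + (- c) * int p"
    using assms by (simp add: coef_val_def of_nat_diff algebra_simps)
  then show ?thesis by (simp add: cong_iff_dvd_diff)
qed (simp add: coef_val_def)

text \<open>A lookup in a hard-coded table as a sum of indicators times values, because expressions
  have no conditional.\<close>

definition Table :: "nat \<Rightarrow> (nat \<Rightarrow> aexp) \<Rightarrow> aexp \<Rightarrow> aexp" where
  "Table n f e = Sum n (\<lambda>a. Times (Eq e (Lit a)) (f a))"

lemma aval_Table:
  assumes "aval e s < n"
  shows "aval (Table n f e) s = aval (f (aval e s)) s"
proof -
  have "aval (Table n f e) s = (\<Sum>a<n. if a = aval e s then aval (f (aval e s)) s else 0)"
    unfolding Table_def aval_Sum by (intro sum.cong) auto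
  then show ?thesis using assms by simp
qed

section \<open>Yates' algorithm as a program\<close>

definition yates_exp :: "string \<Rightarrow> (nat \<Rightarrow> nat \<Rightarrow> int) \<Rightarrow> nat \<Rightarrow> nat \<Rightarrow> aexp" where
  "yates_exp x f D E = Rem (Sum D (\<lambda>d.
     Times (Table E (\<lambda>\<rho>. Coef (f \<rho> d)) (Rem (C0 ''i'') (Lit E)))
       (Cell x (Plus (Times (Lit d) (C0 ''m'')) (Quot (C0 ''i'') (Lit E)))))) (C0 ''p'')"

text \<open>\<open>''m''\<close> is the current array length; divided by \<open>D\<close> it becomes
  the stride between old entries that differ only in their leading digit. The new array is built in
  \<open>''t''\<close> and copied back, since its entries read old ones at positions that would
  otherwise have been overwritten.\<close>

definition yates_body :: "string \<Rightarrow> (nat \<Rightarrow> nat \<Rightarrow> int) \<Rightarrow> nat \<Rightarrow> nat \<Rightarrow> com" where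
  "yates_body x f D E =
     Seq (Assign ''m'' (Lit 0) (Quot (C0 ''m'') (Lit D)))
    (Seq (fill ''t'' (Times (C0 ''m'') (Lit E)) (yates_exp x f D E))
    (Seq (fill x (Times (C0 ''m'') (Lit E)) (Cell ''t'' (C0 ''i'')))
    (Seq (Assign ''m'' (Lit 0) (Times (C0 ''m'') (Lit E)))
         (Assign ''j'' (Lit 0) (Plus (C0 ''j'') (Lit 1))))))"

definition yates :: "string \<Rightarrow> (nat \<Rightarrow> nat \<Rightarrow> int) \<Rightarrow> nat \<Rightarrow> nat \<Rightarrow> aexp \<Rightarrow> com" where
  "yates x f D E n =
     Seq (Assign ''m'' (Lit 0) n)
    (Seq (Assign ''j'' (Lit 0) (Lit 0))
         (While (Minus (C0 ''r'') (C0 ''j'')) (yates_body x f D E)))"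

definition yates_cost :: "string \<Rightarrow> (nat \<Rightarrow> nat \<Rightarrow> int) \<Rightarrow> nat \<Rightarrow> nat \<Rightarrow> aexp \<Rightarrow> nat" where
  "yates_cost x f D E n = assign_cost (Lit 0) n + assign_cost (Lit 0) (Lit 0) +
     2 * ecost (Minus (C0 ''r'') (C0 ''j'')) +
     assign_cost (Lit 0) (Quot (C0 ''m'') (Lit D)) +
     fill_cost (Times (C0 ''m'') (Lit E)) (yates_exp x f D E) +
     fill_cost (Times (C0 ''m'') (Lit E)) (Cell ''t'' (C0 ''i'')) +
     assign_cost (Lit 0) (Times (C0 ''m'') (Lit E)) +
     assign_cost (Lit 0) (Plus (C0 ''j'') (Lit 1))"

lemma runs_yates_body:
  assumes bnd: "bounded b s" "b \<ge> 1" and x: "x \<notin> {''i'', ''j'', ''m'', ''t'', ''p'', ''r''}"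
    and D: "D > 0" and E: "E > 0" and m: "s ''m'' 0 = D * Q" and p: "s ''p'' 0 = p" "p \<ge> 1"
    and L: "Q * E \<le> L" "L < 2 ^ b" and j: "s ''j'' 0 = t" "t + 1 < 2 ^ b"
  shows "\<exists>s'. runs (yates_body x f D E) s (2 * (L + 1) * (yates_cost x f D E n * b)) s' \<and> bounded b s' \<and>
    (\<forall>z. z \<notin> {x, ''i'', ''j'', ''m'', ''t''} \<longrightarrow> s' z = s z) \<and> s' ''j'' 0 = t + 1 \<and> s' ''m'' 0 = Q * E \<and>
    (\<forall>y<Q * E. s' x y = (\<Sum>d<D. coef_val p (f (y mod E) d) * s x (d * Q + y div E)) mod p)"
proof -
  define g where "g y = (\<Sum>d<D. coef_val p (f (y mod E) d) * s x (d * Q + y div E)) mod p" for y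
  have gb: "g y < 2 ^ b" for y
  proof -
    have "g y < p" using p(2) by (simp add: g_def)
    also have "p < 2 ^ b" using bnd(1) p(1) unfolding bounded_def by metis
    finally show ?thesis .
  qed
  have "Q * 1 \<le> Q * E" using E by (intro mult_left_mono) auto
  then have Qb: "Q < 2 ^ b" using L by linarith
  define s1 where "s1 = s(''m'' := (s ''m'')(0 := Q))"
  have r1: "runs (Assign ''m'' (Lit 0) (Quot (C0 ''m'') (Lit D))) s (assign_cost (Lit 0) (Quot (C0 ''m'') (Lit D)) * b) s1"
    using runs_Assign [OF bnd, of "''m''" "Lit 0" "Quot (C0 ''m'') (Lit D)"] D m by (simp add: s1_def)
  have b1: "bounded b s1" unfolding s1_def using bnd(1) Qb by (intro bounded_upd) auto
  define s2 where "s2 = fill_state s1 ''t'' g (Q * E)"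
  have "runs (fill ''t'' (Times (C0 ''m'') (Lit E)) (yates_exp x f D E)) s1
      ((Q * E + 1) * (fill_cost (Times (C0 ''m'') (Lit E)) (yates_exp x f D E) * b)) s2 \<and> bounded b s2"
    unfolding s2_def
  proof (rule runs_fill [OF b1 bnd(2)])
    fix y assume "y < Q * E"
    show "aval (yates_exp x f D E) (fill_state s1 ''t'' g y) = g y"
      using x p E by (simp add: yates_exp_def aval_Sum aval_Table aval_Coef fill_state_apply s1_def g_def)
  qed (use L gb in \<open>auto simp: fill_state_apply s1_def\<close>)
  then have r2: "runs (fill ''t'' (Times (C0 ''m'') (Lit E)) (yates_exp x f D E)) s1
      ((Q * E + 1) * (fill_cost (Times (C0 ''m'') (Lit E)) (yates_exp x f D E) * b)) s2" and b2: "bounded b s2" by auto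
  define s3 where "s3 = fill_state s2 x g (Q * E)"
  have "runs (fill x (Times (C0 ''m'') (Lit E)) (Cell ''t'' (C0 ''i''))) s2
      ((Q * E + 1) * (fill_cost (Times (C0 ''m'') (Lit E)) (Cell ''t'' (C0 ''i'')) * b)) s3 \<and> bounded b s3"
    unfolding s3_def
    by (rule runs_fill [OF b2 bnd(2)])
      (use L gb x in \<open>auto simp: fill_state_apply s1_def s2_def\<close>)
  then have r3: "runs (fill x (Times (C0 ''m'') (Lit E)) (Cell ''t'' (C0 ''i''))) s2
      ((Q * E + 1) * (fill_cost (Times (C0 ''m'') (Lit E)) (Cell ''t'' (C0 ''i'')) * b)) s3" and b3: "bounded b s3" by auto
  define s4 where "s4 = s3(''m'' := (s3 ''m'')(0 := Q * E))"
  have v3: "s3 ''m'' 0 = Q" "s3 ''j'' 0 = t"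
    using x j by (auto simp: fill_state_apply s1_def s2_def s3_def)
  have r4: "runs (Assign ''m'' (Lit 0) (Times (C0 ''m'') (Lit E))) s3 (assign_cost (Lit 0) (Times (C0 ''m'') (Lit E)) * b) s4"
    using runs_Assign [OF b3 bnd(2), of "''m''" "Lit 0" "Times (C0 ''m'') (Lit E)"] v3 by (simp add: s4_def)
  have b4: "bounded b s4" unfolding s4_def using b3 L by (intro bounded_upd) auto
  define s5 where "s5 = s4(''j'' := (s4 ''j'')(0 := t + 1))"
  have r5: "runs (Assign ''j'' (Lit 0) (Plus (C0 ''j'') (Lit 1))) s4 (assign_cost (Lit 0) (Plus (C0 ''j'') (Lit 1)) * b) s5"
    using runs_Assign [OF b4 bnd(2), of "''j''" "Lit 0" "Plus (C0 ''j'') (Lit 1)"] v3 by (simp add: s5_def s4_def)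
  have b5: "bounded b s5" unfolding s5_def using b4 j by (intro bounded_upd) auto
  let ?T1 = "assign_cost (Lit 0) (Quot (C0 ''m'') (Lit D))"
  let ?T2 = "fill_cost (Times (C0 ''m'') (Lit E)) (yates_exp x f D E)"
  let ?T3 = "fill_cost (Times (C0 ''m'') (Lit E)) (Cell ''t'' (C0 ''i''))"
  let ?T4 = "assign_cost (Lit 0) (Times (C0 ''m'') (Lit E))"
  let ?T5 = "assign_cost (Lit 0) (Plus (C0 ''j'') (Lit 1))"
  have "runs (yates_body x f D E) s (?T1 * b + ((Q * E + 1) * (?T2 * b) + ((Q * E + 1) * (?T3 * b) + (?T4 * b + ?T5 * b)))) s5"
    unfolding yates_body_def by (rule runs_Seq [OF r1 runs_Seq [OF r2 runs_Seq [OF r3 runs_Seq [OF r4 r5]]]])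
  moreover have "?T1 * b + ((Q * E + 1) * (?T2 * b) + ((Q * E + 1) * (?T3 * b) + (?T4 * b + ?T5 * b))) \<le>
      2 * (L + 1) * (yates_cost x f D E n * b)"
  proof -
    have "?T1 * b + ((Q * E + 1) * (?T2 * b) + ((Q * E + 1) * (?T3 * b) + (?T4 * b + ?T5 * b))) \<le>
       (L + 1) * (?T1 * b) + ((L + 1) * (?T2 * b) + ((L + 1) * (?T3 * b) + ((L + 1) * (?T4 * b) + (L + 1) * (?T5 * b))))"
      using L(1) by (intro add_mono mult_right_mono) auto
    also have "\<dots> = (L + 1) * ((?T1 + ?T2 + ?T3 + ?T4 + ?T5) * b)" by (simp add: algebra_simps)
    also have "\<dots> \<le> 2 * (L + 1) * (yates_cost x f D E n * b)"
      unfolding yates_cost_def by (intro mult_mono) auto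
    finally show ?thesis .
  qed
  ultimately have "runs (yates_body x f D E) s (2 * (L + 1) * (yates_cost x f D E n * b)) s5" by (rule runs_mono)
  moreover have "s5 z = s z" if "z \<notin> {x, ''i'', ''j'', ''m'', ''t''}" for z
    using that x by (auto simp: s5_def s4_def s3_def s2_def s1_def fill_state_apply)
  moreover have "s5 x y = g y" if "y < Q * E" for y
    using that x by (auto simp: s5_def s4_def s3_def fill_state_apply)
  moreover have "s5 ''j'' 0 = t + 1" "s5 ''m'' 0 = Q * E" by (simp_all add: s5_def s4_def)
  ultimately show ?thesis using b5 unfolding g_def by blast
qed

text \<open>\<open>Z\<close> vectors are transformed at once. Each round moves a digit from the top
  to the bottom of the index, so the number of the vector is the low part of the input index
  \<open>d * Z + y\<close> and the high part of the output index \<open>y * E ^ r + \<rho>\<close>.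
  After \<open>t\<close> rounds the array has length \<open>Z * D ^ (r - t) * E ^ t\<close>, which
  \<open>L\<close> has to bound.\<close>

lemma runs_yates:
  assumes bnd: "bounded b s" "b \<ge> 1" and x: "x \<notin> {''i'', ''j'', ''m'', ''t'', ''p'', ''r''}"
    and D: "D > 0" and E: "E > 0" and n: "aval n s = Z * D ^ r" and p: "s ''p'' 0 = p" "p \<ge> 1" and r: "s ''r'' 0 = r"
    and L: "\<And>t. t \<le> r \<Longrightarrow> Z * D ^ (r - t) * E ^ t \<le> L" "L < 2 ^ b"
    and lt: "\<And>y. y < Z * D ^ r \<Longrightarrow> s x y < p"
  shows "\<exists>s'. runs (yates x f D E n) s (3 * (r + 1) * (L + 1) * (yates_cost x f D E n * b)) s' \<and> bounded b s' \<and>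
    (\<forall>z. z \<notin> {x, ''i'', ''j'', ''m'', ''t''} \<longrightarrow> s' z = s z) \<and> (\<forall>y<Z * E ^ r. s' x y < p) \<and>
    (\<forall>y<Z. \<forall>\<rho><E ^ r. [int (s' x (y * E ^ r + \<rho>)) = (\<Sum>d<D ^ r. tpow f D E r \<rho> d * int (s x (d * Z + y)))] (mod int p))"
proof -
  define I where "I t s' \<longleftrightarrow> bounded b s' \<and> (\<forall>z. z \<notin> {x, ''i'', ''j'', ''m'', ''t''} \<longrightarrow> s' z = s z) \<and>
     s' ''j'' 0 = t \<and> s' ''m'' 0 = Z * D ^ (r - t) * E ^ t \<and> (\<forall>y<Z * D ^ (r - t) * E ^ t. s' x y < p) \<and>
     (\<forall>y<Z * D ^ (r - t). \<forall>\<rho><E ^ t. [int (s' x (y * E ^ t + \<rho>)) =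
        (\<Sum>d<D ^ t. tpow f D E t \<rho> d * int (s x (d * (Z * D ^ (r - t)) + y)))] (mod int p))" for t s'
  let ?w = "Minus (C0 ''r'') (C0 ''j'')"
  let ?Y = "yates_cost x f D E n"
  define s1 where "s1 = s(''m'' := (s ''m'')(0 := Z * D ^ r))"
  define s2 where "s2 = s1(''j'' := (s1 ''j'')(0 := 0))"
  have r1: "runs (Assign ''m'' (Lit 0) n) s (assign_cost (Lit 0) n * b) s1"
    using runs_Assign [OF bnd, of "''m''" "Lit 0" n] n by (simp add: s1_def)
  have b1: "bounded b s1" unfolding s1_def using bnd(1) L(1) [of 0] L(2) by (intro bounded_upd) auto
  have r2: "runs (Assign ''j'' (Lit 0) (Lit 0)) s1 (assign_cost (Lit 0) (Lit 0) * b) s2"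
    using runs_Assign [OF b1 bnd(2), of "''j''" "Lit 0" "Lit 0"] by (simp add: s2_def)
  have b2: "bounded b s2" unfolding s2_def using b1 by (intro bounded_upd) auto
  have rb: "r < 2 ^ b" using bnd(1) r unfolding bounded_def by metis
  have "I 0 s2" unfolding I_def using b2 x lt by (auto simp: s2_def s1_def)
  have "\<exists>s'. runs (While ?w (yates_body x f D E)) s2
      (r * (2 * (L + 1) * (?Y * b)) + (r + 1) * (ecost ?w * b)) s' \<and> I r s'"
  proof (rule runs_While [where I = I, OF _ _ _ bnd(2) \<open>I 0 s2\<close>])
    fix t s' assume t: "t < r" and I: "I t s'"
    define m where "m = r - Suc t"
    have m: "r - t = Suc m" using t by (simp add: m_def)
    define Q where "Q = Z * D ^ m * E ^ t"
    from I have I': "bounded b s'" "\<And>z. z \<notin> {x, ''i'', ''j'', ''m'', ''t''} \<Longrightarrow> s' z = s z"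
      "s' ''j'' 0 = t" "s' ''m'' 0 = D * Q" "\<And>y \<rho>. y < Z * D ^ Suc m \<Longrightarrow> \<rho> < E ^ t \<Longrightarrow> [int (s' x (y * E ^ t + \<rho>)) =
        (\<Sum>d<D ^ t. tpow f D E t \<rho> d * int (s x (d * (Z * D ^ Suc m) + y)))] (mod int p)"
      by (simp_all add: I_def m Q_def)
    have frame: "s' ''p'' 0 = p" "s' ''r'' 0 = r" using I'(2) [of "''p''"] I'(2) [of "''r''"] p r x by auto
    have QE: "Q * E = Z * D ^ (r - Suc t) * E ^ Suc t" by (simp add: Q_def m_def)
    have QL: "Q * E \<le> L" unfolding QE using L(1) [of "Suc t"] t by simp
    have tb: "t + 1 < 2 ^ b" using t rb by simp
    from runs_yates_body [OF I'(1) bnd(2) x D E I'(4) frame(1) p(2) QL L(2) I'(3) tb, of f n]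
    obtain s'' where s'': "runs (yates_body x f D E) s' (2 * (L + 1) * (?Y * b)) s''" "bounded b s''"
      "\<And>z. z \<notin> {x, ''i'', ''j'', ''m'', ''t''} \<Longrightarrow> s'' z = s' z" "s'' ''j'' 0 = t + 1" "s'' ''m'' 0 = Q * E"
      "\<And>y. y < Q * E \<Longrightarrow> s'' x y = (\<Sum>d<D. coef_val p (f (y mod E) d) * s' x (d * Q + y div E)) mod p"
      by blast
    have "I (Suc t) s''"
      unfolding I_def QE [symmetric]
    proof (intro conjI allI impI)
      fix y \<rho> assume y: "y < Z * D ^ (r - Suc t)" and \<rho>: "\<rho> < E ^ Suc t"
      show "[int (s'' x (y * E ^ Suc t + \<rho>)) =
        (\<Sum>d<D ^ Suc t. tpow f D E (Suc t) \<rho> d * int (s x (d * (Z * D ^ (r - Suc t)) + y)))] (mod int p)"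
        unfolding m_def [symmetric]
      proof (rule yates_step [where V = "\<lambda>y. int (s' x y)" and ?V0.0 = "\<lambda>y. int (s x y)" and V' = "\<lambda>y. int (s'' x y)", OF I'(5)])
        fix y \<rho> assume y: "y < Z * D ^ m * E ^ t" and \<rho>: "\<rho> < E"
        have "y * E + \<rho> < Q * E" using mult_add_less [OF y \<rho>] by (simp add: Q_def)
        then have "int (s'' x (y * E + \<rho>)) = (\<Sum>d<D. int (coef_val p (f \<rho> d)) * int (s' x (d * Q + y))) mod int p"
          using \<rho> by (simp add: s''(6) div_mod_mult_add of_nat_mod)
        then have "[int (s'' x (y * E + \<rho>)) = (\<Sum>d<D. int (coef_val p (f \<rho> d)) * int (s' x (d * Q + y)))] (mod int p)"
          by simp
        also have "[(\<Sum>d<D. int (coef_val p (f \<rho> d)) * int (s' x (d * Q + y))) = (\<Sum>d<D. f \<rho> d * int (s' x (d * Q + y)))] (mod int p)"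
          by (intro cong_sum cong_mult cong_refl cong_coef_val p(2))
        finally show "[int (s'' x (y * E + \<rho>)) = (\<Sum>d<D. f \<rho> d * int (s' x (d * (Z * D ^ m * E ^ t) + y)))] (mod int p)"
          by (simp only: Q_def)
      qed (use y \<rho> in \<open>simp_all add: m_def\<close>)
    next
      show "s'' ''j'' 0 = Suc t" using s''(4) by simp
    next
      fix y assume "y < Q * E"
      then show "s'' x y < p" using p(2) by (simp add: s''(6))
    qed (use s'' I'(2) x in auto)
    moreover have "aval ?w s' \<noteq> 0" using frame I'(3) t by simp
    ultimately show "aval ?w s' \<noteq> 0 \<and> (\<exists>s''. runs (yates_body x f D E) s' (2 * (L + 1) * (?Y * b)) s'' \<and> I (Suc t) s'')"
      using s''(1) by blast
  next
    fix s' assume I: "I r s'"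
    then have "s' ''r'' 0 = r" "s' ''j'' 0 = r" using r x by (auto simp: I_def)
    then show "aval ?w s' = 0" by simp
  next
    fix t s' assume "I t s'"
    then show "bounded b s'" by (simp add: I_def)
  qed
  then obtain s' where s': "runs (While ?w (yates_body x f D E)) s2
      (r * (2 * (L + 1) * (?Y * b)) + (r + 1) * (ecost ?w * b)) s'" "I r s'" by blast
  have "runs (yates x f D E n) s (assign_cost (Lit 0) n * b + (assign_cost (Lit 0) (Lit 0) * b +
      (r * (2 * (L + 1) * (?Y * b)) + (r + 1) * (ecost ?w * b)))) s'"
    unfolding yates_def by (rule runs_Seq [OF r1 runs_Seq [OF r2 s'(1)]])
  moreover have "assign_cost (Lit 0) n * b + (assign_cost (Lit 0) (Lit 0) * b +
      (r * (2 * (L + 1) * (?Y * b)) + (r + 1) * (ecost ?w * b))) \<le> 3 * (r + 1) * (L + 1) * (?Y * b)"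
  proof -
    have "assign_cost (Lit 0) n + assign_cost (Lit 0) (Lit 0) + 2 * ecost ?w \<le> ?Y" by (simp add: yates_cost_def)
    then have 1: "(r + 1) * ((assign_cost (Lit 0) n + assign_cost (Lit 0) (Lit 0) + 2 * ecost ?w) * b) \<le> (r + 1) * (?Y * b)"
      by (intro mult_le_mono) auto
    have "2 * (r * (L + 1) * (?Y * b)) + (r + 1) * (?Y * b) \<le> 3 * (r + 1) * (L + 1) * (?Y * b)"
    proof -
      have "2 * (r * (L + 1) * (?Y * b)) + (r + 1) * (?Y * b) \<le>
          2 * ((r + 1) * (L + 1) * (?Y * b)) + (r + 1) * (L + 1) * (?Y * b)"
        by (intro add_mono mult_le_mono) auto
      then show ?thesis by (simp add: algebra_simps)
    qed
    with 1 show ?thesis by (simp add: algebra_simps)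
  qed
  ultimately have "runs (yates x f D E n) s (3 * (r + 1) * (L + 1) * (?Y * b)) s'" by (rule runs_mono)
  then show ?thesis using s'(2) unfolding I_def by (intro exI [of _ s']) simp
qed

section \<open>The verification program\<close>

text \<open>Padded to size \<open>N\<^sup>r\<close> by zeros and transposed if \<open>tr\<close> holds.\<close>

definition ld :: "bool \<Rightarrow> string \<Rightarrow> aexp \<Rightarrow> aexp \<Rightarrow> aexp \<Rightarrow> aexp" where
  "ld tr x i j u = Times (Times (Less i (C0 ''n'')) (Less j (C0 ''n'')))
     (Cell x (Plus (Times (Plus (Times (if tr then j else i) (C0 ''n'')) (if tr then i else j)) (C0 ''k'')) u))"

definition entry :: "nat \<Rightarrow> nat \<Rightarrow> bool \<Rightarrow> (nat \<Rightarrow> nat) \<Rightarrow> nat \<Rightarrow> nat \<Rightarrow> nat \<Rightarrow> nat" where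
  "entry n k tr a i j u = (if i < n \<and> j < n then a (((if tr then j else i) * n + (if tr then i else j)) * k + u) else 0)"

lemma aval_ld:
  "aval (ld tr x i j u) s = entry (s ''n'' 0) (s ''k'' 0) tr (s x) (aval i s) (aval j s) (aval u s)"
  by (simp add: ld_def entry_def)

text \<open>The digits of \<open>a \<theta>\<^sup>v\<close>, given the digits \<open>a\<close> and the digits \<open>f\<close> of \<open>\<theta>\<^sup>k\<close>.\<close>

primrec shift :: "nat \<Rightarrow> nat \<Rightarrow> (nat \<Rightarrow> nat) \<Rightarrow> (nat \<Rightarrow> nat) \<Rightarrow> nat \<Rightarrow> nat \<Rightarrow> nat" where
  "shift p k f a 0 u = a u"
| "shift p k f a (Suc v) u = ((if u = 0 then 0 else shift p k f a v (u - 1)) + shift p k f a v (k - 1) * f u) mod p"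

abbreviation iE :: aexp where "iE \<equiv> C0 ''i''"
abbreviation kE :: aexp where "kE \<equiv> C0 ''k''"
abbreviation nnE :: aexp where "nnE \<equiv> C0 ''nn''"
abbreviation bbE :: aexp where "bbE \<equiv> Times (C0 ''nn'') (C0 ''mm'')"
abbreviation qkE :: aexp where "qkE \<equiv> Times (C0 ''q'') (C0 ''k'')"
abbreviation IsPos :: "aexp \<Rightarrow> aexp" where "IsPos e \<equiv> Is0 (Is0 e)"

text \<open>
  After the transformation by \<open>yates\<close>, \<open>Y\<close> and \<open>Z\<close> contain \<open>B H\<close> and \<open>C H\<close>, \<open>X\<close> the values of the linear
  forms \<open>\<alpha>\<close> at the digits \<open>u\<close> of \<open>\<theta>\<^sup>v A\<close>, \<open>U\<close> those of \<open>\<beta>\<close> at the digits \<open>v\<close> of the selected columns of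
  \<open>B H\<close>, in blocks \<open>c\<close> of \<open>M\<^sup>r\<close> columns, and \<open>V\<close> the digits of \<open>A (B H)\<close>. The array \<open>W\<close> accumulates
  \<open>\<Sum>v. X U\<close>, and \<open>E\<close> the disjunction of all inequalities between \<open>V\<close> and \<open>Z\<close>. The \<open>j\<close>-th selected column
  has number \<open>J j\<close>.
\<close>

definition lenY :: aexp where "lenY = Times nnE (Times kE nnE)"
definition expY :: "bool \<Rightarrow> string \<Rightarrow> aexp" where
  "expY tr src = ld tr src (Rem iE nnE) (Quot (Quot iE nnE) kE) (Rem (Quot iE nnE) kE)"

definition lenX :: aexp where "lenX = Times (Times nnE nnE) (Times kE kE)"
text \<open>The index is \<open>(x * k + v) * k + u\<close>. For positive \<open>v\<close> the digit
  shifts from \<open>(v - 1, u - 1)\<close>, which lies \<open>k + 1\<close> cells back, and the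
  overflow is the digit \<open>(v - 1, k - 1)\<close>, the last cell of the preceding group of
  \<open>k\<close>.\<close>

definition expX :: "bool \<Rightarrow> string \<Rightarrow> aexp" where
  "expX tr src = (let u = Rem iE kE; v = Rem (Quot iE kE) kE; x = Quot (Quot iE kE) kE in
     Rem (Plus (Times (Is0 v) (ld tr src (Cell ''ra'' x) (Cell ''ca'' x) u))
       (Times (IsPos v) (Plus (Times (IsPos u) (Cell ''X'' (Minus iE (Plus kE (Lit 1)))))
         (Times (Cell ''X'' (Minus (Times (Quot iE kE) kE) (Lit 1))) (Cell ''f'' u))))) (C0 ''p''))"

definition lenU :: aexp where "lenU = Times bbE qkE"
definition expU :: aexp where
  "expU = (let v = Rem iE kE; c = Rem (Quot iE kE) (C0 ''q''); x = Quot (Quot iE kE) (C0 ''q'') in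
     Cell ''Y'' (Plus (Times (Plus (Times v nnE) (Cell ''rb'' x)) (C0 ''gg''))
       (Cell ''J'' (Plus (Times c (C0 ''mm'')) (Cell ''cb'' x)))))"

definition lenW :: aexp where "lenW = Times (Times (C0 ''rr'') qkE) kE"
text \<open>\<open>v\<close> is the lowest part of the index, so the partial sum up to
  \<open>v - 1\<close> is in the preceding cell and no inner loop is required. The complete sums are
  the cells with \<open>v = k - 1\<close>, which \<open>expV\<close> picks out.\<close>

definition expW :: aexp where
  "expW = (let v = Rem iE kE; u = Rem (Quot iE kE) kE; c = Rem (Quot (Quot iE kE) kE) (C0 ''q'');
       \<rho> = Quot (Quot (Quot iE kE) kE) (C0 ''q'') in
     Rem (Plus (Times (IsPos v) (Cell ''W'' (Minus iE (Lit 1))))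
       (Times (Cell ''X'' (Plus (Times (Plus (Times v kE) u) (C0 ''rr'')) \<rho>))
              (Cell ''U'' (Plus (Times (Plus (Times c kE) v) (C0 ''rr'')) \<rho>)))) (C0 ''p''))"

definition lenV :: aexp where "lenV = Times (C0 ''rr'') qkE"
definition expV :: aexp where
  "expV = Cell ''W'' (Plus (Times iE kE) (Minus kE (Lit 1)))"

definition lenE :: aexp where "lenE = Times qkE bbE"
definition expE :: aexp where
  "expE = (let x = Rem iE bbE; u = Rem (Quot iE bbE) kE; c = Quot (Quot iE bbE) kE;
       z = Cell ''Z'' (Plus (Times (Plus (Times u nnE) (Cell ''rb'' x)) (C0 ''gg''))
         (Cell ''J'' (Plus (Times c (C0 ''mm'')) (Cell ''cb'' x)))) in
     IsPos (Plus (Times (IsPos iE) (Cell ''E'' (Minus iE (Lit 1))))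
       (Plus (Minus (Cell ''V'' iE) z) (Minus z (Cell ''V'' iE)))))"

text \<open>\<open>L\<close> bounds the length of every array at every round of each transformation,
  with one assumption per array, and \<open>b\<close> bits hold every number that is stored.
  \<open>q\<close> is the number of blocks of selected columns. All values of \<open>J\<close> are
  valid column numbers, also those past the selected ones.\<close>

locale machine =
  fixes N M R G :: nat and \<alpha> \<beta> \<gamma> g :: "nat \<Rightarrow> nat \<Rightarrow> int"
    and n p k r q L b :: nat and J fd :: "nat \<Rightarrow> nat"
  assumes pos: "N \<ge> 2" "M > 0" "R > 0" "G > 0" "p \<ge> 2" "k > 0" "q > 0" "b \<ge> 1"
    and J: "\<And>e. J e < G ^ r"
    and L_less: "L < 2 ^ b"
    and L_X: "\<And>t. t \<le> r \<Longrightarrow> (k * k) * (N * N) ^ (r - t) * R ^ t \<le> L"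
    and L_Y: "\<And>t. t \<le> r \<Longrightarrow> (k * N ^ r) * N ^ (r - t) * G ^ t \<le> L"
    and L_U: "\<And>t. t \<le> r \<Longrightarrow> (q * k) * (N * M) ^ (r - t) * R ^ t \<le> L"
    and L_V: "\<And>t. t \<le> r \<Longrightarrow> (q * k) * R ^ (r - t) * (N * M) ^ t \<le> L"
    and L_W: "R ^ r * (q * k) * k \<le> L"
begin

text \<open>The data that both sides of the test read and never write. \<open>J\<close> is fixed at
  all \<open>e\<close> because the last block of columns reads past the selected ones.\<close>

definition env :: "state \<Rightarrow> bool" where
  "env s \<longleftrightarrow> bounded b s \<and> s ''n'' 0 = n \<and> s ''p'' 0 = p \<and> s ''k'' 0 = k \<and> s ''r'' 0 = r \<and>
     s ''nn'' 0 = N ^ r \<and> s ''mm'' 0 = M ^ r \<and> s ''rr'' 0 = R ^ r \<and> s ''gg'' 0 = G ^ r \<and> s ''q'' 0 = q \<and>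
     (\<forall>x<(N * N) ^ r. s ''ra'' x = row_part N N r x \<and> s ''ca'' x = col_part N N r x) \<and>
     (\<forall>x<(N * M) ^ r. s ''rb'' x = row_part N M r x \<and> s ''cb'' x = col_part N M r x) \<and>
     (\<forall>e. s ''J'' e = J e) \<and> (\<forall>u<k. s ''f'' u = fd u)"

lemma env_bounded: "env s \<Longrightarrow> bounded b s" by (simp add: env_def)

lemma env_scalar:
  assumes "env s"
  shows "s ''n'' 0 = n" "s ''p'' 0 = p" "s ''k'' 0 = k" "s ''r'' 0 = r" "s ''nn'' 0 = N ^ r" "s ''mm'' 0 = M ^ r"
    "s ''rr'' 0 = R ^ r" "s ''gg'' 0 = G ^ r" "s ''q'' 0 = q"
  using assms by (simp_all add: env_def)

lemma env_frame:
  assumes "env s" "bounded b s'"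
    and "\<And>z. z \<notin> {''i'', ''j'', ''m'', ''t'', ''Y'', ''Z'', ''X'', ''U'', ''W'', ''V'', ''E'', ''bad''} \<Longrightarrow> s' z = s z"
  shows "env s'"
  using assms(1,2) by (simp add: env_def assms(3))

text \<open>Time in multiples of \<open>(r + 1) * (L + 1) * b\<close>: the factors stand for the
  rounds of a transformation, the array length and the word length, so that for a sequence only the
  program-dependent constants \<open>m\<close> have to be added.\<close>

definition costs :: "com \<Rightarrow> nat \<Rightarrow> state \<Rightarrow> state \<Rightarrow> bool" where
  "costs c m s s' \<longleftrightarrow> runs c s ((r + 1) * (L + 1) * (m * b)) s'"

lemma costs_Seq: "costs c1 m1 s s1 \<Longrightarrow> costs c2 m2 s1 s2 \<Longrightarrow> costs (Seq c1 c2) (m1 + m2) s s2"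
  unfolding costs_def using runs_Seq by (fastforce simp: algebra_simps)

lemma costs_Assign:
  assumes "bounded b s"
  shows "costs (Assign x a e) (assign_cost a e) s (s(x := (s x)(aval a s := aval e s)))"
  unfolding costs_def
  by (rule runs_mono [OF runs_Assign [OF assms pos(8)]]) simp

lemma costs_fill:
  assumes s: "bounded b s" and x: "x \<noteq> ''i''" and le: "l \<le> L"
    and len: "\<And>t. t \<le> l \<Longrightarrow> aval n' (fill_state s x h t) = l"
    and e: "\<And>t. t < l \<Longrightarrow> aval e (fill_state s x h t) = h t"
    and hb: "\<And>t. t < l \<Longrightarrow> h t < 2 ^ b"
  shows "\<exists>s'. costs (fill x n' e) (fill_cost n' e) s s' \<and> bounded b s' \<and>
    (\<forall>z. z \<notin> {x, ''i''} \<longrightarrow> s' z = s z) \<and> (\<forall>y<l. s' x y = h y)"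
proof -
  have "l < 2 ^ b" using le L_less by simp
  from runs_fill [OF s pos(8) x len this e hb]
  have r: "runs (fill x n' e) s ((l + 1) * (fill_cost n' e * b)) (fill_state s x h l)"
    and bd: "bounded b (fill_state s x h l)" by auto
  have "(l + 1) * (fill_cost n' e * b) \<le> (r + 1) * (L + 1) * (fill_cost n' e * b)"
    using le by (intro mult_right_mono) (auto intro: trans_le_add2)
  then have "costs (fill x n' e) (fill_cost n' e) s (fill_state s x h l)"
    unfolding costs_def using r by (rule runs_mono [rotated])
  then show ?thesis using bd x by (intro exI [of _ "fill_state s x h l"]) (auto simp: fill_state_apply)
qed

lemma costs_yates:
  assumes s: "env s" and x: "x \<in> {''Y'', ''Z'', ''X'', ''U'', ''V''}"
    and D: "D > 0" and E: "E > 0" and n': "aval n' s = Z * D ^ r"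
    and le: "\<And>t. t \<le> r \<Longrightarrow> Z * D ^ (r - t) * E ^ t \<le> L"
    and lt: "\<And>y. y < Z * D ^ r \<Longrightarrow> s x y < p"
  shows "\<exists>s'. costs (yates x f D E n') (3 * yates_cost x f D E n') s s' \<and> env s' \<and>
    (\<forall>z. z \<notin> {x, ''i'', ''j'', ''m'', ''t''} \<longrightarrow> s' z = s z) \<and> (\<forall>y<Z * E ^ r. s' x y < p) \<and>
    (\<forall>y<Z. \<forall>\<rho><E ^ r. [int (s' x (y * E ^ r + \<rho>)) = (\<Sum>d<D ^ r. tpow f D E r \<rho> d * int (s x (d * Z + y)))] (mod int p))"
proof -
  have x': "x \<notin> {''i'', ''j'', ''m'', ''t'', ''p'', ''r''}" using x by auto
  have p1: "p \<ge> 1" using pos(5) by simp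
  from runs_yates [OF env_bounded [OF s] pos(8) x' D E n' env_scalar(2) [OF s] p1 env_scalar(4) [OF s] le L_less lt, of f]
  obtain s' where s': "runs (yates x f D E n') s (3 * (r + 1) * (L + 1) * (yates_cost x f D E n' * b)) s'" "bounded b s'"
    "\<And>z. z \<notin> {x, ''i'', ''j'', ''m'', ''t''} \<Longrightarrow> s' z = s z" "\<forall>y<Z * E ^ r. s' x y < p"
    "\<forall>y<Z. \<forall>\<rho><E ^ r. [int (s' x (y * E ^ r + \<rho>)) = (\<Sum>d<D ^ r. tpow f D E r \<rho> d * int (s x (d * Z + y)))] (mod int p)"
    by blast
  have "env s'" using x by (intro env_frame [OF s s'(2)] s'(3)) auto
  moreover have "costs (yates x f D E n') (3 * yates_cost x f D E n') s s'"
    unfolding costs_def using s'(1) by (rule runs_mono) (simp add: algebra_simps)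
  ultimately show ?thesis using s' by blast
qed

section \<open>The stages of the test\<close>

lemma less_p_bound:
  assumes "env s" "v < p"
  shows "v < 2 ^ b"
proof -
  have "p < 2 ^ b" using env_bounded [OF assms(1)] env_scalar(2) [OF assms(1)] unfolding bounded_def by metis
  with assms(2) show ?thesis by simp
qed

text \<open>The column index leads the layout because the transformation consumes leading digits;
  the pairs of a digit \<open>v\<close> and a row \<open>i\<close> are the \<open>k * N ^ r\<close>
  vectors carried along. The source matrix is multiplied by all \<open>G ^ r\<close> hash columns,
  and later stages read only the selected ones.\<close>

lemma load_hash:
  assumes s: "env s" and x: "x \<in> {''Y'', ''Z''}" and src: "src \<notin> {''i'', x}"
    and Q0: "\<forall>i<N ^ r. \<forall>j<N ^ r. \<forall>v<k. entry n k tr (s src) i j v = Q0 i j v \<and> Q0 i j v < p"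
  shows "\<exists>s'. costs (Seq (fill x lenY (expY tr src)) (yates x g N G lenY))
      (fill_cost lenY (expY tr src) + 3 * yates_cost x g N G lenY) s s' \<and> env s' \<and>
    (\<forall>z. z \<notin> {x, ''i'', ''j'', ''m'', ''t''} \<longrightarrow> s' z = s z) \<and>
    (\<forall>v<k. \<forall>i<N ^ r. \<forall>\<rho><G ^ r. s' x ((v * N ^ r + i) * G ^ r + \<rho>) < p \<and>
       [int (s' x ((v * N ^ r + i) * G ^ r + \<rho>)) = (\<Sum>j<N ^ r. tpow g N G r \<rho> j * int (Q0 i j v))] (mod int p))"
proof -
  note Q0 = Q0 [rule_format]
  define h where "h y = Q0 (y mod N ^ r) (y div N ^ r div k) (y div N ^ r mod k)" for y
  have nn: "N ^ r > 0" using pos by simp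
  have dec: "y mod N ^ r < N ^ r \<and> y div N ^ r div k < N ^ r \<and> y div N ^ r mod k < k"
    if "y < N ^ r * (k * N ^ r)" for y
  proof -
    have "y div N ^ r < N ^ r * k" using that by (intro less_mult_imp_div_less) (simp add: mult_ac)
    then have "y div N ^ r div k < N ^ r" by (rule less_mult_imp_div_less)
    then show ?thesis using nn pos by simp
  qed
  have hp: "h y < p" if "y < N ^ r * (k * N ^ r)" for y
    using Q0 dec [OF that] unfolding h_def by blast
  have le: "N ^ r * (k * N ^ r) \<le> L" using L_Y [of 0] by (simp add: mult_ac)
  have "\<exists>s1. costs (fill x lenY (expY tr src)) (fill_cost lenY (expY tr src)) s s1 \<and> bounded b s1 \<and>
    (\<forall>z. z \<notin> {x, ''i''} \<longrightarrow> s1 z = s z) \<and> (\<forall>y<N ^ r * (k * N ^ r). s1 x y = h y)"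
  proof (rule costs_fill [OF env_bounded [OF s] _ le])
    fix t assume "t < N ^ r * (k * N ^ r)"
    from dec [OF this] show "aval (expY tr src) (fill_state s x h t) = h t"
      using x src Q0 by (auto simp: expY_def aval_ld fill_state_apply env_scalar [OF s] h_def)
  next
    fix t assume "t < N ^ r * (k * N ^ r)"
    then show "h t < 2 ^ b" using less_p_bound [OF s] hp by blast
  qed (use x in \<open>auto simp: lenY_def fill_state_apply env_scalar [OF s]\<close>)
  then obtain s1 where s1: "costs (fill x lenY (expY tr src)) (fill_cost lenY (expY tr src)) s s1" "bounded b s1"
    "\<And>z. z \<notin> {x, ''i''} \<Longrightarrow> s1 z = s z" "\<And>y. y < N ^ r * (k * N ^ r) \<Longrightarrow> s1 x y = h y" by blast
  have e1: "env s1" using x by (intro env_frame [OF s s1(2)] s1(3)) auto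
  have "\<exists>s'. costs (yates x g N G lenY) (3 * yates_cost x g N G lenY) s1 s' \<and> env s' \<and>
    (\<forall>z. z \<notin> {x, ''i'', ''j'', ''m'', ''t''} \<longrightarrow> s' z = s1 z) \<and> (\<forall>y<(k * N ^ r) * G ^ r. s' x y < p) \<and>
    (\<forall>y<k * N ^ r. \<forall>\<rho><G ^ r. [int (s' x (y * G ^ r + \<rho>)) = (\<Sum>d<N ^ r. tpow g N G r \<rho> d * int (s1 x (d * (k * N ^ r) + y)))] (mod int p))"
    using x pos L_Y hp s1(4)
    by (intro costs_yates [OF e1]) (auto simp: lenY_def env_scalar [OF e1] mult_ac)
  then obtain s' where s': "costs (yates x g N G lenY) (3 * yates_cost x g N G lenY) s1 s'" "env s'"
    "\<And>z. z \<notin> {x, ''i'', ''j'', ''m'', ''t''} \<Longrightarrow> s' z = s1 z" "\<And>y. y < (k * N ^ r) * G ^ r \<Longrightarrow> s' x y < p"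
    "\<And>y \<rho>. y < k * N ^ r \<Longrightarrow> \<rho> < G ^ r \<Longrightarrow>
      [int (s' x (y * G ^ r + \<rho>)) = (\<Sum>d<N ^ r. tpow g N G r \<rho> d * int (s1 x (d * (k * N ^ r) + y)))] (mod int p)"
    by blast
  have res: "s' x ((v * N ^ r + i) * G ^ r + \<rho>) < p \<and>
       [int (s' x ((v * N ^ r + i) * G ^ r + \<rho>)) = (\<Sum>j<N ^ r. tpow g N G r \<rho> j * int (Q0 i j v))] (mod int p)"
    if "v < k" "i < N ^ r" "\<rho> < G ^ r" for v i \<rho>
  proof -
    have y: "v * N ^ r + i < k * N ^ r" using that by (intro mult_add_less)
    have "s1 x (d * (k * N ^ r) + (v * N ^ r + i)) = Q0 i d v" if d: "d < N ^ r" for d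
    proof -
      have lt: "d * (k * N ^ r) + (v * N ^ r + i) < N ^ r * (k * N ^ r)" by (rule mult_add_less [OF d y])
      have eq: "d * (k * N ^ r) + (v * N ^ r + i) = (d * k + v) * N ^ r + i" by (simp add: algebra_simps)
      show ?thesis unfolding s1(4) [OF lt] unfolding eq using \<open>v < k\<close> \<open>i < N ^ r\<close>
        by (simp add: h_def div_mod_mult_add)
    qed
    then have "(\<Sum>d<N ^ r. tpow g N G r \<rho> d * int (s1 x (d * (k * N ^ r) + (v * N ^ r + i)))) =
        (\<Sum>j<N ^ r. tpow g N G r \<rho> j * int (Q0 i j v))" by (intro sum.cong) auto
    with s'(5) [OF y that(3)] s'(4) [OF mult_add_less [OF y that(3)]] show ?thesis by simp
  qed
  show ?thesis
    using costs_Seq [OF s1(1) s'(1)] s'(2,3) s1(3) res by (intro exI [of _ s']) auto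
qed

lemma shift_less:
  assumes "u < k" "\<And>u. u < k \<Longrightarrow> a u < p"
  shows "shift p k f a v u < p"
  using assms pos(5) by (cases v) auto

text \<open>The left factor is encoded \<open>k * k\<close> times, for each digit \<open>u\<close>
  of its multiple by each \<theta>^v, because products are expanded in the powers of \<theta> of the
  right factor.\<close>

lemma load_X:
  assumes s: "env s" and src: "src \<notin> {''i'', ''X''}"
    and P0: "\<forall>i<N ^ r. \<forall>j<N ^ r. \<forall>u<k. entry n k tr (s src) i j u = P0 i j u \<and> P0 i j u < p"
  shows "\<exists>s'. costs (Seq (fill ''X'' lenX (expX tr src)) (yates ''X'' \<alpha> (N * N) R lenX))
      (fill_cost lenX (expX tr src) + 3 * yates_cost ''X'' \<alpha> (N * N) R lenX) s s' \<and> env s' \<and>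
    (\<forall>z. z \<notin> {''X'', ''i'', ''j'', ''m'', ''t''} \<longrightarrow> s' z = s z) \<and>
    (\<forall>v<k. \<forall>u<k. \<forall>\<rho><R ^ r. [int (s' ''X'' ((v * k + u) * R ^ r + \<rho>)) =
       (\<Sum>a<(N * N) ^ r. tpow \<alpha> (N * N) R r \<rho> a * int (shift p k fd (P0 (row_part N N r a) (col_part N N r a)) v u))] (mod int p))"
proof -
  note P0 = P0 [rule_format]
  define h where "h y = (let x = y div k div k in
    shift p k fd (P0 (row_part N N r x) (col_part N N r x)) (y div k mod k) (y mod k))" for y
  let ?len = "(N * N) ^ r * (k * k)"
  have h_dec: "h ((x * k + v) * k + u) = shift p k fd (P0 (row_part N N r x) (col_part N N r x)) v u"
    if "v < k" "u < k" for x v u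
    using that by (simp add: h_def div_mod_mult_add)
  have dec: "\<exists>x v u. y = (x * k + v) * k + u \<and> v < k \<and> u < k \<and> x < (N * N) ^ r" if "y < ?len" for y
  proof -
    have "y div k < (N * N) ^ r * k" using that by (intro less_mult_imp_div_less) (simp add: mult_ac)
    then have "y div k div k < (N * N) ^ r" by (rule less_mult_imp_div_less)
    moreover have "y = (y div k div k * k + y div k mod k) * k + y mod k" by simp
    ultimately show ?thesis using pos(6) by (metis mod_less_divisor)
  qed
  have P0': "P0 (row_part N N r x) (col_part N N r x) u < p \<and>
      entry n k tr (s src) (row_part N N r x) (col_part N N r x) u = P0 (row_part N N r x) (col_part N N r x) u"
    if "x < (N * N) ^ r" "u < k" for x u
    using P0 [OF row_part_less [OF that(1)] col_part_less [OF that(1)] that(2)] by simp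
  have hp: "h y < p" if "y < ?len" for y
  proof -
    obtain x v u where y: "y = (x * k + v) * k + u" "v < k" "u < k" "x < (N * N) ^ r" using dec [OF \<open>y < ?len\<close>] by blast
    then show ?thesis unfolding y(1) h_dec [OF y(2,3)] using P0' by (intro shift_less) auto
  qed
  have le: "?len \<le> L" using L_X [of 0] by (simp add: mult_ac)
  have tabs: "s ''ra'' x = row_part N N r x" "s ''ca'' x = col_part N N r x" if "x < (N * N) ^ r" for x
    using s that by (auto simp: env_def)
  have fdig: "s ''f'' u = fd u" if "u < k" for u using s that by (simp add: env_def)
  have "\<exists>s1. costs (fill ''X'' lenX (expX tr src)) (fill_cost lenX (expX tr src)) s s1 \<and> bounded b s1 \<and>
    (\<forall>z. z \<notin> {''X'', ''i''} \<longrightarrow> s1 z = s z) \<and> (\<forall>y<?len. s1 ''X'' y = h y)"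
  proof (rule costs_fill [OF env_bounded [OF s] _ le])
    fix t assume t: "t < ?len"
    then obtain x v u where y: "t = (x * k + v) * k + u" "v < k" "u < k" "x < (N * N) ^ r" using dec by blast
    have dm: "t mod k = u" "t div k = x * k + v" "(x * k + v) mod k = v" "(x * k + v) div k = x"
      using y by (simp_all add: div_mod_mult_add)
    show "aval (expX tr src) (fill_state s ''X'' h t) = h t"
    proof (cases "v = 0")
      case True
      then show ?thesis using src y P0' [OF y(4,3)] h_dec [OF y(2,3), of x] dm
        by (simp add: expX_def Let_def aval_ld fill_state_apply(1,3) env_scalar [OF s] tabs)
    next
      case False
      let ?a = "P0 (row_part N N r x) (col_part N N r x)"
      obtain v' where v': "v = Suc v'" using False by (cases v) auto
      have i1: "(x * k + v) * k - 1 = (x * k + v') * k + (k - 1)" using v' pos(6) by (simp add: algebra_simps)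
      have "(x * k + v') * k + (k - 1) < t" using y(1) v' pos(6) by (simp add: algebra_simps)
      then have X1: "fill_state s ''X'' h t ''X'' ((x * k + v) * k - 1) = shift p k fd ?a v' (k - 1)"
        unfolding i1 using h_dec [of v' "k - 1" x] y(2) v' pos(6) by (simp add: fill_state_apply)
      have X2: "fill_state s ''X'' h t ''X'' (t - (k + 1)) = shift p k fd ?a v' (u - 1)" if "u \<noteq> 0"
      proof -
        have i2: "t - (k + 1) = (x * k + v') * k + (u - 1)" "t - (k + 1) < t"
          using y(1) v' that pos(6) by (auto simp: algebra_simps)
        then show ?thesis using h_dec [of v' "u - 1" x] y(2,3) v' by (simp add: fill_state_apply)
      qed
      have "h t = ((if u = 0 then 0 else shift p k fd ?a v' (u - 1)) + shift p k fd ?a v' (k - 1) * fd u) mod p"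
        using h_dec [OF y(2,3), of x] by (simp only: y(1)) (simp only: v' shift.simps)
      then show ?thesis using src y(2,3) False X1 X2
        by (cases "u = 0") (simp_all add: expX_def Let_def aval_ld fill_state_apply(1,3) env_scalar [OF s] dm fdig)
    qed
  next
    fix t assume "t < ?len"
    then show "h t < 2 ^ b" using less_p_bound [OF s] hp by blast
  qed (auto simp: lenX_def fill_state_apply env_scalar [OF s] power_mult_distrib)
  then obtain s1 where s1: "costs (fill ''X'' lenX (expX tr src)) (fill_cost lenX (expX tr src)) s s1" "bounded b s1"
    "\<And>z. z \<notin> {''X'', ''i''} \<Longrightarrow> s1 z = s z" "\<And>y. y < ?len \<Longrightarrow> s1 ''X'' y = h y" by blast
  have e1: "env s1" by (intro env_frame [OF s s1(2)] s1(3)) auto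
  have "\<exists>s'. costs (yates ''X'' \<alpha> (N * N) R lenX) (3 * yates_cost ''X'' \<alpha> (N * N) R lenX) s1 s' \<and> env s' \<and>
    (\<forall>z. z \<notin> {''X'', ''i'', ''j'', ''m'', ''t''} \<longrightarrow> s' z = s1 z) \<and> (\<forall>y<(k * k) * R ^ r. s' ''X'' y < p) \<and>
    (\<forall>y<k * k. \<forall>\<rho><R ^ r. [int (s' ''X'' (y * R ^ r + \<rho>)) =
       (\<Sum>d<(N * N) ^ r. tpow \<alpha> (N * N) R r \<rho> d * int (s1 ''X'' (d * (k * k) + y)))] (mod int p))"
  proof (rule costs_yates [OF e1])
    show "N * N > 0" "R > 0" using pos by simp_all
    show "aval lenX s1 = (k * k) * (N * N) ^ r" by (simp add: lenX_def env_scalar [OF e1] power_mult_distrib)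
    show "s1 ''X'' y < p" if "y < (k * k) * (N * N) ^ r" for y
    proof -
      have lt: "y < ?len" using that by (simp only: mult.commute)
      show ?thesis unfolding s1(4) [OF lt] by (rule hp [OF lt])
    qed
    show "(k * k) * (N * N) ^ (r - t) * R ^ t \<le> L" if "t \<le> r" for t using that by (rule L_X)
  qed simp
  then obtain s' where "costs (yates ''X'' \<alpha> (N * N) R lenX) (3 * yates_cost ''X'' \<alpha> (N * N) R lenX) s1 s'" "env s'"
    "\<forall>z. z \<notin> {''X'', ''i'', ''j'', ''m'', ''t''} \<longrightarrow> s' z = s1 z"
    "\<forall>y<k * k. \<forall>\<rho><R ^ r. [int (s' ''X'' (y * R ^ r + \<rho>)) =
       (\<Sum>d<(N * N) ^ r. tpow \<alpha> (N * N) R r \<rho> d * int (s1 ''X'' (d * (k * k) + y)))] (mod int p)"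
    by (elim exE conjE) (rule that)
  note s' = this [rule_format]
  have res: "[int (s' ''X'' ((v * k + u) * R ^ r + \<rho>)) =
       (\<Sum>a<(N * N) ^ r. tpow \<alpha> (N * N) R r \<rho> a * int (shift p k fd (P0 (row_part N N r a) (col_part N N r a)) v u))] (mod int p)"
    if "v < k" "u < k" "\<rho> < R ^ r" for v u \<rho>
  proof -
    have y: "v * k + u < k * k" using that by (intro mult_add_less)
    have "s1 ''X'' (d * (k * k) + (v * k + u)) = shift p k fd (P0 (row_part N N r d) (col_part N N r d)) v u"
      if d: "d < (N * N) ^ r" for d
    proof -
      have lt: "d * (k * k) + (v * k + u) < ?len" by (rule mult_add_less [OF d y])
      have eq: "d * (k * k) + (v * k + u) = (d * k + v) * k + u" by (simp add: algebra_simps)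
      show ?thesis unfolding s1(4) [OF lt] unfolding eq by (rule h_dec [OF \<open>v < k\<close> \<open>u < k\<close>])
    qed
    then have "(\<Sum>d<(N * N) ^ r. tpow \<alpha> (N * N) R r \<rho> d * int (s1 ''X'' (d * (k * k) + (v * k + u)))) =
        (\<Sum>a<(N * N) ^ r. tpow \<alpha> (N * N) R r \<rho> a * int (shift p k fd (P0 (row_part N N r a) (col_part N N r a)) v u))"
      by (intro sum.cong) auto
    with s'(4) [OF y that(3)] show ?thesis by simp
  qed
  show ?thesis
  proof (intro exI conjI allI impI)
    show "costs (Seq (fill ''X'' lenX (expX tr src)) (yates ''X'' \<alpha> (N * N) R lenX))
        (fill_cost lenX (expX tr src) + 3 * yates_cost ''X'' \<alpha> (N * N) R lenX) s s'"
      by (rule costs_Seq [OF s1(1) s'(1)])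
    show "env s'" by (rule s'(2))
    show "s' z = s z" if "z \<notin> {''X'', ''i'', ''j'', ''m'', ''t''}" for z
      using s'(3) [OF that] s1(3) [of z] that by simp
  qed (rule res)
qed

text \<open>All \<open>q\<close> blocks of \<open>M ^ r\<close> columns meet the same left factor,
  whose encoding is shared. The last block may run past the selected columns; any column number
  below \<open>G ^ r\<close> is harmless there.\<close>

lemma load_U:
  assumes s: "env s"
    and Y: "\<forall>v<k. \<forall>i<N ^ r. \<forall>\<rho><G ^ r. s ''Y'' ((v * N ^ r + i) * G ^ r + \<rho>) < p"
  shows "\<exists>s'. costs (Seq (fill ''U'' lenU expU) (yates ''U'' \<beta> (N * M) R lenU))
      (fill_cost lenU expU + 3 * yates_cost ''U'' \<beta> (N * M) R lenU) s s' \<and> env s' \<and>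
    (\<forall>z. z \<notin> {''U'', ''i'', ''j'', ''m'', ''t''} \<longrightarrow> s' z = s z) \<and>
    (\<forall>c<q. \<forall>v<k. \<forall>\<rho><R ^ r. [int (s' ''U'' ((c * k + v) * R ^ r + \<rho>)) =
       (\<Sum>x<(N * M) ^ r. tpow \<beta> (N * M) R r \<rho> x * int (s ''Y'' ((v * N ^ r + row_part N M r x) * G ^ r + J (c * M ^ r + col_part N M r x))))] (mod int p))"
proof -
  note Y = Y [rule_format]
  define w where "w x c v = s ''Y'' ((v * N ^ r + row_part N M r x) * G ^ r + J (c * M ^ r + col_part N M r x))" for x c v
  define h where "h y = w (y div k div q) (y div k mod q) (y mod k)" for y
  let ?len = "(N * M) ^ r * (q * k)"
  have h_dec: "h ((x * q + c) * k + v) = w x c v" if "v < k" "c < q" for x c v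
    using that by (simp add: h_def div_mod_mult_add)
  have dec: "\<exists>x c v. y = (x * q + c) * k + v \<and> v < k \<and> c < q \<and> x < (N * M) ^ r" if "y < ?len" for y
  proof -
    have "y div k < (N * M) ^ r * q" using that by (intro less_mult_imp_div_less) (simp add: mult_ac)
    then have "y div k div q < (N * M) ^ r" by (rule less_mult_imp_div_less)
    moreover have "y = (y div k div q * q + y div k mod q) * k + y mod k" by simp
    ultimately show ?thesis using pos(6,7) by (metis mod_less_divisor)
  qed
  have hp: "h y < p" if "y < ?len" for y
  proof -
    obtain x c v where y: "y = (x * q + c) * k + v" "v < k" "c < q" "x < (N * M) ^ r" using dec [OF \<open>y < ?len\<close>] by blast
    show ?thesis unfolding y(1) h_dec [OF y(2,3)] w_def
      by (rule Y [OF y(2) row_part_less [OF y(4)] J])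
  qed
  have le: "?len \<le> L" using L_U [of 0] by (simp add: mult_ac)
  have tabs: "s ''rb'' x = row_part N M r x" "s ''cb'' x = col_part N M r x" if "x < (N * M) ^ r" for x
    using s that by (auto simp: env_def)
  have Jv: "s ''J'' e = J e" for e using s by (simp add: env_def)
  have "\<exists>s1. costs (fill ''U'' lenU expU) (fill_cost lenU expU) s s1 \<and> bounded b s1 \<and>
    (\<forall>z. z \<notin> {''U'', ''i''} \<longrightarrow> s1 z = s z) \<and> (\<forall>y<?len. s1 ''U'' y = h y)"
  proof (rule costs_fill [OF env_bounded [OF s] _ le])
    fix t assume t: "t < ?len"
    then obtain x c v where y: "t = (x * q + c) * k + v" "v < k" "c < q" "x < (N * M) ^ r" using dec by blast
    have dm: "t mod k = v" "t div k = x * q + c" "(x * q + c) mod q = c" "(x * q + c) div q = x"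
      using y by (simp_all add: div_mod_mult_add)
    show "aval expU (fill_state s ''U'' h t) = h t"
      using y by (simp add: expU_def Let_def fill_state_apply env_scalar [OF s] tabs Jv dm h_def w_def)
  next
    fix t assume "t < ?len"
    then show "h t < 2 ^ b" using less_p_bound [OF s] hp by blast
  qed (auto simp: lenU_def fill_state_apply env_scalar [OF s] power_mult_distrib)
  then obtain s1 where s1: "costs (fill ''U'' lenU expU) (fill_cost lenU expU) s s1" "bounded b s1"
    "\<And>z. z \<notin> {''U'', ''i''} \<Longrightarrow> s1 z = s z" "\<And>y. y < ?len \<Longrightarrow> s1 ''U'' y = h y" by blast
  have e1: "env s1" by (intro env_frame [OF s s1(2)] s1(3)) auto
  have "\<exists>s'. costs (yates ''U'' \<beta> (N * M) R lenU) (3 * yates_cost ''U'' \<beta> (N * M) R lenU) s1 s' \<and> env s' \<and>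
    (\<forall>z. z \<notin> {''U'', ''i'', ''j'', ''m'', ''t''} \<longrightarrow> s' z = s1 z) \<and> (\<forall>y<(q * k) * R ^ r. s' ''U'' y < p) \<and>
    (\<forall>y<q * k. \<forall>\<rho><R ^ r. [int (s' ''U'' (y * R ^ r + \<rho>)) =
       (\<Sum>d<(N * M) ^ r. tpow \<beta> (N * M) R r \<rho> d * int (s1 ''U'' (d * (q * k) + y)))] (mod int p))"
  proof (rule costs_yates [OF e1])
    show "N * M > 0" "R > 0" using pos by simp_all
    show "aval lenU s1 = (q * k) * (N * M) ^ r" by (simp add: lenU_def env_scalar [OF e1] power_mult_distrib)
    show "s1 ''U'' y < p" if "y < (q * k) * (N * M) ^ r" for y
    proof -
      have lt: "y < ?len" using that by (simp only: mult.commute)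
      show ?thesis unfolding s1(4) [OF lt] by (rule hp [OF lt])
    qed
    show "(q * k) * (N * M) ^ (r - t) * R ^ t \<le> L" if "t \<le> r" for t using that by (rule L_U)
  qed simp
  then obtain s' where "costs (yates ''U'' \<beta> (N * M) R lenU) (3 * yates_cost ''U'' \<beta> (N * M) R lenU) s1 s'" "env s'"
    "\<forall>z. z \<notin> {''U'', ''i'', ''j'', ''m'', ''t''} \<longrightarrow> s' z = s1 z"
    "\<forall>y<q * k. \<forall>\<rho><R ^ r. [int (s' ''U'' (y * R ^ r + \<rho>)) =
       (\<Sum>d<(N * M) ^ r. tpow \<beta> (N * M) R r \<rho> d * int (s1 ''U'' (d * (q * k) + y)))] (mod int p)"
    by (elim exE conjE) (rule that)
  note s' = this [rule_format]
  have res: "[int (s' ''U'' ((c * k + v) * R ^ r + \<rho>)) = (\<Sum>x<(N * M) ^ r. tpow \<beta> (N * M) R r \<rho> x * int (w x c v))] (mod int p)"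
    if "c < q" "v < k" "\<rho> < R ^ r" for c v \<rho>
  proof -
    have y: "c * k + v < q * k" using that by (intro mult_add_less)
    have "s1 ''U'' (d * (q * k) + (c * k + v)) = w d c v" if d: "d < (N * M) ^ r" for d
    proof -
      have lt: "d * (q * k) + (c * k + v) < ?len" by (rule mult_add_less [OF d y])
      have eq: "d * (q * k) + (c * k + v) = (d * q + c) * k + v" by (simp add: algebra_simps)
      show ?thesis unfolding s1(4) [OF lt] unfolding eq by (rule h_dec [OF \<open>v < k\<close> \<open>c < q\<close>])
    qed
    then have "(\<Sum>d<(N * M) ^ r. tpow \<beta> (N * M) R r \<rho> d * int (s1 ''U'' (d * (q * k) + (c * k + v)))) =
        (\<Sum>x<(N * M) ^ r. tpow \<beta> (N * M) R r \<rho> x * int (w x c v))"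
      by (intro sum.cong) auto
    with s'(4) [OF y that(3)] show ?thesis by simp
  qed
  show ?thesis
    unfolding w_def [symmetric]
  proof (intro exI conjI allI impI)
    show "costs (Seq (fill ''U'' lenU expU) (yates ''U'' \<beta> (N * M) R lenU))
        (fill_cost lenU expU + 3 * yates_cost ''U'' \<beta> (N * M) R lenU) s s'"
      by (rule costs_Seq [OF s1(1) s'(1)])
    show "env s'" by (rule s'(2))
    show "s' z = s z" if "z \<notin> {''U'', ''i'', ''j'', ''m'', ''t''}" for z
      using s'(3) [OF that] s1(3) [of z] that by simp
  qed (rule res)
qed

end

abbreviation expBad :: aexp where
  "expBad \<equiv> IsPos (Plus (C0 ''bad'') (Cell ''E'' (Minus lenE (Lit 1))))"

context machine
begin

lemma compute_V:
  assumes s: "env s"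
  shows "\<exists>s'. costs (Seq (fill ''W'' lenW expW) (Seq (fill ''V'' lenV expV) (yates ''V'' (\<lambda>x \<rho>. \<gamma> \<rho> x) R (N * M) lenV)))
      (fill_cost lenW expW + (fill_cost lenV expV + 3 * yates_cost ''V'' (\<lambda>x \<rho>. \<gamma> \<rho> x) R (N * M) lenV)) s s' \<and> env s' \<and>
    (\<forall>z. z \<notin> {''W'', ''V'', ''i'', ''j'', ''m'', ''t''} \<longrightarrow> s' z = s z) \<and>
    (\<forall>c<q. \<forall>u<k. \<forall>x<(N * M) ^ r. s' ''V'' ((c * k + u) * (N * M) ^ r + x) < p \<and>
      [int (s' ''V'' ((c * k + u) * (N * M) ^ r + x)) = (\<Sum>\<rho><R ^ r. tpow (\<lambda>x \<rho>. \<gamma> \<rho> x) R (N * M) r x \<rho> *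
         (\<Sum>v<k. int (s ''X'' ((v * k + u) * R ^ r + \<rho>)) * int (s ''U'' ((c * k + v) * R ^ r + \<rho>))))] (mod int p))"
proof -
  let ?y = "yates ''V'' (\<lambda>x \<rho>. \<gamma> \<rho> x) R (N * M) lenV" and ?Y = "3 * yates_cost ''V'' (\<lambda>x \<rho>. \<gamma> \<rho> x) R (N * M) lenV"
  define w where "w \<rho> c u v = s ''X'' ((v * k + u) * R ^ r + \<rho>) * s ''U'' ((c * k + v) * R ^ r + \<rho>)" for \<rho> c u v
  define h where "h y = (\<Sum>v'<Suc (y mod k). w (y div k div k div q) (y div k div k mod q) (y div k mod k) v') mod p" for y
  define h' where "h' y = (\<Sum>v<k. w (y div k div q) (y div k mod q) (y mod k) v) mod p" for y
  let ?len' = "R ^ r * (q * k)"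
  let ?len = "?len' * k"
  have h_dec: "h (((\<rho> * q + c) * k + u) * k + v) = (\<Sum>v'<Suc v. w \<rho> c u v') mod p" if "v < k" "u < k" "c < q" for \<rho> c u v
    using that by (simp add: h_def div_mod_mult_add del: sum.lessThan_Suc)
  have h'_dec: "h' ((\<rho> * q + c) * k + u) = (\<Sum>v<k. w \<rho> c u v) mod p" if "u < k" "c < q" for \<rho> c u
    using that by (simp add: h'_def div_mod_mult_add)
  have dec': "\<exists>\<rho> c u. y = (\<rho> * q + c) * k + u \<and> u < k \<and> c < q \<and> \<rho> < R ^ r" if "y < ?len'" for y
  proof -
    have "y div k < R ^ r * q" using that by (intro less_mult_imp_div_less) (simp add: mult_ac)
    then have "y div k div q < R ^ r" by (rule less_mult_imp_div_less)
    moreover have "y = (y div k div q * q + y div k mod q) * k + y mod k" by simp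
    ultimately show ?thesis using pos(6,7) by (metis mod_less_divisor)
  qed
  have dec: "\<exists>\<rho> c u v. y = ((\<rho> * q + c) * k + u) * k + v \<and> v < k \<and> u < k \<and> c < q \<and> \<rho> < R ^ r" if "y < ?len" for y
  proof -
    have "y div k < ?len'" using that by (rule less_mult_imp_div_less)
    then obtain \<rho> c u where "y div k = (\<rho> * q + c) * k + u" "u < k" "c < q" "\<rho> < R ^ r" using dec' by blast
    moreover have "y = y div k * k + y mod k" by simp
    ultimately show ?thesis using pos(6) by (metis mod_less_divisor)
  qed
  have hp: "h y < p" "h' y < p" for y using pos(5) by (simp_all add: h_def h'_def)
  have le: "?len \<le> L" by (rule L_W)
  have le': "?len' \<le> L" using L_V [of 0] by (simp add: mult_ac)
  have "\<exists>s1. costs (fill ''W'' lenW expW) (fill_cost lenW expW) s s1 \<and> bounded b s1 \<and>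
    (\<forall>z. z \<notin> {''W'', ''i''} \<longrightarrow> s1 z = s z) \<and> (\<forall>y<?len. s1 ''W'' y = h y)"
  proof (rule costs_fill [OF env_bounded [OF s] _ le])
    fix t assume t: "t < ?len"
    then obtain \<rho> c u v where y: "t = ((\<rho> * q + c) * k + u) * k + v" "v < k" "u < k" "c < q" "\<rho> < R ^ r" using dec by blast
    have dm: "t mod k = v" "t div k = (\<rho> * q + c) * k + u" "((\<rho> * q + c) * k + u) mod k = u"
        "((\<rho> * q + c) * k + u) div k = \<rho> * q + c" "(\<rho> * q + c) mod q = c" "(\<rho> * q + c) div q = \<rho>"
      using y by (simp_all add: div_mod_mult_add)
    have "aval expW (fill_state s ''W'' h t) =
        (of_bool (v \<noteq> 0) * fill_state s ''W'' h t ''W'' (t - 1) + w \<rho> c u v) mod p"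
      unfolding expW_def Let_def
      by (simp add: fill_state_apply(1,3) env_scalar [OF s] dm(1,2)) (simp add: dm(4,5,6) y(3,4) w_def)
    also have "\<dots> = (\<Sum>v'<Suc v. w \<rho> c u v') mod p"
    proof (cases v)
      case (Suc v')
      have "t - 1 = ((\<rho> * q + c) * k + u) * k + v'" "t - 1 < t" using y(1) Suc by auto
      then have "fill_state s ''W'' h t ''W'' (t - 1) = (\<Sum>v''<v. w \<rho> c u v'') mod p"
        using h_dec [of v' u c \<rho>] y(2-4) Suc by (simp add: fill_state_apply del: sum.lessThan_Suc)
      then show ?thesis using Suc by (simp add: mod_add_left_eq)
    qed simp
    finally show "aval expW (fill_state s ''W'' h t) = h t"
      unfolding y(1) h_dec [OF y(2-4)] .
  next
    fix t assume "t < ?len"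
    show "h t < 2 ^ b" using less_p_bound [OF s] hp(1) by blast
  qed (auto simp: lenW_def fill_state_apply env_scalar [OF s])
  then obtain s1 where "costs (fill ''W'' lenW expW) (fill_cost lenW expW) s s1" "bounded b s1"
    "\<forall>z. z \<notin> {''W'', ''i''} \<longrightarrow> s1 z = s z" "\<forall>y<?len. s1 ''W'' y = h y"
    by (elim exE conjE) (rule that)
  note s1 = this [rule_format]
  have e1: "env s1" by (intro env_frame [OF s s1(2)] s1(3)) auto
  have "\<exists>s2. costs (fill ''V'' lenV expV) (fill_cost lenV expV) s1 s2 \<and> bounded b s2 \<and>
    (\<forall>z. z \<notin> {''V'', ''i''} \<longrightarrow> s2 z = s1 z) \<and> (\<forall>y<?len'. s2 ''V'' y = h' y)"
  proof (rule costs_fill [OF env_bounded [OF e1] _ le'])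
    fix t assume t: "t < ?len'"
    then obtain \<rho> c u where y: "t = (\<rho> * q + c) * k + u" "u < k" "c < q" "\<rho> < R ^ r" using dec' by blast
    have k1: "k - 1 < k" using pos(6) by simp
    have lt: "t * k + (k - 1) < ?len" by (rule mult_add_less [OF t k1])
    have "aval expV (fill_state s1 ''V'' h' t) = s1 ''W'' (t * k + (k - 1))"
      by (simp add: expV_def fill_state_apply env_scalar [OF e1])
    also have "\<dots> = h (t * k + (k - 1))" by (rule s1(4) [OF lt])
    also have "\<dots> = h' t" unfolding y(1) h_dec [OF k1 y(2,3)] h'_dec [OF y(2,3)] using pos(6) by simp
    finally show "aval expV (fill_state s1 ''V'' h' t) = h' t" .
  next
    fix t assume "t < ?len'"
    show "h' t < 2 ^ b" using less_p_bound [OF s] hp(2) by blast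
  qed (auto simp: lenV_def fill_state_apply env_scalar [OF e1])
  then obtain s2 where "costs (fill ''V'' lenV expV) (fill_cost lenV expV) s1 s2" "bounded b s2"
    "\<forall>z. z \<notin> {''V'', ''i''} \<longrightarrow> s2 z = s1 z" "\<forall>y<?len'. s2 ''V'' y = h' y"
    by (elim exE conjE) (rule that)
  note s2 = this [rule_format]
  have e2: "env s2" by (intro env_frame [OF e1 s2(2)] s2(3)) auto
  have "\<exists>s'. costs ?y ?Y s2 s' \<and> env s' \<and>
    (\<forall>z. z \<notin> {''V'', ''i'', ''j'', ''m'', ''t''} \<longrightarrow> s' z = s2 z) \<and> (\<forall>y<(q * k) * (N * M) ^ r. s' ''V'' y < p) \<and>
    (\<forall>y<q * k. \<forall>x<(N * M) ^ r. [int (s' ''V'' (y * (N * M) ^ r + x)) =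
       (\<Sum>d<R ^ r. tpow (\<lambda>x \<rho>. \<gamma> \<rho> x) R (N * M) r x d * int (s2 ''V'' (d * (q * k) + y)))] (mod int p))"
  proof (rule costs_yates [OF e2])
    show "N * M > 0" "R > 0" using pos by simp_all
    show "aval lenV s2 = (q * k) * R ^ r" by (simp add: lenV_def env_scalar [OF e2])
    show "s2 ''V'' y < p" if "y < (q * k) * R ^ r" for y
    proof -
      have lt: "y < ?len'" using that by (simp only: mult.commute)
      show ?thesis unfolding s2(4) [OF lt] by (rule hp(2))
    qed
    show "(q * k) * R ^ (r - t) * (N * M) ^ t \<le> L" if "t \<le> r" for t using that by (rule L_V)
  qed simp
  then obtain s' where "costs ?y ?Y s2 s'" "env s'"
    "\<forall>z. z \<notin> {''V'', ''i'', ''j'', ''m'', ''t''} \<longrightarrow> s' z = s2 z" "\<forall>y<(q * k) * (N * M) ^ r. s' ''V'' y < p"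
    "\<forall>y<q * k. \<forall>x<(N * M) ^ r. [int (s' ''V'' (y * (N * M) ^ r + x)) =
       (\<Sum>d<R ^ r. tpow (\<lambda>x \<rho>. \<gamma> \<rho> x) R (N * M) r x d * int (s2 ''V'' (d * (q * k) + y)))] (mod int p)"
    by (elim exE conjE) (rule that)
  note s' = this [rule_format]
  show ?thesis
  proof (intro exI conjI allI impI)
    show "costs (Seq (fill ''W'' lenW expW) (Seq (fill ''V'' lenV expV) ?y))
        (fill_cost lenW expW + (fill_cost lenV expV + ?Y)) s s'"
      by (rule costs_Seq [OF s1(1) costs_Seq [OF s2(1) s'(1)]])
    show "env s'" by (rule s'(2))
    show "s' z = s z" if "z \<notin> {''W'', ''V'', ''i'', ''j'', ''m'', ''t''}" for z
      using s'(3) [of z] s2(3) [of z] s1(3) [of z] that by simp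
    fix c u x assume cu: "c < q" "u < k" and x: "x < (N * M) ^ r"
    have y: "c * k + u < q * k" using cu by (intro mult_add_less)
    show "s' ''V'' ((c * k + u) * (N * M) ^ r + x) < p" by (rule s'(4) [OF mult_add_less [OF y x]])
    have "[int (s' ''V'' ((c * k + u) * (N * M) ^ r + x)) =
       (\<Sum>d<R ^ r. tpow (\<lambda>x \<rho>. \<gamma> \<rho> x) R (N * M) r x d * int (s2 ''V'' (d * (q * k) + (c * k + u))))] (mod int p)"
      by (rule s'(5) [OF y x])
    also have "[(\<Sum>d<R ^ r. tpow (\<lambda>x \<rho>. \<gamma> \<rho> x) R (N * M) r x d * int (s2 ''V'' (d * (q * k) + (c * k + u)))) =
       (\<Sum>\<rho><R ^ r. tpow (\<lambda>x \<rho>. \<gamma> \<rho> x) R (N * M) r x \<rho> *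
         (\<Sum>v<k. int (s ''X'' ((v * k + u) * R ^ r + \<rho>)) * int (s ''U'' ((c * k + v) * R ^ r + \<rho>))))] (mod int p)"
    proof (rule cong_sum, rule cong_mult [OF cong_refl])
      fix d assume "d \<in> {..<R ^ r}"
      then have d: "d < R ^ r" by simp
      have lt: "d * (q * k) + (c * k + u) < ?len'" by (rule mult_add_less [OF d y])
      have eq: "d * (q * k) + (c * k + u) = (d * q + c) * k + u" by (simp add: algebra_simps)
      have "s2 ''V'' (d * (q * k) + (c * k + u)) = (\<Sum>v<k. w d c u v) mod p"
        unfolding s2(4) [OF lt] unfolding eq by (rule h'_dec [OF cu(2,1)])
      then show "[int (s2 ''V'' (d * (q * k) + (c * k + u))) =
          (\<Sum>v<k. int (s ''X'' ((v * k + u) * R ^ r + d)) * int (s ''U'' ((c * k + v) * R ^ r + d)))] (mod int p)"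
        by (simp add: w_def of_nat_mod)
    qed
    finally show "[int (s' ''V'' ((c * k + u) * (N * M) ^ r + x)) = (\<Sum>\<rho><R ^ r. tpow (\<lambda>x \<rho>. \<gamma> \<rho> x) R (N * M) r x \<rho> *
         (\<Sum>v<k. int (s ''X'' ((v * k + u) * R ^ r + \<rho>)) * int (s ''U'' ((c * k + v) * R ^ r + \<rho>))))] (mod int p)" .
  qed
qed

text \<open>\<open>''bad''\<close> is only ever raised, so that both sides of the test can share
  it.\<close>

lemma compare:
  assumes s: "env s"
  shows "\<exists>s'. costs (Seq (fill ''E'' lenE expE) (Assign ''bad'' (Lit 0) expBad))
      (fill_cost lenE expE + assign_cost (Lit 0) expBad) s s' \<and> env s' \<and>
    (\<forall>z. z \<notin> {''E'', ''i'', ''bad''} \<longrightarrow> s' z = s z) \<and>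
    s' ''bad'' 0 = of_bool (s ''bad'' 0 \<noteq> 0 \<or> (\<exists>c<q. \<exists>u<k. \<exists>x<(N * M) ^ r. s ''V'' ((c * k + u) * (N * M) ^ r + x) \<noteq>
        s ''Z'' ((u * N ^ r + row_part N M r x) * G ^ r + J (c * M ^ r + col_part N M r x))))"
proof -
  let ?bb = "(N * M) ^ r"
  let ?len = "q * k * ?bb"
  define ne where "ne y \<longleftrightarrow> s ''V'' y \<noteq> s ''Z'' ((y div ?bb mod k * N ^ r + row_part N M r (y mod ?bb)) * G ^ r +
      J (y div ?bb div k * M ^ r + col_part N M r (y mod ?bb)))" for y
  define h where "h y = (of_bool (\<exists>y'\<le>y. ne y') :: nat)" for y
  have bb: "?bb > 0" using pos by simp
  have bbe: "N ^ r * M ^ r = ?bb" by (simp add: power_mult_distrib)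
  have tabs: "s ''rb'' x = row_part N M r x" "s ''cb'' x = col_part N M r x" if "x < (N * M) ^ r" for x
    using s that by (auto simp: env_def)
  have Jv: "s ''J'' e = J e" for e using s by (simp add: env_def)
  have le: "?len \<le> L" using L_V [of r] by simp
  have two: "1 < (2::nat) ^ b" using pos(8) by (intro one_less_power) auto
  have "\<exists>s1. costs (fill ''E'' lenE expE) (fill_cost lenE expE) s s1 \<and> bounded b s1 \<and>
    (\<forall>z. z \<notin> {''E'', ''i''} \<longrightarrow> s1 z = s z) \<and> (\<forall>y<?len. s1 ''E'' y = h y)"
  proof (rule costs_fill [OF env_bounded [OF s] _ le])
    fix t assume t: "t < ?len"
    have m: "t mod ?bb < ?bb" using bb by simp
    have diff: "(a - c) + (c - a) = 0 \<longleftrightarrow> a = c" for a c :: nat by auto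
    have "aval expE (fill_state s ''E'' h t) = of_bool (t \<noteq> 0 \<and> fill_state s ''E'' h t ''E'' (t - 1) \<noteq> 0 \<or> ne t)"
      unfolding expE_def Let_def
      by (simp add: fill_state_apply(1,3) env_scalar [OF s] bbe tabs [OF m] Jv ne_def diff)
    also have "\<dots> = h t"
    proof (cases t)
      case 0
      then show ?thesis by (simp add: h_def)
    next
      case (Suc t')
      then have "fill_state s ''E'' h t ''E'' (t - 1) = h t'" by (simp add: fill_state_apply)
      then show ?thesis using Suc by (auto simp: h_def le_Suc_eq)
    qed
    finally show "aval expE (fill_state s ''E'' h t) = h t" .
  next
    fix t assume "t < ?len"
    show "h t < 2 ^ b" using two by (auto simp: h_def)
  qed (auto simp: lenE_def fill_state_apply env_scalar [OF s] bbe)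
  then obtain s1 where "costs (fill ''E'' lenE expE) (fill_cost lenE expE) s s1" "bounded b s1"
    "\<forall>z. z \<notin> {''E'', ''i''} \<longrightarrow> s1 z = s z" "\<forall>y<?len. s1 ''E'' y = h y"
    by (elim exE conjE) (rule that)
  note s1 = this [rule_format]
  have e1: "env s1" by (intro env_frame [OF s s1(2)] s1(3)) auto
  have len1: "?len - 1 < ?len" using pos bb by simp
  have "aval expBad s1 = of_bool (s ''bad'' 0 \<noteq> 0 \<or> h (?len - 1) \<noteq> 0)"
    using s1(4) [OF len1] s1(3) [of "''bad''"]
    by (simp add: lenE_def env_scalar [OF e1] bbe)
  moreover have "h (?len - 1) \<noteq> 0 \<longleftrightarrow> (\<exists>c<q. \<exists>u<k. \<exists>x<?bb. s ''V'' ((c * k + u) * ?bb + x) \<noteq>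
        s ''Z'' ((u * N ^ r + row_part N M r x) * G ^ r + J (c * M ^ r + col_part N M r x)))" (is "_ \<longleftrightarrow> ?ex")
  proof
    assume "h (?len - 1) \<noteq> 0"
    then obtain y where y: "y \<le> ?len - 1" "ne y" unfolding h_def by auto
    then have lt: "y < ?len" using len1 by linarith
    have lt1: "y div ?bb < q * k" using lt by (rule less_mult_imp_div_less)
    then have c: "y div ?bb div k < q" by (rule less_mult_imp_div_less)
    have u: "y div ?bb mod k < k" using pos by simp
    have x: "y mod ?bb < ?bb" using bb by simp
    have "y = (y div ?bb div k * k + y div ?bb mod k) * ?bb + y mod ?bb" by (simp only: div_mult_mod_eq)
    with y(2) c u x show ?ex unfolding ne_def by metis
  next
    assume ?ex
    then obtain c u x where cux: "c < q" "u < k" "x < ?bb" and neq: "s ''V'' ((c * k + u) * ?bb + x) \<noteq>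
        s ''Z'' ((u * N ^ r + row_part N M r x) * G ^ r + J (c * M ^ r + col_part N M r x))" by blast
    have "(c * k + u) * ?bb + x < ?len" using cux by (intro mult_add_less)
    then have le: "(c * k + u) * ?bb + x \<le> ?len - 1" by linarith
    have "ne ((c * k + u) * ?bb + x)" using neq cux unfolding ne_def by (simp add: div_mod_mult_add)
    with le have "\<exists>y'\<le>?len - 1. ne y'" by blast
    then show "h (?len - 1) \<noteq> 0" unfolding h_def by simp
  qed
  ultimately have v: "aval expBad s1 = of_bool (s ''bad'' 0 \<noteq> 0 \<or> (\<exists>c<q. \<exists>u<k. \<exists>x<?bb. s ''V'' ((c * k + u) * ?bb + x) \<noteq>
        s ''Z'' ((u * N ^ r + row_part N M r x) * G ^ r + J (c * M ^ r + col_part N M r x))))" by simp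
  define s' where "s' = s1(''bad'' := (s1 ''bad'')(0 := aval expBad s1))"
  have c2: "costs (Assign ''bad'' (Lit 0) expBad) (assign_cost (Lit 0) expBad) s1 s'"
    using costs_Assign [OF s1(2), of "''bad''" "Lit 0" expBad] by (simp only: s'_def aval.simps)
  have "aval expBad s1 < 2 ^ b" using two unfolding v by (auto simp: of_bool_def)
  then have "bounded b s'" unfolding s'_def by (rule bounded_upd [OF s1(2)])
  then have "env s'" by (rule env_frame [OF e1]) (simp add: s'_def)
  moreover have "s' ''bad'' 0 = aval expBad s1" by (simp only: s'_def fun_upd_same)
  moreover have "s' z = s z" if "z \<notin> {''E'', ''i'', ''bad''}" for z
    using that s1(3) [of z] by (simp add: s'_def)
  ultimately show ?thesis using costs_Seq [OF s1(1) c2] unfolding v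
    by (intro exI [of _ s'] conjI allI impI) simp_all
qed

end

section \<open>Digits over a finite field\<close>

context cring
begin

text \<open>\<open>from_digits\<close> for arbitrary integer coefficients, which makes it additive:
  sums and differences of digit vectors can be formed before any reduction modulo
  \<open>p\<close>.\<close>

definition combine :: "nat \<Rightarrow> 'a \<Rightarrow> (nat \<Rightarrow> int) \<Rightarrow> 'a" where
  "combine k \<theta> c = (\<Oplus>u\<in>{..<k}. [c u] \<cdot> (\<theta> [^] u))"

lemma finsum_lessThan_Suc:
  assumes "\<And>i. i < Suc n \<Longrightarrow> f i \<in> carrier R"
  shows "(\<Oplus>i\<in>{..<Suc n}. f i) = f n \<oplus> (\<Oplus>i\<in>{..<n}. f i)"
  unfolding lessThan_Suc using assms by (subst finsum_insert) auto

lemma combine_closed: "\<theta> \<in> carrier R \<Longrightarrow> combine k \<theta> c \<in> carrier R"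
  unfolding combine_def by (rule finsum_closed) auto

lemma combine_cong: "(\<And>u. u < k \<Longrightarrow> c u = d u) \<Longrightarrow> \<theta> \<in> carrier R \<Longrightarrow> combine k \<theta> c = combine k \<theta> d"
  unfolding combine_def by (rule finsum_cong') auto

lemma combine_add:
  assumes "\<theta> \<in> carrier R"
  shows "combine k \<theta> (\<lambda>u. c u + d u) = combine k \<theta> c \<oplus> combine k \<theta> d"
proof -
  have "combine k \<theta> (\<lambda>u. c u + d u) = (\<Oplus>u\<in>{..<k}. [c u] \<cdot> (\<theta> [^] u) \<oplus> [d u] \<cdot> (\<theta> [^] u))"
    unfolding combine_def using assms by (intro finsum_cong') (auto simp: add.int_pow_mult)
  then show ?thesis unfolding combine_def using assms by (subst (asm) finsum_addf) auto
qed

lemma combine_diff: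
  assumes "\<theta> \<in> carrier R"
  shows "combine k \<theta> (\<lambda>u. c u - d u) = combine k \<theta> c \<ominus> combine k \<theta> d"
proof -
  have "combine k \<theta> (\<lambda>u. c u - d u) \<oplus> combine k \<theta> d = combine k \<theta> c"
    using combine_add [OF assms, of k "\<lambda>u. c u - d u" d] by simp
  then have "combine k \<theta> c \<ominus> combine k \<theta> d =
      (combine k \<theta> (\<lambda>u. c u - d u) \<oplus> combine k \<theta> d) \<ominus> combine k \<theta> d" by simp
  also have "\<dots> = combine k \<theta> (\<lambda>u. c u - d u)"
    using combine_closed [OF assms] by (simp add: minus_eq a_assoc r_neg)
  finally show ?thesis by simp
qed

lemma int_scale: "x \<in> carrier R \<Longrightarrow> [(m::int)] \<cdot> x = ([m] \<cdot> \<one>) \<otimes> x"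
  by (simp add: add_pow_ldistr_int)

lemma combine_scale:
  assumes "\<theta> \<in> carrier R"
  shows "combine k \<theta> (\<lambda>u. m * c u) = [m] \<cdot> combine k \<theta> c"
proof -
  have "combine k \<theta> (\<lambda>u. m * c u) = (\<Oplus>u\<in>{..<k}. ([m] \<cdot> \<one>) \<otimes> [c u] \<cdot> (\<theta> [^] u))"
    unfolding combine_def using assms
    by (intro finsum_cong') (auto simp: add.int_pow_pow mult.commute int_scale [symmetric])
  also have "\<dots> = ([m] \<cdot> \<one>) \<otimes> combine k \<theta> c"
    unfolding combine_def using assms by (intro finsum_rdistr [symmetric]) auto
  finally show ?thesis using int_scale combine_closed [OF assms] by metis
qed

lemma combine_zero:
  assumes "\<theta> \<in> carrier R"
  shows "combine k \<theta> (\<lambda>u. 0) = \<zero>"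
proof -
  have "combine k \<theta> (\<lambda>u. 0) = (\<Oplus>u\<in>{..<k}. \<zero>)"
    unfolding combine_def using assms by (intro finsum_cong') (auto simp: add_pow_int_ge)
  then show ?thesis by simp
qed

lemma combine_sum:
  assumes "\<theta> \<in> carrier R"
  shows "combine k \<theta> (\<lambda>u. \<Sum>i<m. c i u) = (\<Oplus>i\<in>{..<m::nat}. combine k \<theta> (c i))"
proof (induction m)
  case 0
  then show ?case using combine_zero [OF assms] by simp
next
  case (Suc m)
  have "combine k \<theta> (\<lambda>u. \<Sum>i<Suc m. c i u) = combine k \<theta> (\<lambda>u. c m u + (\<Sum>i<m. c i u))"
    by (simp add: add.commute)
  also have "\<dots> = combine k \<theta> (c m) \<oplus> (\<Oplus>i\<in>{..<m}. combine k \<theta> (c i))"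
    by (simp only: combine_add [OF assms] Suc.IH)
  also have "\<dots> = (\<Oplus>i\<in>{..<Suc m}. combine k \<theta> (c i))"
    using combine_closed [OF assms] by (subst finsum_lessThan_Suc) auto
  finally show ?case .
qed

lemma combine_shift:
  assumes \<theta>: "\<theta> \<in> carrier R"
  shows "\<theta> \<otimes> combine (Suc k) \<theta> c =
    combine (Suc k) \<theta> (\<lambda>u. if u = 0 then 0 else c (u - 1)) \<oplus> [c k] \<cdot> (\<theta> [^] Suc k)"
proof (induction k)
  case 0
  show ?case using \<theta> by (simp add: combine_def lessThan_Suc finsum_insert add_pow_rdistr_int add_pow_int_ge)
next
  case (Suc k)
  have 1: "combine (Suc (Suc k)) \<theta> d = [d (Suc k)] \<cdot> (\<theta> [^] Suc k) \<oplus> combine (Suc k) \<theta> d" for d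
    unfolding combine_def using \<theta> by (subst finsum_lessThan_Suc) auto
  have "\<theta> \<otimes> combine (Suc (Suc k)) \<theta> c =
      \<theta> \<otimes> ([c (Suc k)] \<cdot> (\<theta> [^] Suc k)) \<oplus> \<theta> \<otimes> combine (Suc k) \<theta> c"
    unfolding 1 using \<theta> combine_closed [OF \<theta>] by (intro r_distr) auto
  also have "\<theta> \<otimes> ([c (Suc k)] \<cdot> (\<theta> [^] Suc k)) = [c (Suc k)] \<cdot> (\<theta> [^] Suc (Suc k))"
    using \<theta> by (simp add: add_pow_rdistr_int m_comm)
  also have "\<theta> \<otimes> combine (Suc k) \<theta> c =
      combine (Suc k) \<theta> (\<lambda>u. if u = 0 then 0 else c (u - 1)) \<oplus> [c k] \<cdot> (\<theta> [^] Suc k)" by (rule Suc.IH)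
  also have "[c (Suc k)] \<cdot> (\<theta> [^] Suc (Suc k)) \<oplus>
      (combine (Suc k) \<theta> (\<lambda>u. if u = 0 then 0 else c (u - 1)) \<oplus> [c k] \<cdot> (\<theta> [^] Suc k)) =
      combine (Suc (Suc k)) \<theta> (\<lambda>u. if u = 0 then 0 else c (u - 1)) \<oplus> [c (Suc k)] \<cdot> (\<theta> [^] Suc (Suc k))"
    unfolding 1 using \<theta> combine_closed [OF \<theta>]
    by (simp add: a_ac del: nat_pow_Suc)
  finally show ?case .
qed

end

section \<open>Arithmetic in a presented finite field\<close>

locale presented_field = field F for F :: "'a ring" (structure) +
  fixes p k :: nat and \<theta> :: 'a
  assumes fin: "finite (carrier F)" and pres: "presents F p k \<theta>"
begin

lemma p_prime: "prime p" and theta: "\<theta> \<in> carrier F"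
  and bij: "bij_betw (from_digits F k \<theta>) ({..<k} \<rightarrow>\<^sub>E {..<p}) (carrier F)"
  using pres by (auto simp: presents_def)

lemma p_gt_1: "p > 1" using p_prime by (rule prime_gt_1_nat)

lemma card_carrier: "card (carrier F) = p ^ k"
  using bij_betw_same_card [OF bij] by (simp add: card_PiE)

lemma k_pos: "k > 0"
proof (rule ccontr)
  assume "\<not> k > 0"
  then have "card (carrier F) = 1" using card_carrier by simp
  then obtain x where "carrier F = {x}" by (auto simp: card_1_singleton_iff)
  then show False using zero_closed one_closed zero_not_one by auto
qed

lemma from_digits_eq: "from_digits F k \<theta> c = combine k \<theta> (\<lambda>u. int (c u))"
  unfolding from_digits_def combine_def by (simp add: add_pow_int_ge)

text \<open>The order \<open>p ^ k\<close> of the additive group annihilates 1, and a field has no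
  nonzero nilpotent elements.\<close>

lemma p_one: "[int p] \<cdot> \<one> = \<zero>"
proof -
  have pow: "[int (p ^ j)] \<cdot> \<one> = ([int p] \<cdot> \<one>) [^] j" for j
  proof (induction j)
    case 0
    then show ?case by simp
  next
    case (Suc j)
    have "[int (p ^ Suc j)] \<cdot> \<one> = [int p] \<cdot> ([int (p ^ j)] \<cdot> \<one>)"
      by (simp add: add.int_pow_pow mult.commute)
    also have "\<dots> = ([int p] \<cdot> \<one>) \<otimes> ([int (p ^ j)] \<cdot> \<one>)" by (rule int_scale) simp
    finally show ?case using Suc by (simp add: m_comm)
  qed
  have "[card (carrier F)] \<cdot> \<one> = \<zero>"
    using add.pow_order_eq_1 [of \<one>] fin by (simp add: order_def)
  then have "[int (p ^ k)] \<cdot> \<one> = \<zero>" unfolding card_carrier by (simp only: add_pow_int_ge int_ops nat_int)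
  then have "([int p] \<cdot> \<one>) [^] k = \<zero>" by (simp only: pow)
  moreover have "x = \<zero>" if "x \<in> carrier F" "x [^] j = \<zero>" for x and j :: nat
    using that(2)
  proof (induction j)
    case (Suc j)
    then show ?case using integral [of "x [^] j" x] that(1) by auto
  qed simp
  ultimately show ?thesis by simp
qed

lemma p_scale: "x \<in> carrier F \<Longrightarrow> [int p] \<cdot> x = \<zero>"
  by (subst int_scale) (simp_all add: p_one)

lemma mod_scale:
  assumes x: "x \<in> carrier F"
  shows "[(z mod int p)] \<cdot> x = [z] \<cdot> x"
proof -
  have "[(int p * (z div int p))] \<cdot> x = [(z div int p)] \<cdot> ([int p] \<cdot> x)"
    using x by (simp add: add.int_pow_pow)
  also have "\<dots> = \<zero>" using x p_scale [OF x] by simp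
  finally have "[(int p * (z div int p) + z mod int p)] \<cdot> x = [(z mod int p)] \<cdot> x"
    using x by (simp only: add.int_pow_mult) simp
  then show ?thesis by simp
qed

lemma combine_mod: "combine k \<theta> (\<lambda>u. c u mod int p) = combine k \<theta> c"
  unfolding combine_def using theta by (intro finsum_cong') (auto simp: mod_scale)

text \<open>Reduced modulo \<open>p\<close>, the coefficients form a digit string, and only the zero
  string represents zero. So the powers of \<theta> below \<open>k\<close> are independent over the
  prime field.\<close>

lemma combine_eq_zero_iff: "combine k \<theta> c = \<zero> \<longleftrightarrow> (\<forall>u<k. int p dvd c u)"
proof
  assume zero: "combine k \<theta> c = \<zero>"
  define d where "d = (\<lambda>u\<in>{..<k}. nat (c u mod int p))"
  define e where "e = (\<lambda>u\<in>{..<k}. 0::nat)"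
  have de: "d \<in> {..<k} \<rightarrow>\<^sub>E {..<p}" "e \<in> {..<k} \<rightarrow>\<^sub>E {..<p}"
    using p_gt_1 by (auto simp: d_def e_def nat_less_iff)
  have "from_digits F k \<theta> d = combine k \<theta> (\<lambda>u. c u mod int p)"
    unfolding from_digits_eq using p_gt_1 theta by (intro combine_cong) (auto simp: d_def)
  also have "\<dots> = combine k \<theta> (\<lambda>u. 0)" using combine_mod zero combine_zero [OF theta] by simp
  also have "\<dots> = from_digits F k \<theta> e"
    unfolding from_digits_eq using theta by (intro combine_cong) (auto simp: e_def)
  finally have "d = e" using bij_betw_imp_inj_on [OF bij] de by (meson inj_onD)
  show "\<forall>u<k. int p dvd c u"
  proof (intro allI impI)
    fix u assume u: "u < k"
    have "d u = e u" using \<open>d = e\<close> by simp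
    then have "nat (c u mod int p) = 0" using u by (simp add: d_def e_def)
    moreover have "c u mod int p \<ge> 0" using p_gt_1 by simp
    ultimately show "int p dvd c u" by (simp add: dvd_eq_mod_eq_0)
  qed
next
  assume "\<forall>u<k. int p dvd c u"
  then have "combine k \<theta> (\<lambda>u. c u mod int p) = combine k \<theta> (\<lambda>u. 0)"
    using theta by (intro combine_cong) auto
  then show "combine k \<theta> c = \<zero>" using combine_mod combine_zero [OF theta] by simp
qed

text \<open>The characteristic is exactly \<open>p\<close>: a multiple of 1 is a digit combination
  with a constant coefficient only. This turns identities supplied over \<open>F\<close> into
  congruences of integers.\<close>

lemma int_one_eq_iff: "[(y::int)] \<cdot> \<one> = [z] \<cdot> \<one> \<longleftrightarrow> [y = z] (mod int p)"
proof
  assume "[y = z] (mod int p)"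
  then show "[y] \<cdot> \<one> = [z] \<cdot> \<one>" using mod_scale [of \<one>] by (metis one_closed unique_euclidean_semiring_class.cong_def)
next
  assume eq: "[y] \<cdot> \<one> = [z] \<cdot> \<one>"
  have diff: "[(y - z)] \<cdot> \<one> = \<zero>"
  proof -
    have "[(y - z)] \<cdot> \<one> \<oplus> [z] \<cdot> \<one> = [((y - z) + z)] \<cdot> \<one>" by (rule add.int_pow_mult [symmetric]) simp
    also have "\<dots> = [z] \<cdot> \<one>" using eq by simp
    finally show ?thesis by (metis add.int_pow_closed one_closed add.r_cancel_one')
  qed
  define c where "c u = (if u = 0 then y - z else 0)" for u :: nat
  have "combine k \<theta> c = (\<Oplus>u\<in>{..<k}. \<zero>)"
    unfolding combine_def using theta diff
    by (intro finsum_cong') (auto simp: c_def add_pow_int_ge)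
  then have "combine k \<theta> c = \<zero>" by simp
  then have "int p dvd c 0" using combine_eq_zero_iff k_pos by blast
  then show "[y = z] (mod int p)" by (simp add: c_def cong_iff_dvd_diff)
qed

lemma digits_mem: "a \<in> carrier F \<Longrightarrow> digits F p k \<theta> a \<in> {..<k} \<rightarrow>\<^sub>E {..<p}"
  unfolding digits_def by (rule the_inv_into_into [OF bij_betw_imp_inj_on [OF bij] _ subset_refl])
    (simp add: bij_betw_imp_surj_on [OF bij])

lemma digits_less: "a \<in> carrier F \<Longrightarrow> u < k \<Longrightarrow> digits F p k \<theta> a u < p"
  using digits_mem [of a] by (auto simp: PiE_iff)

lemma combine_digits: "a \<in> carrier F \<Longrightarrow> combine k \<theta> (\<lambda>u. int (digits F p k \<theta> a u)) = a"
  unfolding digits_def from_digits_eq [symmetric] by (rule f_the_inv_into_f_bij_betw [OF bij]) simp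

text \<open>Each step of \<open>shift\<close> multiplies by \<theta>: the digits move up, the
  overflowing \<theta>^k is replaced by its digits \<open>f\<close>, and reduction modulo
  \<open>p\<close> leaves the value unchanged.\<close>

lemma combine_shift_digits:
  assumes f: "combine k \<theta> (\<lambda>u. int (f u)) = \<theta> [^] k"
  shows "combine k \<theta> (\<lambda>u. int (shift p k f a v u)) = combine k \<theta> (\<lambda>u. int (a u)) \<otimes> \<theta> [^] v"
proof (induction v)
  case 0
  show ?case using combine_closed [OF theta] by simp
next
  case (Suc v)
  obtain k' where k': "k = Suc k'" using k_pos by (cases k) auto
  let ?c = "\<lambda>u. int (shift p k f a v u)"
  have "combine k \<theta> (\<lambda>u. int (shift p k f a (Suc v) u)) =
      combine k \<theta> (\<lambda>u. ((if u = 0 then 0 else ?c (u - 1)) + ?c (k - 1) * int (f u)) mod int p)"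
    using theta by (intro combine_cong) (auto simp: of_nat_mod)
  also have "\<dots> = combine k \<theta> (\<lambda>u. (if u = 0 then 0 else ?c (u - 1)) + ?c (k - 1) * int (f u))"
    by (rule combine_mod)
  also have "\<dots> = combine k \<theta> (\<lambda>u. if u = 0 then 0 else ?c (u - 1)) \<oplus> [?c (k - 1)] \<cdot> (\<theta> [^] k)"
    by (simp only: combine_add [OF theta] combine_scale [OF theta] f)
  also have "\<dots> = \<theta> \<otimes> combine k \<theta> ?c"
    using combine_shift [OF theta, of k' ?c] by (simp only: k' diff_Suc_1)
  also have "\<dots> = \<theta> \<otimes> (combine k \<theta> (\<lambda>u. int (a u)) \<otimes> \<theta> [^] v)" by (simp only: Suc.IH)
  also have "\<dots> = combine k \<theta> (\<lambda>u. int (a u)) \<otimes> \<theta> [^] Suc v"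
    using theta combine_closed [OF theta] by (simp add: m_ac)
  finally show ?case .
qed

text \<open>Only the right factor is expanded in powers of \<theta>. The digits of
  \<open>a l\<close> times \<theta>^v then enter linearly, with the digits \<open>b l v\<close> as
  integer coefficients.\<close>

lemma combine_inner_product:
  fixes m :: nat
  assumes f: "combine k \<theta> (\<lambda>u. int (f u)) = \<theta> [^] k"
  shows "combine k \<theta> (\<lambda>u. (\<Sum>v<k. \<Sum>l<m. int (shift p k f (a l) v u) * int (b l v)) - int (c u)) =
    (\<Oplus>l\<in>{..<m}. combine k \<theta> (\<lambda>u. int (a l u)) \<otimes> combine k \<theta> (\<lambda>u. int (b l u))) \<ominus> combine k \<theta> (\<lambda>u. int (c u))"
proof -
  have "combine k \<theta> (\<lambda>u. \<Sum>v<k. \<Sum>l<m. int (shift p k f (a l) v u) * int (b l v)) =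
      combine k \<theta> (\<lambda>u. \<Sum>l<m. \<Sum>v<k. int (b l v) * int (shift p k f (a l) v u))"
    using theta by (intro combine_cong, subst sum.swap) (simp_all add: mult.commute)
  also have "\<dots> = (\<Oplus>l\<in>{..<m}. \<Oplus>v\<in>{..<k}. [int (b l v)] \<cdot> combine k \<theta> (\<lambda>u. int (shift p k f (a l) v u)))"
    by (simp only: combine_sum [OF theta] combine_scale [OF theta])
  also have "\<dots> = (\<Oplus>l\<in>{..<m}. combine k \<theta> (\<lambda>u. int (a l u)) \<otimes> combine k \<theta> (\<lambda>u. int (b l u)))"
  proof (rule finsum_cong')
    fix l
    have "(\<Oplus>v\<in>{..<k}. [int (b l v)] \<cdot> combine k \<theta> (\<lambda>u. int (shift p k f (a l) v u))) =
        (\<Oplus>v\<in>{..<k}. combine k \<theta> (\<lambda>u. int (a l u)) \<otimes> ([int (b l v)] \<cdot> (\<theta> [^] v)))"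
      using theta combine_closed [OF theta]
      by (intro finsum_cong') (auto simp: combine_shift_digits [OF f] add_pow_rdistr_int)
    also have "\<dots> = combine k \<theta> (\<lambda>u. int (a l u)) \<otimes> (\<Oplus>v\<in>{..<k}. [int (b l v)] \<cdot> (\<theta> [^] v))"
      using theta combine_closed [OF theta] by (intro finsum_rdistr [symmetric]) auto
    finally show "(\<Oplus>v\<in>{..<k}. [int (b l v)] \<cdot> combine k \<theta> (\<lambda>u. int (shift p k f (a l) v u))) =
        combine k \<theta> (\<lambda>u. int (a l u)) \<otimes> combine k \<theta> (\<lambda>u. int (b l u))"
      by (simp only: combine_def [of k \<theta> "\<lambda>u. int (b l u)"])
  qed (use combine_closed [OF theta] in auto)
  finally show ?thesis by (simp only: combine_diff [OF theta])
qed

end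

section \<open>One side of the test: rows of the difference against the selected hash
  columns\<close>

definition side_prog where
  "side_prog N M R G \<alpha> \<beta> \<gamma> g tr pa qa za =
     Seq (Seq (fill ''Y'' lenY (expY tr qa)) (yates ''Y'' g N G lenY))
    (Seq (Seq (fill ''Z'' lenY (expY tr za)) (yates ''Z'' g N G lenY))
    (Seq (Seq (fill ''X'' lenX (expX tr pa)) (yates ''X'' \<alpha> (N * N) R lenX))
    (Seq (Seq (fill ''U'' lenU expU) (yates ''U'' \<beta> (N * M) R lenU))
    (Seq (Seq (fill ''W'' lenW expW) (Seq (fill ''V'' lenV expV) (yates ''V'' (\<lambda>x \<rho>. \<gamma> \<rho> x) R (N * M) lenV)))
         (Seq (fill ''E'' lenE expE) (Assign ''bad'' (Lit 0) expBad))))))"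

definition side_cost where
  "side_cost N M R G \<alpha> \<beta> \<gamma> g tr pa qa za =
     fill_cost lenY (expY tr qa) + 3 * yates_cost ''Y'' g N G lenY +
    (fill_cost lenY (expY tr za) + 3 * yates_cost ''Z'' g N G lenY +
    (fill_cost lenX (expX tr pa) + 3 * yates_cost ''X'' \<alpha> (N * N) R lenX +
    (fill_cost lenU expU + 3 * yates_cost ''U'' \<beta> (N * M) R lenU +
    (fill_cost lenW expW + (fill_cost lenV expV + 3 * yates_cost ''V'' (\<lambda>x \<rho>. \<gamma> \<rho> x) R (N * M) lenV) +
    (fill_cost lenE expE + assign_cost (Lit 0) expBad)))))"

context machine
begin

text \<open>Digit \<open>u\<close> of an entry of \<open>P0 Q0 - Z0\<close>, as an unreduced integer
  that is meaningful only modulo \<open>p\<close>.\<close>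

definition defect :: "(nat \<Rightarrow> nat \<Rightarrow> nat \<Rightarrow> nat) \<Rightarrow> (nat \<Rightarrow> nat \<Rightarrow> nat \<Rightarrow> nat) \<Rightarrow> (nat \<Rightarrow> nat \<Rightarrow> nat \<Rightarrow> nat) \<Rightarrow>
    nat \<Rightarrow> nat \<Rightarrow> nat \<Rightarrow> int" where
  "defect P0 Q0 Z0 u i j = (\<Sum>v<k. \<Sum>l<N ^ r. int (shift p k fd (P0 i l) v u) * int (Q0 l j v)) - int (Z0 i j u)"

definition detected :: "(nat \<Rightarrow> nat \<Rightarrow> nat \<Rightarrow> nat) \<Rightarrow> (nat \<Rightarrow> nat \<Rightarrow> nat \<Rightarrow> nat) \<Rightarrow> (nat \<Rightarrow> nat \<Rightarrow> nat \<Rightarrow> nat) \<Rightarrow> bool" where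
  "detected P0 Q0 Z0 \<longleftrightarrow> (\<exists>c<q. \<exists>u<k. \<exists>x<(N * M) ^ r. \<not> int p dvd
     (\<Sum>j<N ^ r. tpow g N G r (J (c * M ^ r + col_part N M r x)) j * defect P0 Q0 Z0 u (row_part N M r x) j))"

lemma side:
  assumes s: "env s" and bil: "bilinear_matmul (int p) N M R \<alpha> \<beta> \<gamma>"
    and src: "{pa, qa, za} \<subseteq> {''A'', ''B'', ''C''}"
    and P0: "\<forall>i<N ^ r. \<forall>j<N ^ r. \<forall>u<k. entry n k tr (s pa) i j u = P0 i j u \<and> P0 i j u < p"
    and Q0: "\<forall>i<N ^ r. \<forall>j<N ^ r. \<forall>u<k. entry n k tr (s qa) i j u = Q0 i j u \<and> Q0 i j u < p"
    and Z0: "\<forall>i<N ^ r. \<forall>j<N ^ r. \<forall>u<k. entry n k tr (s za) i j u = Z0 i j u \<and> Z0 i j u < p"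
  shows "\<exists>s'. costs (side_prog N M R G \<alpha> \<beta> \<gamma> g tr pa qa za) (side_cost N M R G \<alpha> \<beta> \<gamma> g tr pa qa za) s s' \<and>
    env s' \<and> s' ''A'' = s ''A'' \<and> s' ''B'' = s ''B'' \<and> s' ''C'' = s ''C'' \<and>
    s' ''bad'' 0 = of_bool (s ''bad'' 0 \<noteq> 0 \<or> detected P0 Q0 Z0)"
proof -
  let ?c1 = "fill_cost lenY (expY tr qa) + 3 * yates_cost ''Y'' g N G lenY"
  let ?c2 = "fill_cost lenY (expY tr za) + 3 * yates_cost ''Z'' g N G lenY"
  let ?c3 = "fill_cost lenX (expX tr pa) + 3 * yates_cost ''X'' \<alpha> (N * N) R lenX"
  let ?c4 = "fill_cost lenU expU + 3 * yates_cost ''U'' \<beta> (N * M) R lenU"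
  let ?c5 = "fill_cost lenW expW + (fill_cost lenV expV + 3 * yates_cost ''V'' (\<lambda>x \<rho>. \<gamma> \<rho> x) R (N * M) lenV)"
  let ?c6 = "fill_cost lenE expE + assign_cost (Lit 0) expBad"
  let ?S1 = "Seq (fill ''Y'' lenY (expY tr qa)) (yates ''Y'' g N G lenY)"
  let ?S2 = "Seq (fill ''Z'' lenY (expY tr za)) (yates ''Z'' g N G lenY)"
  let ?S3 = "Seq (fill ''X'' lenX (expX tr pa)) (yates ''X'' \<alpha> (N * N) R lenX)"
  let ?S4 = "Seq (fill ''U'' lenU expU) (yates ''U'' \<beta> (N * M) R lenU)"
  let ?S5 = "Seq (fill ''W'' lenW expW) (Seq (fill ''V'' lenV expV) (yates ''V'' (\<lambda>x \<rho>. \<gamma> \<rho> x) R (N * M) lenV))"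
  let ?S6 = "Seq (fill ''E'' lenE expE) (Assign ''bad'' (Lit 0) expBad)"
  let ?b = "s ''bad'' 0"
  have src': "qa \<notin> {''i'', ''Y''}" "za \<notin> {''i'', ''Z''}" "pa \<notin> {''i'', ''X''}"
    using src by auto
  have mem: "''Y'' \<in> {''Y'', ''Z''}" "''Z'' \<in> {''Y'', ''Z''}" by simp_all
  from load_hash [OF s mem(1) src'(1) Q0]
  obtain s1 where "costs ?S1 ?c1 s s1" "env s1"
    "\<forall>z. z \<notin> {''Y'', ''i'', ''j'', ''m'', ''t''} \<longrightarrow> s1 z = s z"
    "\<forall>v<k. \<forall>i<N ^ r. \<forall>\<rho><G ^ r. s1 ''Y'' ((v * N ^ r + i) * G ^ r + \<rho>) < p \<and>
       [int (s1 ''Y'' ((v * N ^ r + i) * G ^ r + \<rho>)) = (\<Sum>j<N ^ r. tpow g N G r \<rho> j * int (Q0 i j v))] (mod int p)"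
    by (elim exE conjE) (rule that)
  note s1 = this [rule_format]
  have "za \<notin> {''Y'', ''i'', ''j'', ''m'', ''t''}" "pa \<notin> {''Y'', ''i'', ''j'', ''m'', ''t''}" using src by auto
  note za1 = s1(3) [OF this(1)] and pa1 = s1(3) [OF this(2)]
  from load_hash [OF s1(2) mem(2) src'(2) Z0 [folded za1]]
  obtain s2 where "costs ?S2 ?c2 s1 s2" "env s2"
    "\<forall>z. z \<notin> {''Z'', ''i'', ''j'', ''m'', ''t''} \<longrightarrow> s2 z = s1 z"
    "\<forall>v<k. \<forall>i<N ^ r. \<forall>\<rho><G ^ r. s2 ''Z'' ((v * N ^ r + i) * G ^ r + \<rho>) < p \<and>
       [int (s2 ''Z'' ((v * N ^ r + i) * G ^ r + \<rho>)) = (\<Sum>j<N ^ r. tpow g N G r \<rho> j * int (Z0 i j v))] (mod int p)"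
    by (elim exE conjE) (rule that)
  note s2 = this [rule_format]
  have "pa \<notin> {''Z'', ''i'', ''j'', ''m'', ''t''}" using src by auto
  note pa2 = s2(3) [OF this]
  from load_X [OF s2(2) src'(3) P0 [folded pa1, folded pa2]]
  obtain s3 where "costs ?S3 ?c3 s2 s3" "env s3"
    "\<forall>z. z \<notin> {''X'', ''i'', ''j'', ''m'', ''t''} \<longrightarrow> s3 z = s2 z"
    "\<forall>v<k. \<forall>u<k. \<forall>\<rho><R ^ r. [int (s3 ''X'' ((v * k + u) * R ^ r + \<rho>)) =
       (\<Sum>a<(N * N) ^ r. tpow \<alpha> (N * N) R r \<rho> a * int (shift p k fd (P0 (row_part N N r a) (col_part N N r a)) v u))] (mod int p)"
    by (elim exE conjE) (rule that)
  note s3 = this [rule_format]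
  have Y: "s3 ''Y'' = s1 ''Y''" using s3(3) [of "''Y''"] s2(3) [of "''Y''"] by simp
  have Yp: "\<forall>v<k. \<forall>i<N ^ r. \<forall>\<rho><G ^ r. s3 ''Y'' ((v * N ^ r + i) * G ^ r + \<rho>) < p"
    unfolding Y by (intro allI impI s1(4) [THEN conjunct1])
  from load_U [OF s3(2) Yp]
  obtain s4 where "costs ?S4 ?c4 s3 s4" "env s4"
    "\<forall>z. z \<notin> {''U'', ''i'', ''j'', ''m'', ''t''} \<longrightarrow> s4 z = s3 z"
    "\<forall>c<q. \<forall>v<k. \<forall>\<rho><R ^ r. [int (s4 ''U'' ((c * k + v) * R ^ r + \<rho>)) =
       (\<Sum>x<(N * M) ^ r. tpow \<beta> (N * M) R r \<rho> x * int (s3 ''Y'' ((v * N ^ r + row_part N M r x) * G ^ r + J (c * M ^ r + col_part N M r x))))] (mod int p)"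
    by (elim exE conjE) (rule that)
  note s4 = this [rule_format]
  have X: "s4 ''X'' = s3 ''X''" using s4(3) [of "''X''"] by simp
  from compute_V [OF s4(2)]
  obtain s5 where "costs ?S5 ?c5 s4 s5" "env s5"
    "\<forall>z. z \<notin> {''W'', ''V'', ''i'', ''j'', ''m'', ''t''} \<longrightarrow> s5 z = s4 z"
    "\<forall>c<q. \<forall>u<k. \<forall>x<(N * M) ^ r. s5 ''V'' ((c * k + u) * (N * M) ^ r + x) < p \<and>
      [int (s5 ''V'' ((c * k + u) * (N * M) ^ r + x)) = (\<Sum>\<rho><R ^ r. tpow (\<lambda>x \<rho>. \<gamma> \<rho> x) R (N * M) r x \<rho> *
         (\<Sum>v<k. int (s4 ''X'' ((v * k + u) * R ^ r + \<rho>)) * int (s4 ''U'' ((c * k + v) * R ^ r + \<rho>))))] (mod int p)"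
    by (elim exE conjE) (rule that)
  note s5 = this [rule_format]
  have Z: "s5 ''Z'' = s2 ''Z''" using s5(3) [of "''Z''"] s4(3) [of "''Z''"] s3(3) [of "''Z''"] by simp
  from compare [OF s5(2)]
  obtain s6 where "costs ?S6 ?c6 s5 s6" "env s6"
    "\<forall>z. z \<notin> {''E'', ''i'', ''bad''} \<longrightarrow> s6 z = s5 z"
    "s6 ''bad'' 0 = of_bool (s5 ''bad'' 0 \<noteq> 0 \<or> (\<exists>c<q. \<exists>u<k. \<exists>x<(N * M) ^ r. s5 ''V'' ((c * k + u) * (N * M) ^ r + x) \<noteq>
        s5 ''Z'' ((u * N ^ r + row_part N M r x) * G ^ r + J (c * M ^ r + col_part N M r x))))"
    by (elim exE conjE) (rule that)
  note s6 = this [rule_format]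
  have key: "s5 ''V'' ((c * k + u) * (N * M) ^ r + x) \<noteq>
        s5 ''Z'' ((u * N ^ r + row_part N M r x) * G ^ r + J (c * M ^ r + col_part N M r x)) \<longleftrightarrow>
      \<not> int p dvd (\<Sum>j<N ^ r. tpow g N G r (J (c * M ^ r + col_part N M r x)) j * defect P0 Q0 Z0 u (row_part N M r x) j)"
    if cux: "c < q" "u < k" "x < (N * M) ^ r" for c u x
  proof -
    define i where "i = row_part N M r x"
    define e where "e = J (c * M ^ r + col_part N M r x)"
    have i: "i < N ^ r" unfolding i_def by (rule row_part_less [OF cux(3)])
    have e: "e < G ^ r" unfolding e_def by (rule J)
    define A where "A v i j = int (shift p k fd (P0 i j) v u)" for v i j
    define B where "B v j l = int (s1 ''Y'' ((v * N ^ r + j) * G ^ r + J (c * M ^ r + l)))" for v j l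
    define V where "V = s5 ''V'' ((c * k + u) * (N * M) ^ r + x)"
    define Zv where "Zv = s5 ''Z'' ((u * N ^ r + i) * G ^ r + e)"
    have 1: "[int V = (\<Sum>\<rho><R ^ r. tpow (\<lambda>x \<rho>. \<gamma> \<rho> x) R (N * M) r x \<rho> * (\<Sum>v<k. int (s4 ''X'' ((v * k + u) * R ^ r + \<rho>)) * int (s4 ''U'' ((c * k + v) * R ^ r + \<rho>))))] (mod int p)"
      unfolding V_def by (rule s5(4) [OF cux, THEN conjunct2])
    have 2: "[(\<Sum>\<rho><R ^ r. tpow (\<lambda>x \<rho>. \<gamma> \<rho> x) R (N * M) r x \<rho> * (\<Sum>v<k. int (s4 ''X'' ((v * k + u) * R ^ r + \<rho>)) * int (s4 ''U'' ((c * k + v) * R ^ r + \<rho>)))) =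
        (\<Sum>\<rho><R ^ r. tpow (\<lambda>x \<rho>. \<gamma> \<rho> x) R (N * M) r x \<rho> * (\<Sum>v<k.
      (\<Sum>a<(N * N) ^ r. tpow \<alpha> (N * N) R r \<rho> a * A v (row_part N N r a) (col_part N N r a)) *
      (\<Sum>b<(N * M) ^ r. tpow \<beta> (N * M) R r \<rho> b * B v (row_part N M r b) (col_part N M r b))))] (mod int p)"
    proof (rule cong_sum, rule cong_mult [OF cong_refl], rule cong_sum, rule cong_mult)
      fix \<rho> v assume "\<rho> \<in> {..<R ^ r}" "v \<in> {..<k}"
      then have rv: "v < k" "\<rho> < R ^ r" by auto
      show "[int (s4 ''X'' ((v * k + u) * R ^ r + \<rho>)) =
          (\<Sum>a<(N * N) ^ r. tpow \<alpha> (N * N) R r \<rho> a * A v (row_part N N r a) (col_part N N r a))] (mod int p)"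
        unfolding X A_def by (rule s3(4) [OF rv(1) cux(2) rv(2)])
      show "[int (s4 ''U'' ((c * k + v) * R ^ r + \<rho>)) =
          (\<Sum>b<(N * M) ^ r. tpow \<beta> (N * M) R r \<rho> b * B v (row_part N M r b) (col_part N M r b))] (mod int p)"
        unfolding B_def Y [symmetric] by (rule s4(4) [OF cux(1) rv])
    qed
    have "N > 0" using pos(1) by simp
    note 3 = matmul_via_tpow [OF bil this pos(2) cux(3), where k = k and A = A and B = B]
    have 4: "[(\<Sum>v<k. \<Sum>l<N ^ r. A v i l * B v l (col_part N M r x)) =
        (\<Sum>v<k. \<Sum>l<N ^ r. A v i l * (\<Sum>j<N ^ r. tpow g N G r e j * int (Q0 l j v)))] (mod int p)"
    proof (rule cong_sum, rule cong_sum, rule cong_mult [OF cong_refl])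
      fix v l assume "v \<in> {..<k}" "l \<in> {..<N ^ r}"
      then show "[B v l (col_part N M r x) = (\<Sum>j<N ^ r. tpow g N G r e j * int (Q0 l j v))] (mod int p)"
        unfolding B_def e_def [symmetric] using s1(4) [of v l e] e by simp
    qed
    \<comment> \<open>Associativity: \<open>A (B H)\<close> equals \<open>(A B) H\<close>.\<close>
    have 5: "(\<Sum>v<k. \<Sum>l<N ^ r. A v i l * (\<Sum>j<N ^ r. tpow g N G r e j * int (Q0 l j v))) =
        (\<Sum>j<N ^ r. tpow g N G r e j * (\<Sum>v<k. \<Sum>l<N ^ r. A v i l * int (Q0 l j v)))"
    proof -
      have "(\<Sum>v<k. \<Sum>l<N ^ r. A v i l * (\<Sum>j<N ^ r. tpow g N G r e j * int (Q0 l j v))) =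
          (\<Sum>v<k. \<Sum>l<N ^ r. \<Sum>j<N ^ r. tpow g N G r e j * (A v i l * int (Q0 l j v)))"
        unfolding sum_distrib_left by (intro sum.cong refl) (simp only: mult.left_commute)
      also have "\<dots> = (\<Sum>v<k. \<Sum>j<N ^ r. \<Sum>l<N ^ r. tpow g N G r e j * (A v i l * int (Q0 l j v)))"
        by (intro sum.cong refl sum.swap)
      also have "\<dots> = (\<Sum>j<N ^ r. \<Sum>v<k. \<Sum>l<N ^ r. tpow g N G r e j * (A v i l * int (Q0 l j v)))"
        by (rule sum.swap)
      finally show ?thesis by (simp only: sum_distrib_left)
    qed
    have Vc: "[int V = (\<Sum>j<N ^ r. tpow g N G r e j * (\<Sum>v<k. \<Sum>l<N ^ r. A v i l * int (Q0 l j v)))] (mod int p)"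
      using cong_trans [OF cong_trans [OF cong_trans [OF 1 2] 3] 4 [unfolded i_def]] 5 unfolding i_def by simp
    have Zc: "[int Zv = (\<Sum>j<N ^ r. tpow g N G r e j * int (Z0 i j u))] (mod int p)" and Zp: "Zv < p"
      unfolding Zv_def Z using s2(4) [OF cux(2) i e] by auto
    have Vp: "V < p" unfolding V_def by (rule s5(4) [OF cux, THEN conjunct1])
    have "[int V - int Zv = (\<Sum>j<N ^ r. tpow g N G r e j * defect P0 Q0 Z0 u i j)] (mod int p)"
      using cong_diff [OF Vc Zc] by (simp add: defect_def A_def right_diff_distrib sum_subtractf)
    then have "int p dvd (int V - int Zv) \<longleftrightarrow> int p dvd (\<Sum>j<N ^ r. tpow g N G r e j * defect P0 Q0 Z0 u i j)"
      by (rule cong_dvd_iff)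
    \<comment> \<open>Both values are reduced, so comparing the cells decides the
      congruence.\<close>
    moreover have "int p dvd (int V - int Zv) \<longleftrightarrow> V = Zv"
      using Vp Zp by (simp add: mod_eq_dvd_iff [symmetric] flip: of_nat_mod)
    ultimately show ?thesis unfolding V_def Zv_def i_def e_def by simp
  qed
  have bad: "s5 ''bad'' = s ''bad''"
    using s5(3) [of "''bad''"] s4(3) [of "''bad''"] s3(3) [of "''bad''"] s2(3) [of "''bad''"] s1(3) [of "''bad''"] by simp
  have fr: "s6 z = s z" if "z \<in> {''A'', ''B'', ''C''}" for z
    using that s6(3) [of z] s5(3) [of z] s4(3) [of z] s3(3) [of z] s2(3) [of z] s1(3) [of z] by auto
  show ?thesis
  proof (intro exI conjI)
    show "costs (side_prog N M R G \<alpha> \<beta> \<gamma> g tr pa qa za) (side_cost N M R G \<alpha> \<beta> \<gamma> g tr pa qa za) s s6"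
      unfolding side_prog_def side_cost_def
      by (rule costs_Seq [OF s1(1) costs_Seq [OF s2(1) costs_Seq [OF s3(1) costs_Seq [OF s4(1) costs_Seq [OF s5(1) s6(1)]]]]])
    show "env s6" by (rule s6(2))
    show "s6 ''A'' = s ''A''" "s6 ''B'' = s ''B''" "s6 ''C'' = s ''C''" using fr by simp_all
    have "(\<exists>c<q. \<exists>u<k. \<exists>x<(N * M) ^ r. s5 ''V'' ((c * k + u) * (N * M) ^ r + x) \<noteq>
        s5 ''Z'' ((u * N ^ r + row_part N M r x) * G ^ r + J (c * M ^ r + col_part N M r x))) \<longleftrightarrow> detected P0 Q0 Z0"
      unfolding detected_def using key by (intro ex_cong1 conj_cong refl) auto
    then show "s6 ''bad'' 0 = of_bool (s ''bad'' 0 \<noteq> 0 \<or> detected P0 Q0 Z0)"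
      unfolding s6(4) bad by simp
  qed
qed

end

section \<open>Setting up the tables and selecting the hash columns\<close>

text \<open>
  The values with property \<open>P\<close> in increasing order. The next entry may contain a rejected value, since
  the program writes every candidate before it tests it.
\<close>

primrec sel :: "(nat \<Rightarrow> bool) \<Rightarrow> nat \<Rightarrow> nat \<Rightarrow> nat" where
  "sel P 0 = (\<lambda>_. 0)"
| "sel P (Suc t) = (sel P t)(card {j. j < t \<and> P j} := t)"

lemma card_less_Suc: "card {j. j < Suc t \<and> P j} = card {j. j < t \<and> P j} + of_bool (P t)"
proof (cases "P t")
  case True
  then have "{j. j < Suc t \<and> P j} = insert t {j. j < t \<and> P j}" by (auto simp: less_Suc_eq)
  then show ?thesis using True by simp
next
  case False
  then have "{j. j < Suc t \<and> P j} = {j. j < t \<and> P j}" by (auto simp: less_Suc_eq)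
  then show ?thesis using False by simp
qed

text \<open>Holds for every \<open>e\<close>, also for the positions past the selected values, which
  the last block of columns reads.\<close>

lemma sel_le: "sel P t e \<le> t - 1"
  by (induction t) (auto intro: order_trans)

lemma sel_hits: "j < t \<Longrightarrow> P j \<Longrightarrow> \<exists>e<card {j. j < t \<and> P j}. sel P t e = j"
proof (induction t)
  case (Suc t)
  show ?case
  proof (cases "j = t")
    case True
    then show ?thesis using Suc.prems by (intro exI [of _ "card {j. j < t \<and> P j}"]) (simp add: card_less_Suc)
  next
    case False
    then obtain e where "e < card {j. j < t \<and> P j}" "sel P t e = j" using Suc by auto
    then show ?thesis by (intro exI [of _ e]) (simp add: card_less_Suc)
  qed
qed simp

text \<open>As for the row parts, a leading zero is harmless, here because index 0 has weight 1; the
  weight table is filled by the same kind of recurrence.\<close>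

lemma weight_Suc: "w 0 = 1 \<Longrightarrow> x < G ^ t \<Longrightarrow> weight w G (Suc t) x = weight w G t x"
proof (induction t arbitrary: x)
  case (Suc t)
  then have "x div G < G ^ t" by (intro less_mult_imp_div_less) (simp add: mult.commute)
  from Suc.IH [OF Suc.prems(1) this] show ?case by (simp only: weight.simps(2))
qed simp

lemma weight_0: "w 0 = 1 \<Longrightarrow> weight w G t 0 = 1"
  by (induction t) auto

lemma weight_le:
  assumes "\<And>j. j < G \<Longrightarrow> w j \<le> N"
  shows "x < G ^ t \<Longrightarrow> weight w G t x \<le> N ^ t"
proof (induction t arbitrary: x)
  case (Suc t)
  have "G > 0" using Suc.prems by (cases G) auto
  moreover have "x div G < G ^ t" using Suc.prems by (intro less_mult_imp_div_less) (simp add: mult.commute)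
  ultimately show ?case using Suc.IH assms [of "x mod G"] by (simp add: mult_le_mono)
qed simp

abbreviation put :: "string \<Rightarrow> aexp \<Rightarrow> com" where "put x e \<equiv> Assign x (Lit 0) e"
abbreviation put_cost :: "aexp \<Rightarrow> nat" where "put_cost e \<equiv> assign_cost (Lit 0) e"

definition pow_body :: "nat \<Rightarrow> nat \<Rightarrow> nat \<Rightarrow> nat \<Rightarrow> com" where
  "pow_body N M R G = Seq (put ''nn'' (Times (C0 ''nn'') (Lit N))) (Seq (put ''mm'' (Times (C0 ''mm'') (Lit M)))
    (Seq (put ''rr'' (Times (C0 ''rr'') (Lit R))) (Seq (put ''gg'' (Times (C0 ''gg'') (Lit G)))
      (put ''r'' (Plus (C0 ''r'') (Lit 1))))))"

text \<open>Truncated subtraction stops the loop at the least \<open>r\<close> with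
  \<open>n <= N ^ r\<close>. \<open>''r''\<close> counts up from its initial memory value 0.\<close>

definition pow_prog :: "nat \<Rightarrow> nat \<Rightarrow> nat \<Rightarrow> nat \<Rightarrow> com" where
  "pow_prog N M R G = Seq (put ''nn'' (Lit 1)) (Seq (put ''mm'' (Lit 1)) (Seq (put ''rr'' (Lit 1)) (Seq (put ''gg'' (Lit 1))
    (While (Minus (C0 ''n'') (C0 ''nn'')) (pow_body N M R G)))))"

definition pow_cost :: "nat \<Rightarrow> nat \<Rightarrow> nat \<Rightarrow> nat \<Rightarrow> nat" where
  "pow_cost N M R G = put_cost (Lit 1) + (put_cost (Lit 1) + (put_cost (Lit 1) + (put_cost (Lit 1) +
     ((put_cost (Times (C0 ''nn'') (Lit N)) + (put_cost (Times (C0 ''mm'') (Lit M)) +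
      (put_cost (Times (C0 ''rr'') (Lit R)) + (put_cost (Times (C0 ''gg'') (Lit G)) + put_cost (Plus (C0 ''r'') (Lit 1)))))) +
      ecost (Minus (C0 ''n'') (C0 ''nn''))))))"

text \<open>Reads the table that it is filling: \<open>i div (b * c)\<close> is smaller than
  \<open>i\<close>, except for \<open>i = 0\<close>, where the cell still holds its initial
  0.\<close>

definition row_exp :: "nat \<Rightarrow> nat \<Rightarrow> string \<Rightarrow> aexp" where
  "row_exp b c x = Plus (Quot (Rem iE (Lit (b * c))) (Lit c)) (Times (Lit b) (Cell x (Quot iE (Lit (b * c)))))"

definition col_exp :: "nat \<Rightarrow> nat \<Rightarrow> string \<Rightarrow> aexp" where
  "col_exp b c x = Plus (Rem iE (Lit c)) (Times (Lit c) (Cell x (Quot iE (Lit (b * c)))))"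

text \<open>At \<open>i = 0\<close> the product is 0, because the cell read is the one being written
  and still holds 0; the summand \<open>Is0 iE\<close> supplies the weight 1 there.\<close>

definition weight_exp :: "nat \<Rightarrow> (nat \<Rightarrow> nat) \<Rightarrow> aexp" where
  "weight_exp G w = Plus (Times (Table G (\<lambda>d. Lit (w d)) (Rem iE (Lit G))) (Cell ''w'' (Quot iE (Lit G)))) (Is0 iE)"

definition sel_body :: com where
  "sel_body = Seq (Assign ''J'' (C0 ''c'') (C0 ''j''))
    (Seq (put ''c'' (Plus (C0 ''c'') (Is0 (Minus (Cell ''w'' (C0 ''j'')) (C0 ''mm'')))))
         (put ''j'' (Plus (C0 ''j'') (Lit 1))))"

definition sel_cost :: nat where
  "sel_cost = assign_cost (C0 ''c'') (C0 ''j'') +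
    (put_cost (Plus (C0 ''c'') (Is0 (Minus (Cell ''w'' (C0 ''j'')) (C0 ''mm'')))) + put_cost (Plus (C0 ''j'') (Lit 1))) +
    ecost (Minus (C0 ''gg'') (C0 ''j''))"

context machine
begin

lemma runs_set:
  assumes "bounded b s" "aval e s = v" "v < 2 ^ b"
  shows "runs (put x e) s (put_cost e * b) (s(x := (s x)(0 := v)))" "bounded b (s(x := (s x)(0 := v)))"
  using runs_Assign [OF assms(1) pos(8), of x "Lit 0" e] bounded_upd [OF assms(1,3)] assms(2) by simp_all

lemma costs_set:
  assumes "bounded b s" "aval e s = v" "v < 2 ^ b"
  shows "costs (put x e) (put_cost e) s (s(x := (s x)(0 := v)))" "bounded b (s(x := (s x)(0 := v)))"
  using costs_Assign [OF assms(1), of x "Lit 0" e] runs_set(2) [OF assms] assms(2) by simp_all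

lemma costs_While:
  assumes l: "l \<le> L"
    and step: "\<And>t s. t < l \<Longrightarrow> I t s \<Longrightarrow> aval e s \<noteq> 0 \<and> (\<exists>s'. runs c s (m * b) s' \<and> I (Suc t) s')"
    and stop: "\<And>s. I l s \<Longrightarrow> aval e s = 0"
    and bnd: "\<And>t s. t \<le> l \<Longrightarrow> I t s \<Longrightarrow> bounded b s"
    and init: "I 0 s"
  shows "\<exists>s'. costs (While e c) (m + ecost e) s s' \<and> I l s'"
proof -
  have "\<exists>s'. runs (While e c) s (l * (m * b) + (l + 1) * (ecost e * b)) s' \<and> I l s'"
    by (rule runs_While [where I = I and m = l, OF _ _ _ pos(8) init]) (erule (1) step | erule stop | erule (1) bnd)+
  then obtain s' where s': "runs (While e c) s (l * (m * b) + (l + 1) * (ecost e * b)) s'" "I l s'" by blast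
  have "l * (m * b) + (l + 1) * (ecost e * b) \<le> (L + 1) * (m * b) + (L + 1) * (ecost e * b)"
    using l by (intro add_mono mult_right_mono) auto
  also have "\<dots> = (L + 1) * ((m + ecost e) * b)" by (simp add: algebra_simps)
  also have "\<dots> \<le> (r + 1) * (L + 1) * ((m + ecost e) * b)" by (intro mult_right_mono) auto
  finally show ?thesis using s' runs_mono unfolding costs_def by blast
qed

lemma size_bounds: "N ^ r \<le> L" "M ^ r \<le> L" "R ^ r \<le> L" "G ^ r \<le> L" "r \<le> L"
  "(N * N) ^ r \<le> L" "(N * M) ^ r \<le> L" "q \<le> L"
proof -
  have le: "y \<le> L" if "x > 0" "x * y \<le> L" for x y :: nat
  proof -
    have "y \<le> x * y" using that(1) by simp
    then show ?thesis using that(2) by (rule order_trans)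
  qed
  have p: "N ^ r > 0" "k * k > 0" "q * k > 0" using pos by simp_all
  have "(k * k) * (N * N) ^ r \<le> L" using L_X [of 0] by simp
  then show 1: "(N * N) ^ r \<le> L" by (rule le [OF p(2)])
  have "(q * k) * (N * M) ^ r \<le> L" using L_U [of 0] by simp
  then show 2: "(N * M) ^ r \<le> L" by (rule le [OF p(3)])
  show 3: "N ^ r \<le> L" by (rule le [OF p(1)]) (use 1 in \<open>simp add: power_mult_distrib\<close>)
  show "M ^ r \<le> L" by (rule le [OF p(1)]) (use 2 in \<open>simp add: power_mult_distrib\<close>)
  have "(q * k) * R ^ r \<le> L" using L_V [of 0] by simp
  then show "R ^ r \<le> L" by (rule le [OF p(3)])
  have "(k * N ^ r) * G ^ r \<le> L" using L_Y [of r] by simp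
  moreover have "k * N ^ r > 0" using pos by simp
  ultimately show "G ^ r \<le> L" by (rule le [rotated])
  have "r < 2 ^ r" by (rule less_exp)
  also have "(2::nat) ^ r \<le> N ^ r" using pos(1) by (rule power_mono) simp
  finally show "r \<le> L" using 3 by simp
  have "k * (N * M) ^ r * q \<le> L" using L_V [of r] by (simp add: mult_ac)
  moreover have "k * (N * M) ^ r > 0" using pos by simp
  ultimately show "q \<le> L" by (rule le [rotated])
qed

lemma pow_less:
  assumes "x > 0" "x ^ r \<le> L" "t \<le> r"
  shows "x ^ t < 2 ^ b"
proof -
  have "x ^ t \<le> x ^ r" using assms by (intro power_increasing) auto
  then show ?thesis using assms(2) L_less by linarith
qed

lemma powers:
  assumes s: "bounded b s" "s ''n'' 0 = n" "s ''r'' 0 = 0" and r: "n \<le> N ^ r" "\<forall>t<r. N ^ t < n"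
  shows "\<exists>s'. costs (pow_prog N M R G) (pow_cost N M R G) s s' \<and> bounded b s' \<and>
    (\<forall>z. z \<notin> {''nn'', ''mm'', ''rr'', ''gg'', ''r''} \<longrightarrow> s' z = s z) \<and>
    s' ''nn'' 0 = N ^ r \<and> s' ''mm'' 0 = M ^ r \<and> s' ''rr'' 0 = R ^ r \<and> s' ''gg'' 0 = G ^ r \<and> s' ''r'' 0 = r"
proof -
  define I where "I t s' \<longleftrightarrow> bounded b s' \<and> (\<forall>z. z \<notin> {''nn'', ''mm'', ''rr'', ''gg'', ''r''} \<longrightarrow> s' z = s z) \<and>
    s' ''nn'' 0 = N ^ t \<and> s' ''mm'' 0 = M ^ t \<and> s' ''rr'' 0 = R ^ t \<and> s' ''gg'' 0 = G ^ t \<and> s' ''r'' 0 = t" for t s'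
  have one: "(1::nat) < 2 ^ b" using pos(8) by (intro one_less_power) auto
  let ?bc = "put_cost (Times (C0 ''nn'') (Lit N)) + (put_cost (Times (C0 ''mm'') (Lit M)) +
      (put_cost (Times (C0 ''rr'') (Lit R)) + (put_cost (Times (C0 ''gg'') (Lit G)) + put_cost (Plus (C0 ''r'') (Lit 1)))))"
  define s1 where "s1 = s(''nn'' := (s ''nn'')(0 := 1))"
  note a1 = costs_set [OF s(1) aval.simps(1) one, of "''nn''", folded s1_def]
  define s2 where "s2 = s1(''mm'' := (s1 ''mm'')(0 := 1))"
  note a2 = costs_set [OF a1(2) aval.simps(1) one, of "''mm''", folded s2_def]
  define s3 where "s3 = s2(''rr'' := (s2 ''rr'')(0 := 1))"
  note a3 = costs_set [OF a2(2) aval.simps(1) one, of "''rr''", folded s3_def]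
  define s4 where "s4 = s3(''gg'' := (s3 ''gg'')(0 := 1))"
  note a4 = costs_set [OF a3(2) aval.simps(1) one, of "''gg''", folded s4_def]
  have "I 0 s4" unfolding I_def using a4(2) s by (simp add: s4_def s3_def s2_def s1_def)
  let ?w = "Minus (C0 ''n'') (C0 ''nn'')"
  have "\<exists>s'. costs (While ?w (pow_body N M R G)) (?bc + ecost ?w) s4 s' \<and> I r s'"
  proof (rule costs_While [OF size_bounds(5)])
    fix t s' assume t: "t < r" and I: "I t s'"
    have n: "s' ''n'' 0 = n" using I s(2) by (simp add: I_def)
    have St: "Suc t \<le> r" using t by simp
    have lt: "N ^ Suc t < 2 ^ b" "M ^ Suc t < 2 ^ b" "R ^ Suc t < 2 ^ b" "G ^ Suc t < 2 ^ b"
      using pos size_bounds(1-4) St by (auto simp only: intro!: pow_less)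
    have ltr: "t + 1 < 2 ^ b" using t size_bounds(5) L_less by linarith
    have bs: "bounded b s'" using I by (simp add: I_def)
    have e1: "aval (Times (C0 ''nn'') (Lit N)) s' = N ^ Suc t" using I by (simp add: I_def)
    note b1 = runs_set [OF bs e1 lt(1), of "''nn''"]
    let ?s1 = "s'(''nn'' := (s' ''nn'')(0 := N ^ Suc t))"
    have e2: "aval (Times (C0 ''mm'') (Lit M)) ?s1 = M ^ Suc t" using I by (simp add: I_def)
    note b2 = runs_set [OF b1(2) e2 lt(2), of "''mm''"]
    let ?s2 = "?s1(''mm'' := (?s1 ''mm'')(0 := M ^ Suc t))"
    have e3: "aval (Times (C0 ''rr'') (Lit R)) ?s2 = R ^ Suc t" using I by (simp add: I_def)
    note b3 = runs_set [OF b2(2) e3 lt(3), of "''rr''"]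
    let ?s3 = "?s2(''rr'' := (?s2 ''rr'')(0 := R ^ Suc t))"
    have e4: "aval (Times (C0 ''gg'') (Lit G)) ?s3 = G ^ Suc t" using I by (simp add: I_def)
    note b4 = runs_set [OF b3(2) e4 lt(4), of "''gg''"]
    let ?s4 = "?s3(''gg'' := (?s3 ''gg'')(0 := G ^ Suc t))"
    have e5: "aval (Plus (C0 ''r'') (Lit 1)) ?s4 = t + 1" using I by (simp add: I_def)
    note b5 = runs_set [OF b4(2) e5 ltr, of "''r''"]
    have "runs (pow_body N M R G) s' (?bc * b) (?s4(''r'' := (?s4 ''r'')(0 := t + 1)))"
      unfolding pow_body_def
      by (rule runs_mono [OF runs_Seq [OF b1(1) runs_Seq [OF b2(1) runs_Seq [OF b3(1) runs_Seq [OF b4(1) b5(1)]]]]])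
        (simp add: algebra_simps)
    moreover have "I (Suc t) (?s4(''r'' := (?s4 ''r'')(0 := t + 1)))"
      unfolding I_def
    proof (intro conjI)
      show "bounded b (?s4(''r'' := (?s4 ''r'')(0 := t + 1)))" by (rule b5(2))
    qed (use I in \<open>simp_all add: I_def\<close>)
    moreover have "aval ?w s' \<noteq> 0" using r(2) [rule_format, OF t] n I by (simp add: I_def)
    ultimately show "aval ?w s' \<noteq> 0 \<and> (\<exists>s''. runs (pow_body N M R G) s' (?bc * b) s'' \<and> I (Suc t) s'')"
      by (intro conjI exI)
  next
    fix s' assume "I r s'"
    then show "aval ?w s' = 0" using r(1) s(2) by (simp add: I_def)
  next
    fix t s' assume "I t s'"
    then show "bounded b s'" by (simp add: I_def)
  qed (rule \<open>I 0 s4\<close>)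
  then obtain s' where s': "costs (While ?w (pow_body N M R G)) (?bc + ecost ?w) s4 s'"
    "I r s'" by (elim exE conjE) (rule that)
  have "costs (pow_prog N M R G) (pow_cost N M R G) s s'"
    unfolding pow_prog_def pow_cost_def
    by (rule costs_Seq [OF a1(1) costs_Seq [OF a2(1) costs_Seq [OF a3(1) costs_Seq [OF a4(1) s'(1)]]]])
  then show ?thesis using s'(2) unfolding I_def by (intro exI conjI) blast+
qed

lemma fill_row:
  assumes s: "bounded b s" "s x = (\<lambda>_. 0)" and x: "x \<noteq> ''i''" and bc: "bb * c \<ge> 2" "(bb * c) ^ r \<le> L"
    and len: "\<forall>h t. aval n' (fill_state s x h t) = (bb * c) ^ r"
  shows "\<exists>s'. costs (fill x n' (row_exp bb c x)) (fill_cost n' (row_exp bb c x)) s s' \<and> bounded b s' \<and>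
    (\<forall>z. z \<notin> {x, ''i''} \<longrightarrow> s' z = s z) \<and> (\<forall>y<(bb * c) ^ r. s' x y = row_part bb c r y)"
proof (rule costs_fill [OF s(1) x bc(2) len [rule_format]])
  fix t assume t: "t < (bb * c) ^ r"
  have "aval (row_exp bb c x) (fill_state s x (row_part bb c r) t) = t mod (bb * c) div c + bb * row_part bb c r (t div (bb * c))"
  proof (cases "t = 0")
    case False
    then have "t div (bb * c) < t" using bc(1) by (intro div_less_dividend) auto
    then show ?thesis using x by (simp add: row_exp_def fill_state_apply)
  qed (use x s(2) in \<open>simp add: row_exp_def fill_state_apply row_part_0\<close>)
  also have "\<dots> = row_part bb c r t" using row_part_Suc [OF t] by simp
  finally show "aval (row_exp bb c x) (fill_state s x (row_part bb c r) t) = row_part bb c r t" .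
  have "0 < c" using bc(1) by (cases c) auto
  then have "bb ^ r \<le> (bb * c) ^ r" by (intro power_mono) auto
  then show "row_part bb c r t < 2 ^ b" using row_part_less [OF t] bc(2) L_less by linarith
qed

lemma fill_col:
  assumes s: "bounded b s" "s x = (\<lambda>_. 0)" and x: "x \<noteq> ''i''" and bc: "bb * c \<ge> 2" "(bb * c) ^ r \<le> L"
    and len: "\<forall>h t. aval n' (fill_state s x h t) = (bb * c) ^ r"
  shows "\<exists>s'. costs (fill x n' (col_exp bb c x)) (fill_cost n' (col_exp bb c x)) s s' \<and> bounded b s' \<and>
    (\<forall>z. z \<notin> {x, ''i''} \<longrightarrow> s' z = s z) \<and> (\<forall>y<(bb * c) ^ r. s' x y = col_part bb c r y)"
proof (rule costs_fill [OF s(1) x bc(2) len [rule_format]])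
  fix t assume t: "t < (bb * c) ^ r"
  have "aval (col_exp bb c x) (fill_state s x (col_part bb c r) t) = t mod c + c * col_part bb c r (t div (bb * c))"
  proof (cases "t = 0")
    case False
    then have "t div (bb * c) < t" using bc(1) by (intro div_less_dividend) auto
    then show ?thesis using x by (simp add: col_exp_def fill_state_apply)
  qed (use x s(2) in \<open>simp add: col_exp_def fill_state_apply col_part_0\<close>)
  also have "\<dots> = col_part bb c r t" using col_part_Suc [OF t] by simp
  finally show "aval (col_exp bb c x) (fill_state s x (col_part bb c r) t) = col_part bb c r t" .
  have "0 < bb" using bc(1) by (cases bb) auto
  then have "c ^ r \<le> (bb * c) ^ r" by (intro power_mono) auto
  then show "col_part bb c r t < 2 ^ b" using col_part_less [OF t] bc(2) L_less by linarith
qed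

lemma fill_weight:
  assumes s: "bounded b s" "s ''w'' = (\<lambda>_. 0)" "s ''gg'' 0 = G ^ r"
    and w: "w 0 = 1" "G \<ge> 2" "\<forall>j<G. w j \<le> N"
  shows "\<exists>s'. costs (fill ''w'' (C0 ''gg'') (weight_exp G w)) (fill_cost (C0 ''gg'') (weight_exp G w)) s s' \<and> bounded b s' \<and>
    (\<forall>z. z \<notin> {''w'', ''i''} \<longrightarrow> s' z = s z) \<and> (\<forall>y<G ^ r. s' ''w'' y = weight w G r y)"
proof (rule costs_fill [OF s(1) _ size_bounds(4)])
  fix t assume t: "t < G ^ r"
  have mG: "t mod G < G" using w(2) by simp
  show "aval (weight_exp G w) (fill_state s ''w'' (weight w G r) t) = weight w G r t"
  proof (cases "t = 0")
    case False
    then have "t div G < t" using w(2) by (intro div_less_dividend) auto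
    then have "aval (weight_exp G w) (fill_state s ''w'' (weight w G r) t) = w (t mod G) * weight w G r (t div G)"
      using False mG by (simp add: weight_exp_def fill_state_apply aval_Table)
    also have "\<dots> = weight w G r t" using weight_Suc [of w, OF w(1) t] by simp
    finally show ?thesis .
  next
    case True
    then show ?thesis using s(2) by (simp add: weight_exp_def fill_state_apply weight_0 [of w, OF w(1)])
  qed
  have "weight w G r t \<le> N ^ r" by (rule weight_le [OF _ t]) (use w(3) in simp)
  then show "weight w G r t < 2 ^ b" using size_bounds(1) L_less by linarith
qed (use s(3) in \<open>simp_all add: fill_state_apply\<close>)

lemma select:
  assumes s: "bounded b s" "s ''J'' = (\<lambda>_. 0)" "s ''c'' 0 = 0" "s ''j'' 0 = 0" "s ''gg'' 0 = G ^ r" "s ''mm'' 0 = M ^ r"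
    "\<forall>y<G ^ r. s ''w'' y = weight w G r y"
  shows "\<exists>s'. costs (While (Minus (C0 ''gg'') (C0 ''j'')) sel_body) sel_cost s s' \<and> bounded b s' \<and>
    (\<forall>z. z \<notin> {''J'', ''c'', ''j''} \<longrightarrow> s' z = s z) \<and>
    s' ''c'' 0 = card {j. j < G ^ r \<and> weight w G r j \<le> M ^ r} \<and> s' ''J'' = sel (\<lambda>j. weight w G r j \<le> M ^ r) (G ^ r)"
proof -
  let ?P = "\<lambda>j. weight w G r j \<le> M ^ r"
  define I where "I t s' \<longleftrightarrow> bounded b s' \<and> (\<forall>z. z \<notin> {''J'', ''c'', ''j''} \<longrightarrow> s' z = s z) \<and>
    s' ''j'' 0 = t \<and> s' ''c'' 0 = card {j. j < t \<and> ?P j} \<and> s' ''J'' = sel ?P t" for t s'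
  let ?w = "Minus (C0 ''gg'') (C0 ''j'')"
  let ?e = "Plus (C0 ''c'') (Is0 (Minus (Cell ''w'' (C0 ''j'')) (C0 ''mm'')))"
  let ?bc = "assign_cost (C0 ''c'') (C0 ''j'') + (put_cost ?e + put_cost (Plus (C0 ''j'') (Lit 1)))"
  have "\<exists>s'. costs (While ?w sel_body) (?bc + ecost ?w) s s' \<and> I (G ^ r) s'"
  proof (rule costs_While [OF size_bounds(4)])
    fix t s' assume t: "t < G ^ r" and I: "I t s'"
    have lt: "t + 1 < 2 ^ b" using t size_bounds(4) L_less by linarith
    have v: "s' ''gg'' 0 = G ^ r" "s' ''mm'' 0 = M ^ r" "s' ''w'' t = weight w G r t" "s' ''j'' 0 = t"
      "s' ''c'' 0 = card {j. j < t \<and> ?P j}" "s' ''J'' = sel ?P t"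
      using I s t by (simp_all add: I_def)
    have bs: "bounded b s'" using I by (simp add: I_def)
    let ?s1 = "s'(''J'' := (s' ''J'')(card {j. j < t \<and> ?P j} := t))"
    have c1: "runs (Assign ''J'' (C0 ''c'') (C0 ''j'')) s' (assign_cost (C0 ''c'') (C0 ''j'') * b) ?s1"
      using runs_Assign [OF bs pos(8), of "''J''" "C0 ''c''" "C0 ''j''"] v by simp
    have b1: "bounded b ?s1" using bs lt by (intro bounded_upd) auto
    have "card {j. j < Suc t \<and> ?P j} \<le> card {..<Suc t}" by (rule card_mono) auto
    then have lt2: "card {j. j < Suc t \<and> ?P j} < 2 ^ b" using lt by simp
    have e2: "aval ?e ?s1 = card {j. j < Suc t \<and> ?P j}" unfolding card_less_Suc using v by simp
    note c2 = runs_set [OF b1 e2 lt2, of "''c''"]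
    let ?s2 = "?s1(''c'' := (?s1 ''c'')(0 := card {j. j < Suc t \<and> ?P j}))"
    have e3: "aval (Plus (C0 ''j'') (Lit 1)) ?s2 = t + 1" using v by simp
    note c3 = runs_set [OF c2(2) e3 lt, of "''j''"]
    have "runs sel_body s' (?bc * b) (?s2(''j'' := (?s2 ''j'')(0 := t + 1)))"
      unfolding sel_body_def by (rule runs_mono [OF runs_Seq [OF c1 runs_Seq [OF c2(1) c3(1)]]]) (simp add: algebra_simps)
    moreover have "I (Suc t) (?s2(''j'' := (?s2 ''j'')(0 := t + 1)))"
      unfolding I_def
    proof (intro conjI)
      show "bounded b (?s2(''j'' := (?s2 ''j'')(0 := t + 1)))" by (rule c3(2))
    qed (use I in \<open>simp_all add: I_def\<close>)
    moreover have "aval ?w s' \<noteq> 0" using v t by simp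
    ultimately show "aval ?w s' \<noteq> 0 \<and> (\<exists>s''. runs sel_body s' (?bc * b) s'' \<and> I (Suc t) s'')" by (intro conjI exI)
  next
    fix s' assume "I (G ^ r) s'"
    then show "aval ?w s' = 0" using s(5) by (simp add: I_def)
  next
    fix t s' assume "I t s'"
    then show "bounded b s'" by (simp add: I_def)
  qed (use s in \<open>simp add: I_def\<close>)
  then show ?thesis unfolding I_def sel_cost_def by (elim exE conjE) (intro exI conjI)
qed

end

section \<open>The complete program\<close>

abbreviation "exp_q \<equiv> Plus (Quot (C0 ''c'') (C0 ''mm'')) (Lit 1)"

text \<open>The second call receives \<open>B\<close>, \<open>A\<close> and \<open>C\<close>
  transposed: the transpose of \<open>A B\<close> is the product of the transposes in reverse order,
  so sparse columns become sparse rows.\<close>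

definition mmv_prog where
  "mmv_prog N M R G \<alpha> \<beta> \<gamma> g w =
     Seq (pow_prog N M R G)
    (Seq (fill ''ra'' (Times nnE nnE) (row_exp N N ''ra''))
    (Seq (fill ''ca'' (Times nnE nnE) (col_exp N N ''ca''))
    (Seq (fill ''rb'' bbE (row_exp N M ''rb''))
    (Seq (fill ''cb'' bbE (col_exp N M ''cb''))
    (Seq (fill ''w'' (C0 ''gg'') (weight_exp G w))
    (Seq (While (Minus (C0 ''gg'') (C0 ''j'')) sel_body)
    (Seq (put ''q'' exp_q)
    (Seq (side_prog N M R G \<alpha> \<beta> \<gamma> g False ''A'' ''B'' ''C'')
    (Seq (side_prog N M R G \<alpha> \<beta> \<gamma> g True ''B'' ''A'' ''C'')
         (put ''out'' (Is0 (C0 ''bad''))))))))))))"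

definition mmv_cost where
  "mmv_cost N M R G \<alpha> \<beta> \<gamma> g w =
     pow_cost N M R G +
    (fill_cost (Times nnE nnE) (row_exp N N ''ra'') +
    (fill_cost (Times nnE nnE) (col_exp N N ''ca'') +
    (fill_cost bbE (row_exp N M ''rb'') +
    (fill_cost bbE (col_exp N M ''cb'') +
    (fill_cost (C0 ''gg'') (weight_exp G w) +
    (sel_cost +
    (put_cost exp_q +
    (side_cost N M R G \<alpha> \<beta> \<gamma> g False ''A'' ''B'' ''C'' +
    (side_cost N M R G \<alpha> \<beta> \<gamma> g True ''B'' ''A'' ''C'' +
     put_cost (Is0 (C0 ''bad'')))))))))))"

lemma entry_True: "entry n k True a i j u = entry n k False a j i u"
  by (simp add: entry_def)

context machine
begin

lemma run_mmv_prog: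
  assumes s: "bounded b s" "s ''n'' 0 = n" "s ''p'' 0 = p" "s ''k'' 0 = k" "\<forall>u<k. s ''f'' u = fd u"
    and z: "\<forall>x\<in>{''r'', ''j'', ''ra'', ''ca'', ''rb'', ''cb'', ''w'', ''J'', ''c'', ''bad''}. s x = (\<lambda>_. 0)"
    and r: "n \<le> N ^ r" "\<forall>t<r. N ^ t < n"
    and w: "w 0 = 1" "G \<ge> 2" "\<forall>j<G. w j \<le> N"
    and J_eq: "J = sel (\<lambda>j. weight w G r j \<le> M ^ r) (G ^ r)"
    and q_eq: "q = card {j. j < G ^ r \<and> weight w G r j \<le> M ^ r} div M ^ r + 1"
    and bil: "bilinear_matmul (int p) N M R \<alpha> \<beta> \<gamma>"
    and A: "\<forall>i<N ^ r. \<forall>j<N ^ r. \<forall>u<k. entry n k False (s ''A'') i j u = Ad i j u \<and> Ad i j u < p"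
    and B: "\<forall>i<N ^ r. \<forall>j<N ^ r. \<forall>u<k. entry n k False (s ''B'') i j u = Bd i j u \<and> Bd i j u < p"
    and C: "\<forall>i<N ^ r. \<forall>j<N ^ r. \<forall>u<k. entry n k False (s ''C'') i j u = Cd i j u \<and> Cd i j u < p"
  shows "\<exists>s'. costs (mmv_prog N M R G \<alpha> \<beta> \<gamma> g w) (mmv_cost N M R G \<alpha> \<beta> \<gamma> g w) s s' \<and>
    s' ''out'' 0 = of_bool (\<not> detected Ad Bd Cd \<and> \<not> detected (\<lambda>i j. Bd j i) (\<lambda>i j. Ad j i) (\<lambda>i j. Cd j i))"
proof -
  have r0: "s ''r'' 0 = 0" using z by simp
  obtain s1 where "costs (pow_prog N M R G) (pow_cost N M R G) s s1" "bounded b s1"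
    "\<forall>z. z \<notin> {''nn'', ''mm'', ''rr'', ''gg'', ''r''} \<longrightarrow> s1 z = s z"
    "s1 ''nn'' 0 = N ^ r" "s1 ''mm'' 0 = M ^ r" "s1 ''rr'' 0 = R ^ r" "s1 ''gg'' 0 = G ^ r" "s1 ''r'' 0 = r"
    using powers [OF s(1,2) r0 r] by (elim exE conjE) (rule that)
  note s1 = this [rule_format]
  have NN: "N * N \<ge> 2" "N * M \<ge> 2"
  proof -
    have "2 * 1 \<le> N * N" "2 * 1 \<le> N * M" using pos by (intro mult_le_mono; simp)+
    then show "N * N \<ge> 2" "N * M \<ge> 2" by simp_all
  qed
  have lenA: "\<forall>h t. aval (Times nnE nnE) (fill_state s' x h t) = (N * N) ^ r"
    if "s' ''nn'' 0 = N ^ r" "x \<in> {''ra'', ''ca''}" for s' x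
    using that by (auto simp: fill_state_apply power_mult_distrib)
  have lenB: "\<forall>h t. aval bbE (fill_state s' x h t) = (N * M) ^ r"
    if "s' ''nn'' 0 = N ^ r" "s' ''mm'' 0 = M ^ r" "x \<in> {''rb'', ''cb''}" for s' x
    using that by (auto simp: fill_state_apply power_mult_distrib)
  have str: "''ra'' \<in> {''ra'', ''ca''}" "''ca'' \<in> {''ra'', ''ca''}" "''rb'' \<in> {''rb'', ''cb''}" "''cb'' \<in> {''rb'', ''cb''}"
    "''ra'' \<noteq> ''i''" "''ca'' \<noteq> ''i''" "''rb'' \<noteq> ''i''" "''cb'' \<noteq> ''i''" by simp_all
  have z1: "s1 ''ra'' = (\<lambda>_. 0)" using s1(3) [of "''ra''"] z by simp
  obtain s2 where "costs (fill ''ra'' (Times nnE nnE) (row_exp N N ''ra'')) (fill_cost (Times nnE nnE) (row_exp N N ''ra'')) s1 s2"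
    "bounded b s2" "\<forall>z. z \<notin> {''ra'', ''i''} \<longrightarrow> s2 z = s1 z" "\<forall>y<(N * N) ^ r. s2 ''ra'' y = row_part N N r y"
    using fill_row [OF s1(2) z1 str(5) NN(1) size_bounds(6) lenA [of s1, OF s1(4) str(1)]] by (elim exE conjE) (rule that)
  note s2 = this [rule_format]
  have z2: "s2 ''ca'' = (\<lambda>_. 0)" "s2 ''nn'' 0 = N ^ r" using s2(3) [of "''ca''"] s1(3) [of "''ca''"] s2(3) [of "''nn''"] s1(4) z by simp_all
  obtain s3 where "costs (fill ''ca'' (Times nnE nnE) (col_exp N N ''ca'')) (fill_cost (Times nnE nnE) (col_exp N N ''ca'')) s2 s3"
    "bounded b s3" "\<forall>z. z \<notin> {''ca'', ''i''} \<longrightarrow> s3 z = s2 z" "\<forall>y<(N * N) ^ r. s3 ''ca'' y = col_part N N r y"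
    using fill_col [OF s2(2) z2(1) str(6) NN(1) size_bounds(6) lenA [of s2, OF z2(2) str(2)]] by (elim exE conjE) (rule that)
  note s3 = this [rule_format]
  have f3: "s3 z = s1 z" if "z \<notin> {''ra'', ''ca'', ''i''}" for z using that s3(3) [of z] s2(3) [of z] by simp
  have z3: "s3 ''rb'' = (\<lambda>_. 0)" "s3 ''nn'' 0 = N ^ r" "s3 ''mm'' 0 = M ^ r"
    using f3 [of "''rb''"] f3 [of "''nn''"] f3 [of "''mm''"] s1(3) [of "''rb''"] s1(4,5) z by simp_all
  obtain s4 where "costs (fill ''rb'' bbE (row_exp N M ''rb'')) (fill_cost bbE (row_exp N M ''rb'')) s3 s4"
    "bounded b s4" "\<forall>z. z \<notin> {''rb'', ''i''} \<longrightarrow> s4 z = s3 z" "\<forall>y<(N * M) ^ r. s4 ''rb'' y = row_part N M r y"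
    using fill_row [OF s3(2) z3(1) str(7) NN(2) size_bounds(7) lenB [of s3, OF z3(2,3) str(3)]] by (elim exE conjE) (rule that)
  note s4 = this [rule_format]
  have z4: "s4 ''cb'' = (\<lambda>_. 0)" "s4 ''nn'' 0 = N ^ r" "s4 ''mm'' 0 = M ^ r"
    using s4(3) [of "''cb''"] s4(3) [of "''nn''"] s4(3) [of "''mm''"] f3 [of "''cb''"] z3 s1(3) [of "''cb''"] z by simp_all
  obtain s5 where "costs (fill ''cb'' bbE (col_exp N M ''cb'')) (fill_cost bbE (col_exp N M ''cb'')) s4 s5"
    "bounded b s5" "\<forall>z. z \<notin> {''cb'', ''i''} \<longrightarrow> s5 z = s4 z" "\<forall>y<(N * M) ^ r. s5 ''cb'' y = col_part N M r y"
    using fill_col [OF s4(2) z4(1) str(8) NN(2) size_bounds(7) lenB [of s4, OF z4(2,3) str(4)]] by (elim exE conjE) (rule that)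
  note s5 = this [rule_format]
  have f5: "s5 z = s1 z" if "z \<notin> {''ra'', ''ca'', ''rb'', ''cb'', ''i''}" for z
    using that s5(3) [of z] s4(3) [of z] f3 [of z] by simp
  have z5: "s5 ''w'' = (\<lambda>_. 0)" "s5 ''gg'' 0 = G ^ r"
    using f5 [of "''w''"] f5 [of "''gg''"] s1(3) [of "''w''"] s1(7) z by simp_all
  obtain s6 where "costs (fill ''w'' (C0 ''gg'') (weight_exp G w)) (fill_cost (C0 ''gg'') (weight_exp G w)) s5 s6"
    "bounded b s6" "\<forall>z. z \<notin> {''w'', ''i''} \<longrightarrow> s6 z = s5 z" "\<forall>y<G ^ r. s6 ''w'' y = weight w G r y"
    using fill_weight [OF s5(2) z5 w] by (elim exE conjE) (rule that)
  note s6 = this [rule_format]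
  have f6: "s6 z = s1 z" if "z \<notin> {''ra'', ''ca'', ''rb'', ''cb'', ''i'', ''w''}" for z
    using that s6(3) [of z] f5 [of z] by simp
  have z6: "s6 ''J'' = (\<lambda>_. 0)" "s6 ''c'' 0 = 0" "s6 ''j'' 0 = 0" "s6 ''gg'' 0 = G ^ r" "s6 ''mm'' 0 = M ^ r"
    "\<forall>y<G ^ r. s6 ''w'' y = weight w G r y"
    using f6 [of "''J''"] f6 [of "''c''"] f6 [of "''j''"] f6 [of "''gg''"] f6 [of "''mm''"] s1(5,7) z
      s1(3) [of "''J''"] s1(3) [of "''c''"] s1(3) [of "''j''"] s6(4) by simp_all
  obtain s7 where "costs (While (Minus (C0 ''gg'') (C0 ''j'')) sel_body) sel_cost s6 s7" "bounded b s7"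
    "\<forall>z. z \<notin> {''J'', ''c'', ''j''} \<longrightarrow> s7 z = s6 z"
    "s7 ''c'' 0 = card {j. j < G ^ r \<and> weight w G r j \<le> M ^ r}" "s7 ''J'' = sel (\<lambda>j. weight w G r j \<le> M ^ r) (G ^ r)"
    using select [OF s6(2) z6] by (elim exE conjE) (rule that)
  note s7 = this [rule_format]
  have f7: "s7 z = s1 z" if "z \<notin> {''ra'', ''ca'', ''rb'', ''cb'', ''i'', ''w'', ''J'', ''c'', ''j''}" for z
    using that s7(3) [of z] f6 [of z] by simp
  have "aval exp_q s7 = q" using s7(4) f7 [of "''mm''"] s1(5) by (simp add: q_eq)
  moreover have "q < 2 ^ b" using size_bounds(8) L_less by linarith
  ultimately have c8: "costs (put ''q'' exp_q) (put_cost exp_q) s7 (s7(''q'' := (s7 ''q'')(0 := q)))"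
      and b8: "bounded b (s7(''q'' := (s7 ''q'')(0 := q)))"
    using costs_set [OF s7(2), of exp_q q "''q''"] by blast+
  define s8 where "s8 = s7(''q'' := (s7 ''q'')(0 := q))"
  have f8: "s8 z = s z" if "z \<notin> {''ra'', ''ca'', ''rb'', ''cb'', ''i'', ''w'', ''J'', ''c'', ''j'', ''nn'', ''mm'', ''rr'', ''gg'', ''r'', ''q''}" for z
    using that f7 [of z] s1(3) [of z] by (simp add: s8_def)
  have env8: "env s8"
    unfolding env_def
  proof (intro conjI allI impI)
    show "bounded b s8" unfolding s8_def by (rule b8)
    show "s8 ''n'' 0 = n" "s8 ''p'' 0 = p" "s8 ''k'' 0 = k"
      using f8 [of "''n''"] f8 [of "''p''"] f8 [of "''k''"] s by simp_all
    show "s8 ''r'' 0 = r" "s8 ''nn'' 0 = N ^ r" "s8 ''mm'' 0 = M ^ r" "s8 ''rr'' 0 = R ^ r" "s8 ''gg'' 0 = G ^ r"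
      using f7 [of "''r''"] f7 [of "''nn''"] f7 [of "''mm''"] f7 [of "''rr''"] f7 [of "''gg''"] s1 by (simp_all add: s8_def)
    show "s8 ''q'' 0 = q" by (simp add: s8_def)
    show "s8 ''J'' e = J e" for e unfolding J_eq using s7(5) by (simp add: s8_def)
    show "s8 ''f'' u = fd u" if "u < k" for u using that f8 [of "''f''"] s(5) by simp
    show "s8 ''ra'' x = row_part N N r x" "s8 ''ca'' x = col_part N N r x" if "x < (N * N) ^ r" for x
      using s2(4) [OF that] s3(4) [OF that] s3(3) [of "''ra''"] s4(3) [of "''ra''"] s5(3) [of "''ra''"] s6(3) [of "''ra''"] s7(3) [of "''ra''"]
        s4(3) [of "''ca''"] s5(3) [of "''ca''"] s6(3) [of "''ca''"] s7(3) [of "''ca''"]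
      by (simp_all add: s8_def)
    show "s8 ''rb'' x = row_part N M r x" "s8 ''cb'' x = col_part N M r x" if "x < (N * M) ^ r" for x
      using s4(4) [OF that] s5(4) [OF that] s5(3) [of "''rb''"] s6(3) [of "''rb''"] s7(3) [of "''rb''"]
        s6(3) [of "''cb''"] s7(3) [of "''cb''"]
      by (simp_all add: s8_def)
  qed
  have in8: "s8 ''A'' = s ''A''" "s8 ''B'' = s ''B''" "s8 ''C'' = s ''C''" "s8 ''bad'' 0 = 0"
    using f8 [of "''A''"] f8 [of "''B''"] f8 [of "''C''"] f8 [of "''bad''"] z by simp_all
  have src: "{''A'', ''B'', ''C''} \<subseteq> {''A'', ''B'', ''C''}" "{''B'', ''A'', ''C''} \<subseteq> {''A'', ''B'', ''C''}" by auto
  obtain s9 where s9: "costs (side_prog N M R G \<alpha> \<beta> \<gamma> g False ''A'' ''B'' ''C'') (side_cost N M R G \<alpha> \<beta> \<gamma> g False ''A'' ''B'' ''C'') s8 s9"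
    "env s9" "s9 ''A'' = s8 ''A''" "s9 ''B'' = s8 ''B''" "s9 ''C'' = s8 ''C''"
    "s9 ''bad'' 0 = of_bool (s8 ''bad'' 0 \<noteq> 0 \<or> detected Ad Bd Cd)"
    using side [OF env8 bil src(1) A [folded in8] B [folded in8] C [folded in8]] by (elim exE conjE) (rule that)
  have At: "\<forall>i<N ^ r. \<forall>j<N ^ r. \<forall>u<k. entry n k True (s9 ''A'') i j u = Ad j i u \<and> Ad j i u < p"
    and Bt: "\<forall>i<N ^ r. \<forall>j<N ^ r. \<forall>u<k. entry n k True (s9 ''B'') i j u = Bd j i u \<and> Bd j i u < p"
    and Ct: "\<forall>i<N ^ r. \<forall>j<N ^ r. \<forall>u<k. entry n k True (s9 ''C'') i j u = Cd j i u \<and> Cd j i u < p"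
    using A B C unfolding entry_True s9(3-5) in8 by blast+
  obtain s10 where s10: "costs (side_prog N M R G \<alpha> \<beta> \<gamma> g True ''B'' ''A'' ''C'') (side_cost N M R G \<alpha> \<beta> \<gamma> g True ''B'' ''A'' ''C'') s9 s10"
    "env s10" "s10 ''bad'' 0 = of_bool (s9 ''bad'' 0 \<noteq> 0 \<or> detected (\<lambda>i j. Bd j i) (\<lambda>i j. Ad j i) (\<lambda>i j. Cd j i))"
    using side [OF s9(2) bil src(2) Bt At Ct] by (elim exE conjE) (rule that)
  have v: "aval (Is0 (Cell ''bad'' (Lit 0))) s10 = of_bool (\<not> detected Ad Bd Cd \<and> \<not> detected (\<lambda>i j. Bd j i) (\<lambda>i j. Ad j i) (\<lambda>i j. Cd j i))"
    using s10(3) s9(6) in8(4) by simp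
  have "aval (Is0 (Cell ''bad'' (Lit 0))) s10 < 2 ^ b" using one_less_power [of "2::nat" b] pos(8) by simp
  note c11 = costs_set(1) [OF env_bounded [OF s10(2)] v this [unfolded v], of "''out''"]
  show ?thesis
  proof (intro exI conjI)
    show "costs (mmv_prog N M R G \<alpha> \<beta> \<gamma> g w) (mmv_cost N M R G \<alpha> \<beta> \<gamma> g w) s (s10(''out'' := (s10 ''out'')(0 :=
        of_bool (\<not> detected Ad Bd Cd \<and> \<not> detected (\<lambda>i j. Bd j i) (\<lambda>i j. Ad j i) (\<lambda>i j. Cd j i)))))"
      unfolding mmv_prog_def mmv_cost_def
      by (rule costs_Seq [OF s1(1) costs_Seq [OF s2(1) costs_Seq [OF s3(1) costs_Seq [OF s4(1) costs_Seq [OF s5(1)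
        costs_Seq [OF s6(1) costs_Seq [OF s7(1) costs_Seq [OF c8 [folded s8_def] costs_Seq [OF s9(1) costs_Seq [OF s10(1) c11]]]]]]]]]])
  qed simp
qed

end

section \<open>Correctness of the verdict\<close>

lemma ex_parts:
  assumes "c > 0" "i < b ^ t" "j < c ^ t"
  shows "\<exists>x<(b * c) ^ t. row_part b c t x = i \<and> col_part b c t x = j"
proof (rule ccontr)
  assume neg: "\<not> ?thesis"
  \<comment> \<open>The sum of the indicator over all \<open>x\<close> is 1, so some
    \<open>x\<close> is hit.\<close>
  have "(\<Sum>x<(b * c) ^ t. of_bool (row_part b c t x = i \<and> col_part b c t x = j) * (1::int)) = (1::int)"
    using sum_of_bool_parts [OF assms, of "\<lambda>_ _. 1"] .
  moreover have "(\<Sum>x<(b * c) ^ t. of_bool (row_part b c t x = i \<and> col_part b c t x = j) * (1::int)) = 0"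
    using neg by (intro sum.neutral) auto
  ultimately show False by simp
qed

text \<open>If all nonzero rows and columns had more than \<open>m\<close> entries, there would be more than \<open>m\<^sup>2\<close> entries.\<close>

lemma ex_sparse_line:
  fixes T :: "(nat \<times> nat) set" and m :: nat
  assumes fin: "finite T" and ne: "T \<noteq> {}" and card: "card T \<le> m * m"
  shows "\<exists>(i, j)\<in>T. card {j'. (i, j') \<in> T} \<le> m \<or> card {i'. (i', j) \<in> T} \<le> m"
proof (rule ccontr)
  assume neg: "\<not> ?thesis"
  \<comment> \<open>One entry gives a row with more than \<open>m\<close> entries, and each of these
    lies in a column with more than \<open>m\<close> entries.\<close>
  obtain i j where ij: "(i, j) \<in> T" using ne by auto
  let ?S = "{j'. (i, j') \<in> T}"
  have finS: "finite ?S" using finite_imageI [OF fin, of snd] by (rule finite_subset [rotated]) force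
  have finC: "finite {i'. (i', j') \<in> T}" for j'
    using finite_imageI [OF fin, of fst] by (rule finite_subset [rotated]) force
  have gt: "Suc m \<le> card {j'. (i', j') \<in> T}" "Suc m \<le> card {i''. (i'', j') \<in> T}" if "(i', j') \<in> T" for i' j'
    using neg that by (auto simp: not_le Suc_le_eq)
  have "Suc m * Suc m \<le> card ?S * Suc m" using gt(1) [OF ij] by (rule mult_right_mono) simp
  also have "\<dots> = (\<Sum>j'\<in>?S. Suc m)" by simp
  also have "\<dots> \<le> (\<Sum>j'\<in>?S. card {i'. (i', j') \<in> T})" using gt(2) by (intro sum_mono) blast
  also have "\<dots> = card (SIGMA j':?S. {i'. (i', j') \<in> T})" using finS finC by simp
  also have "\<dots> = card (prod.swap ` (SIGMA j':?S. {i'. (i', j') \<in> T}))"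
    by (rule card_image [symmetric]) (auto simp: inj_on_def)
  also have "\<dots> \<le> card T" using fin by (intro card_mono) auto
  finally have "Suc m * Suc m \<le> m * m" using card by linarith
  then show False by simp
qed

locale mmv = machine N M R G \<alpha> \<beta> \<gamma> g n p k r q L b J fd + presented_field F p k \<theta>
  for N M R G :: nat and \<alpha> \<beta> \<gamma> g :: "nat \<Rightarrow> nat \<Rightarrow> int" and n p k r q L b :: nat and J fd :: "nat \<Rightarrow> nat"
    and F :: "'a ring" (structure) and \<theta> :: 'a +
  assumes n_le: "n \<le> N ^ r" and fd: "\<And>u. u < k \<Longrightarrow> fd u = digits F p k \<theta> (\<theta> [^] k) u"
begin

definition dig :: "(nat \<Rightarrow> nat \<Rightarrow> 'a) \<Rightarrow> nat \<Rightarrow> nat \<Rightarrow> nat \<Rightarrow> nat" where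
  "dig a i j u = (if i < n \<and> j < n then digits F p k \<theta> (a i j) u else 0)"

lemma entry_mat_cells:
  assumes a: "mat_entries F n a" and "u < k"
  shows "entry n k False (mat_cells F p k \<theta> n a) i j u = dig a i j u" "dig a i j u < p"
proof -
  show "entry n k False (mat_cells F p k \<theta> n a) i j u = dig a i j u"
  proof (cases "i < n \<and> j < n")
    case True
    then have "(i * n + j) * k + u < n * n * k" using \<open>u < k\<close> by (intro mult_add_less) auto
    then show ?thesis using True \<open>u < k\<close> by (simp add: entry_def mat_cells_def dig_def div_mod_mult_add)
  qed (auto simp: entry_def dig_def)
  show "dig a i j u < p" using a \<open>u < k\<close> p_gt_1 by (auto simp: dig_def mat_entries_def digits_less)
qed

lemma combine_dig:
  assumes "a i j \<in> carrier F" "i < n" "j < n"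
  shows "combine k \<theta> (\<lambda>u. int (dig a i j u)) = a i j"
  using assms combine_digits [of "a i j"] by (simp add: dig_def)

lemma combine_fd: "combine k \<theta> (\<lambda>u. int (fd u)) = \<theta> [^] k"
proof -
  have "combine k \<theta> (\<lambda>u. int (fd u)) = combine k \<theta> (\<lambda>u. int (digits F p k \<theta> (\<theta> [^] k) u))"
    using fd theta by (intro combine_cong) auto
  then show ?thesis using theta by (simp add: combine_digits)
qed

lemma shift_zero: "shift p k fd (\<lambda>u. 0) v u = 0"
  by (induction v arbitrary: u) auto

text \<open>For indices inside the matrix, recombining the digits gives the entry of the product
  minus \<open>c\<close>, and its vanishing is read off digit by digit; in the padding all defects
  are 0.\<close>

lemma defect_iff:
  assumes a: "mat_entries F n a" and b: "mat_entries F n b'" and c: "mat_entries F n c"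
  shows "(\<forall>u<k. int p dvd defect (dig a) (dig b') (dig c) u i j) \<longleftrightarrow> (i < n \<and> j < n \<longrightarrow> mat_prod F n a b' i j = c i j)"
proof (cases "i < n \<and> j < n")
  case False
  have "defect (dig a) (dig b') (dig c) u i j = 0" for u
  proof (cases "i < n")
    case True
    then show ?thesis using False by (simp add: defect_def dig_def)
  next
    case False
    then have "dig a i l = (\<lambda>u. 0)" for l by (auto simp: dig_def)
    then show ?thesis using False by (simp add: defect_def shift_zero) (simp add: dig_def)
  qed
  then show ?thesis using False by auto
next
  case True
  have "defect (dig a) (dig b') (dig c) u i j =
      (\<Sum>v<k. \<Sum>l<n. int (shift p k fd (dig a i l) v u) * int (dig b' l j v)) - int (dig c i j u)" for u
  proof -
    have "(\<Sum>l<N ^ r. int (shift p k fd (dig a i l) v u) * int (dig b' l j v)) =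
        (\<Sum>l<n. int (shift p k fd (dig a i l) v u) * int (dig b' l j v))" for v
      using n_le by (intro sum.mono_neutral_right) (auto simp: dig_def)
    then show ?thesis by (simp add: defect_def)
  qed
  then have "combine k \<theta> (\<lambda>u. defect (dig a) (dig b') (dig c) u i j) =
      (\<Oplus>l\<in>{..<n}. combine k \<theta> (\<lambda>u. int (dig a i l u)) \<otimes> combine k \<theta> (\<lambda>u. int (dig b' l j u))) \<ominus> combine k \<theta> (\<lambda>u. int (dig c i j u))"
    by (simp only: combine_inner_product [OF combine_fd])
  also have "(\<Oplus>l\<in>{..<n}. combine k \<theta> (\<lambda>u. int (dig a i l u)) \<otimes> combine k \<theta> (\<lambda>u. int (dig b' l j u))) = mat_prod F n a b' i j"
    unfolding mat_prod_def using a b True by (intro finsum_cong') (auto simp: combine_dig mat_entries_def)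
  also have "combine k \<theta> (\<lambda>u. int (dig c i j u)) = c i j"
    using c True by (intro combine_dig) (auto simp: mat_entries_def)
  finally have eq: "combine k \<theta> (\<lambda>u. defect (dig a) (dig b') (dig c) u i j) = mat_prod F n a b' i j \<ominus> c i j" .
  have "mat_prod F n a b' i j \<in> carrier F"
    unfolding mat_prod_def using a b True by (intro finsum_closed) (auto simp: mat_entries_def)
  moreover have "c i j \<in> carrier F" using c True by (auto simp: mat_entries_def)
  ultimately have "mat_prod F n a b' i j \<ominus> c i j = \<zero> \<longleftrightarrow> mat_prod F n a b' i j = c i j" by (rule r_right_minus_eq)
  then show ?thesis using True combine_eq_zero_iff [of "\<lambda>u. defect (dig a) (dig b') (dig c) u i j"] eq by simp
qed

lemma mat_prod_transpose:
  assumes "mat_entries F n a" "mat_entries F n b'" "i < n" "j < n"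
  shows "mat_prod F n (\<lambda>i j. b' j i) (\<lambda>i j. a j i) i j = mat_prod F n a b' j i"
  unfolding mat_prod_def using assms by (intro finsum_cong') (auto simp: mat_entries_def m_comm)

lemma not_detected:
  assumes "\<And>u i j. u < k \<Longrightarrow> int p dvd defect P0 Q0 Z0 u i j"
  shows "\<not> detected P0 Q0 Z0"
  unfolding detected_def using assms by (auto intro!: dvd_sum dvd_mult)

text \<open>\<open>tpow_detects\<close> supplies a row \<open>e'\<close> of the tensor power whose
  weight is at most \<open>M ^ r\<close>, hence a selected one. If it is the \<open>e\<close>-th, it
  lies in block \<open>e div M ^ r\<close> at column \<open>e mod M ^ r\<close>, and
  \<open>x\<close> encodes this column together with the matrix row \<open>i\<close>.\<close>

lemma sparse_row_detected:
  assumes iso: "\<forall>X. X \<subseteq> {..<N} \<and> X \<noteq> {} \<longrightarrow> (\<exists>j<G. w j \<le> card X \<and> card (T j \<inter> X) = 1)"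
    and g: "g = (\<lambda>j x. of_bool (x \<in> T j))"
    and J_eq: "J = sel (\<lambda>j. weight w G r j \<le> M ^ r) (G ^ r)"
    and q_eq: "q = card {j. j < G ^ r \<and> weight w G r j \<le> M ^ r} div M ^ r + 1"
    and u: "u < k" and i: "i < N ^ r" and j: "j < N ^ r" "\<not> int p dvd defect P0 Q0 Z0 u i j"
    and sparse: "card {j. j < N ^ r \<and> \<not> int p dvd defect P0 Q0 Z0 u i j} \<le> M ^ r"
  shows "detected P0 Q0 Z0"
proof -
  have iso': "\<exists>j<G. w j \<le> card X \<and> card (T j \<inter> X) = 1" if "X \<subseteq> {..<N}" "X \<noteq> {}" for X
    using iso that by blast
  have "{x. x < N ^ r \<and> \<not> int p dvd defect P0 Q0 Z0 u i x} \<noteq> {}" using j by blast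
  from tpow_detects [of N G w T, OF iso' this, folded g]
  obtain e' where e': "e' < G ^ r" "weight w G r e' \<le> card {x. x < N ^ r \<and> \<not> int p dvd defect P0 Q0 Z0 u i x}"
    "\<not> int p dvd (\<Sum>x<N ^ r. tpow g N G r e' x * defect P0 Q0 Z0 u i x)" by blast
  let ?P = "\<lambda>j. weight w G r j \<le> M ^ r"
  have "?P e'" using e'(2) sparse by linarith
  from sel_hits [of e' "G ^ r" ?P, OF e'(1) this] obtain e where e: "e < card {j. j < G ^ r \<and> ?P j}" "J e = e'"
    unfolding J_eq by blast
  have mm: "M ^ r > 0" using pos by simp
  \<comment> \<open>The additional block in \<open>q\<close> covers the remainder of the
    division.\<close>
  have c: "e div M ^ r < q"
    unfolding q_eq using div_le_mono [of e "card {j. j < G ^ r \<and> ?P j}" "M ^ r"] e(1) by simp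
  have "e mod M ^ r < M ^ r" using mm by simp
  from ex_parts [OF pos(2) i this] obtain x where x: "x < (N * M) ^ r" "row_part N M r x = i" "col_part N M r x = e mod M ^ r"
    by blast
  have "J (e div M ^ r * M ^ r + col_part N M r x) = e'" unfolding x(3) using e(2) by (simp only: div_mult_mod_eq)
  then show ?thesis unfolding detected_def using c u x e'(3) by blast
qed

text \<open>If the matrices differ, some nonzero row or column of the difference is sparse. One
  digit that is nonzero modulo \<open>p\<close> suffices to detect it, as the support of that digit
  is contained in that of the line. Columns are handled by the transposed matrices.\<close>

lemma detected_iff:
  assumes iso: "\<forall>X. X \<subseteq> {..<N} \<and> X \<noteq> {} \<longrightarrow> (\<exists>j<G. w j \<le> card X \<and> card (T j \<inter> X) = 1)"
    and g: "g = (\<lambda>j x. of_bool (x \<in> T j))"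
    and J_eq: "J = sel (\<lambda>j. weight w G r j \<le> M ^ r) (G ^ r)"
    and q_eq: "q = card {j. j < G ^ r \<and> weight w G r j \<le> M ^ r} div M ^ r + 1"
    and abc: "mat_entries F n a" "mat_entries F n b'" "mat_entries F n c"
    and sparse: "card {(i, j). i < n \<and> j < n \<and> mat_prod F n a b' i j \<ominus> c i j \<noteq> \<zero>} \<le> M ^ r * M ^ r"
  shows "(\<not> detected (dig a) (dig b') (dig c) \<and>
      \<not> detected (\<lambda>i j. dig b' j i) (\<lambda>i j. dig a j i) (\<lambda>i j. dig c j i)) \<longleftrightarrow> mmv_yes F n a b' c"
proof -
  define a' where "a' = (\<lambda>i j. b' j i)"
  define b'' where "b'' = (\<lambda>i j. a j i)"
  define c' where "c' = (\<lambda>i j. c j i)"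
  have tr: "mat_entries F n a'" "mat_entries F n b''" "mat_entries F n c'"
    using abc by (auto simp: mat_entries_def a'_def b''_def c'_def)
  have dig_tr: "(\<lambda>i j. dig b' j i) = dig a'" "(\<lambda>i j. dig a j i) = dig b''" "(\<lambda>i j. dig c j i) = dig c'"
    by (auto simp: dig_def a'_def b''_def c'_def fun_eq_iff)
  have prod_tr: "mat_prod F n a' b'' i j = mat_prod F n a b' j i" if "i < n" "j < n" for i j
    unfolding a'_def b''_def by (rule mat_prod_transpose [OF abc(1,2) that])
  have prod: "mat_prod F n a b' i j \<in> carrier F" if "i < n" "j < n" for i j
    unfolding mat_prod_def using abc that by (intro finsum_closed) (auto simp: mat_entries_def)
  define T' where "T' = {(i, j). i < n \<and> j < n \<and> mat_prod F n a b' i j \<noteq> c i j}"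
  have T': "T' = {(i, j). i < n \<and> j < n \<and> mat_prod F n a b' i j \<ominus> c i j \<noteq> \<zero>}"
    unfolding T'_def using prod abc by (auto simp: mat_entries_def)
  show ?thesis
  proof (cases "mmv_yes F n a b' c")
    case True
    have "\<not> detected (dig a) (dig b') (dig c)"
    proof (rule not_detected)
      fix u i j assume "u < k"
      then show "int p dvd defect (dig a) (dig b') (dig c) u i j"
        using defect_iff [OF abc, of i j] True by (auto simp: mmv_yes_def)
    qed
    moreover have "\<not> detected (dig a') (dig b'') (dig c')"
    proof (rule not_detected)
      fix u i j assume "u < k"
      moreover have "i < n \<and> j < n \<longrightarrow> mat_prod F n a' b'' i j = c' i j"
        using True prod_tr by (auto simp: mmv_yes_def c'_def)
      ultimately show "int p dvd defect (dig a') (dig b'') (dig c') u i j"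
        using defect_iff [OF tr, of i j] by blast
    qed
    ultimately show ?thesis using True unfolding dig_tr by simp
  next
    case False
    have fin': "finite T'" by (rule finite_subset [of _ "{..<n} \<times> {..<n}"]) (auto simp: T'_def)
    have "T' \<noteq> {}" using False by (auto simp: T'_def mmv_yes_def)
    moreover have "card T' \<le> M ^ r * M ^ r" using sparse unfolding T' .
    ultimately obtain i j where ij: "(i, j) \<in> T'"
      and or: "card {j'. (i, j') \<in> T'} \<le> M ^ r \<or> card {i'. (i', j) \<in> T'} \<le> M ^ r"
      using ex_sparse_line [OF fin'] by blast
    have lt: "i < n" "j < n" "i < N ^ r" "j < N ^ r" using ij n_le by (auto simp: T'_def)
    have finr: "finite {j'. (i, j') \<in> T'}" "finite {i'. (i', j) \<in> T'}"
      by (rule finite_subset [of _ "{..<n}"]; auto simp: T'_def)+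
    from or have "detected (dig a) (dig b') (dig c) \<or> detected (dig a') (dig b'') (dig c')"
    proof
      assume row: "card {j'. (i, j') \<in> T'} \<le> M ^ r"
      obtain u where u: "u < k" "\<not> int p dvd defect (dig a) (dig b') (dig c) u i j"
        using defect_iff [OF abc, of i j] ij by (auto simp: T'_def)
      have "{j'. j' < N ^ r \<and> \<not> int p dvd defect (dig a) (dig b') (dig c) u i j'} \<subseteq> {j'. (i, j') \<in> T'}"
        using defect_iff [OF abc, of i] u(1) by (auto simp: T'_def)
      then have "card {j'. j' < N ^ r \<and> \<not> int p dvd defect (dig a) (dig b') (dig c) u i j'} \<le> M ^ r"
        using card_mono [OF finr(1)] row by (meson order_trans)
      from sparse_row_detected [OF iso g J_eq q_eq u(1) lt(3,4) u(2) this] show ?thesis ..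
    next
      assume col: "card {i'. (i', j) \<in> T'} \<le> M ^ r"
      have ne: "\<not> (j < n \<and> i < n \<longrightarrow> mat_prod F n a' b'' j i = c' j i)"
        using ij lt prod_tr [of j i] by (auto simp: T'_def c'_def)
      then obtain u where u: "u < k" "\<not> int p dvd defect (dig a') (dig b'') (dig c') u j i"
        using defect_iff [OF tr, of j i] by blast
      have "{i'. i' < N ^ r \<and> \<not> int p dvd defect (dig a') (dig b'') (dig c') u j i'} \<subseteq> {i'. (i', j) \<in> T'}"
      proof
        fix i' assume "i' \<in> {i'. i' < N ^ r \<and> \<not> int p dvd defect (dig a') (dig b'') (dig c') u j i'}"
        then have "\<not> (j < n \<and> i' < n \<longrightarrow> mat_prod F n a' b'' j i' = c' j i')"
          using defect_iff [OF tr, of j i'] u(1) by blast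
        then show "i' \<in> {i'. (i', j) \<in> T'}" using prod_tr [of j i'] by (auto simp: T'_def c'_def)
      qed
      then have "card {i'. i' < N ^ r \<and> \<not> int p dvd defect (dig a') (dig b'') (dig c') u j i'} \<le> M ^ r"
        using card_mono [OF finr(2)] col by (meson order_trans)
      from sparse_row_detected [OF iso g J_eq q_eq u(1) lt(4,3) u(2) this] show ?thesis ..
    qed
    then show ?thesis using False unfolding dig_tr by simp
  qed
qed

end

section \<open>The time bound\<close>

lemma power_mono_nat: "x \<le> y \<Longrightarrow> x ^ r \<le> (y::nat) ^ r"
  by (rule power_mono) auto

text \<open>Bounds the arrays that occur between the two ends of a Yates transformation.\<close>

lemma mixed_power_le:
  fixes D E X r t :: nat
  assumes "D \<le> X" "E \<le> X" "t \<le> r"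
  shows "D ^ (r - t) * E ^ t \<le> X ^ r"
proof -
  have "D ^ (r - t) * E ^ t \<le> X ^ (r - t) * X ^ t" using assms by (intro mult_le_mono power_mono_nat)
  also have "\<dots> = X ^ r" using assms(3) by (simp flip: power_add)
  finally show ?thesis .
qed

text \<open>Here \<open>l\<close> bounds the binary logarithm of the field size, unlike in the
  isolating family, where it is that of the ground set; \<open>e0\<close> does the same for
  \<open>R * LL\<close>.\<close>

lemma mmv_run:
  fixes F :: "'a ring" and N M R G LL n p k r l e0 :: nat
  assumes F: "field F" "finite (carrier F)" "presents F p k \<theta>"
    and N: "N \<ge> 2" "M > 0" "M \<le> N" "N * N \<le> R" and bil: "bilinear_matmul (int p) N M R \<alpha> \<beta> \<gamma>"
    and w: "w 0 = 1" "G \<ge> 2" "\<forall>j<G. w j \<le> N"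
    and iso: "\<forall>X. X \<subseteq> {..<N} \<and> X \<noteq> {} \<longrightarrow> (\<exists>j<G. w j \<le> card X \<and> card (T j \<inter> X) = 1)"
    and LL: "G \<le> N * LL" "LL > 0" "card {j. j < G ^ r \<and> weight w G r j \<le> M ^ r} \<le> M ^ r * LL ^ r" "R * LL \<le> 2 ^ e0"
    and r: "n \<le> N ^ r" "\<forall>t<r. N ^ t < n" and l: "p ^ k \<le> 2 ^ l"
    and abc: "mat_entries F n A" "mat_entries F n B" "mat_entries F n C"
    and sparse: "card {(i, j). i < n \<and> j < n \<and> mat_prod F n A B i j \<ominus>\<^bsub>F\<^esub> C i j \<noteq> \<zero>\<^bsub>F\<^esub>} \<le> M ^ r * M ^ r"
  shows "\<exists>m s. exec (mmv_prog N M R G \<alpha> \<beta> \<gamma> (\<lambda>j x. of_bool (x \<in> T j)) w) (mmv_input F p k \<theta> n A B C) m s \<and>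
    m \<le> (r + 1) * (2 * k * k * (R * LL) ^ r + 1) * (mmv_cost N M R G \<alpha> \<beta> \<gamma> (\<lambda>j x. of_bool (x \<in> T j)) w * (2 + 2 * l + e0 * r)) \<and>
    s ''out'' 0 = (if mmv_yes F n A B C then 1 else 0)"
proof -
  interpret presented_field F p k \<theta>
    using F by (simp add: presented_field_def presented_field_axioms_def)
  define g :: "nat \<Rightarrow> nat \<Rightarrow> int" where "g = (\<lambda>j x. of_bool (x \<in> T j))"
  define P where "P = (\<lambda>j. weight w G r j \<le> M ^ r)"
  define J where "J = sel P (G ^ r)"
  define q where "q = card {j. j < G ^ r \<and> P j} div M ^ r + 1"
  \<comment> \<open>\<open>R ^ r\<close> is the number of products, \<open>k * k\<close> counts
    pairs of digits, and \<open>2 * LL ^ r\<close> bounds the number \<open>q\<close> of blocks. The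
    same \<open>LL ^ r\<close> covers the hashing, because \<open>G <= N * LL\<close> and
    \<open>N * N <= R\<close>.\<close>
  define L where "L = 2 * k * k * (R * LL) ^ r"
  \<comment> \<open>Two factors \<open>k <= 2 ^ l\<close> and the power of
    \<open>R * LL <= 2 ^ e0\<close> make up \<open>L\<close>; the summand 2 is for its factor 2 and
    for strictness.\<close>
  define b where "b = 2 + 2 * l + e0 * r"
  define fd where "fd = digits F p k \<theta> (\<theta> [^]\<^bsub>F\<^esub> k)"
  have mm: "M ^ r > 0" using N by simp
  have LLr: "LL ^ r > 0" using LL by simp
  have kk: "k > 0" by (rule k_pos)
  have R: "R > 0" using N mult_le_mono [OF N(1) N(1)] by linarith
  have NM: "N * M \<le> N * N" using N by simp
  have q_le: "q \<le> 2 * LL ^ r"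
  proof -
    have "card {j. j < G ^ r \<and> P j} div M ^ r \<le> (M ^ r * LL ^ r) div M ^ r"
      using LL(3) unfolding P_def by (rule div_le_mono)
    also have "\<dots> = LL ^ r" using mm by (intro nonzero_mult_div_cancel_left) simp
    finally show ?thesis using LLr unfolding q_def by linarith
  qed
  have X: "(R * LL) ^ r = R ^ r * LL ^ r" by (rule power_mult_distrib)
  have R_le: "R ^ r \<le> (R * LL) ^ r" using LL(2) by (intro power_mono_nat) simp
  have k_le: "k \<le> k * k" using kk by simp
  have L1: "(k * k) * (N * N) ^ (r - t) * R ^ t \<le> L" if "t \<le> r" for t
  proof -
    have "(N * N) ^ (r - t) * R ^ t \<le> R ^ r" using N(4) that by (intro mixed_power_le) auto
    also note R_le
    finally have "(k * k) * ((N * N) ^ (r - t) * R ^ t) \<le> (k * k) * (R * LL) ^ r" by (rule mult_le_mono2)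
    also have "\<dots> \<le> L" unfolding L_def by simp
    finally show ?thesis by (simp only: mult.assoc)
  qed
  have L2: "(k * N ^ r) * N ^ (r - t) * G ^ t \<le> L" if "t \<le> r" for t
  proof -
    have "N ^ (r - t) * G ^ t \<le> (N * LL) ^ r" using LL(1,2) that by (intro mixed_power_le) auto
    then have "k * (N ^ r * (N ^ (r - t) * G ^ t)) \<le> (k * k) * (N ^ r * (N * LL) ^ r)"
      using k_le by (intro mult_le_mono) auto
    also have "N ^ r * (N * LL) ^ r = (N * N * LL) ^ r" by (simp add: power_mult_distrib mult_ac)
    also have "(k * k) * \<dots> \<le> (k * k) * (R * LL) ^ r" using N(4) by (intro mult_le_mono2 power_mono_nat mult_le_mono1)
    also have "\<dots> \<le> L" unfolding L_def by simp
    finally show ?thesis by (simp only: mult.assoc)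
  qed
  have L3: "(q * k) * x \<le> L" if "x \<le> R ^ r" for x
  proof -
    have "(q * k) * x \<le> (2 * LL ^ r * (k * k)) * R ^ r" using q_le k_le that by (intro mult_le_mono)
    then show ?thesis unfolding L_def X by (simp add: mult_ac)
  qed
  have L4: "(q * k) * (N * M) ^ (r - t) * R ^ t \<le> L" if "t \<le> r" for t
  proof -
    have "(N * M) ^ (r - t) * R ^ t \<le> R ^ r" using N(4) NM that by (intro mixed_power_le) linarith+
    from L3 [OF this] show ?thesis by (simp add: mult.assoc)
  qed
  have L5: "(q * k) * R ^ (r - t) * (N * M) ^ t \<le> L" if "t \<le> r" for t
  proof -
    have "R ^ (r - t) * (N * M) ^ t \<le> R ^ r" using N(4) NM that by (intro mixed_power_le) linarith+
    from L3 [OF this] show ?thesis by (simp add: mult.assoc)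
  qed
  have L6: "R ^ r * (q * k) * k \<le> L"
  proof -
    have "R ^ r * (q * k) * k \<le> R ^ r * (2 * LL ^ r * k) * k" using q_le by (intro mult_le_mono) auto
    then show ?thesis unfolding L_def X by (simp add: mult_ac)
  qed
  have p2: "p \<ge> 2" using p_gt_1 by simp
  have pl: "p \<le> 2 ^ l"
  proof -
    have "p ^ 1 \<le> p ^ k" using kk p2 by (intro power_increasing) auto
    with l show ?thesis by simp
  qed
  have kl: "k \<le> 2 ^ l"
  proof -
    have "k < 2 ^ k" by (rule less_exp)
    also have "(2::nat) ^ k \<le> p ^ k" using p2 by (rule power_mono_nat)
    finally show ?thesis using l by simp
  qed
  have L_less: "L < 2 ^ b"
  proof -
    have "L \<le> 2 * 2 ^ l * 2 ^ l * (2 ^ e0) ^ r" unfolding L_def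
      using kl LL(4) by (intro mult_le_mono power_mono_nat) auto
    also have "\<dots> = 2 ^ (1 + l + l + e0 * r)" by (simp add: power_add power_mult)
    also have "\<dots> < 2 ^ b" unfolding b_def by (rule power_strict_increasing) auto
    finally show ?thesis .
  qed
  have "P 0" unfolding P_def using weight_0 [of w, OF w(1)] mm by (simp only: Suc_leI One_nat_def)
  have Jl: "J e < G ^ r" for e
  proof -
    have "G ^ r > 0" using w(2) by simp
    then show ?thesis unfolding J_def using sel_le [of P "G ^ r" e] by linarith
  qed
  interpret mmv N M R G \<alpha> \<beta> \<gamma> g n p k r q L b J fd F \<theta>
  proof unfold_locales
    show "N \<ge> 2" "M > 0" "R > 0" "p \<ge> 2" "k > 0" "L < 2 ^ b" "n \<le> N ^ r"
      by (fact N(1) N(2) R p2 kk L_less r(1))+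
    show "G > 0" "q > 0" "b \<ge> 1" using w(2) by (simp_all add: q_def b_def)
    show "J e < G ^ r" for e by (fact Jl)
    show "(k * k) * (N * N) ^ (r - t) * R ^ t \<le> L" if "t \<le> r" for t using that by (rule L1)
    show "(k * N ^ r) * N ^ (r - t) * G ^ t \<le> L" if "t \<le> r" for t using that by (rule L2)
    show "(q * k) * (N * M) ^ (r - t) * R ^ t \<le> L" if "t \<le> r" for t using that by (rule L4)
    show "(q * k) * R ^ (r - t) * (N * M) ^ t \<le> L" if "t \<le> r" for t using that by (rule L5)
    show "R ^ r * (q * k) * k \<le> L" by (fact L6)
    show "fd u = digits F p k \<theta> (\<theta> [^]\<^bsub>F\<^esub> k) u" if "u < k" for u by (simp only: fd_def)
  qed
  let ?s = "mmv_input F p k \<theta> n A B C"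
  have pb: "p < 2 ^ b"
  proof -
    have "(2::nat) ^ l < 2 ^ b" unfolding b_def by (rule power_strict_increasing) auto
    with pl show ?thesis by (rule le_less_trans)
  qed
  have nb: "n < 2 ^ b"
  proof -
    have "N ^ r \<le> L" by (rule size_bounds)
    then show ?thesis using r(1) L_less by linarith
  qed
  have kb: "k < 2 ^ b"
  proof -
    have "(2::nat) ^ l < 2 ^ b" unfolding b_def by (rule power_strict_increasing) auto
    with kl show ?thesis by (rule le_less_trans)
  qed
  have mc: "mat_cells F p k \<theta> n a i < 2 ^ b" if a: "mat_entries F n a" for a i
  proof (cases "i < n * n * k")
    case True
    have n: "n > 0" using True by (cases n) auto
    have "i div k < n * n" using True by (rule less_mult_imp_div_less)
    then have "i div k div n < n" by (rule less_mult_imp_div_less)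
    then have "a (i div k div n) (i div k mod n) \<in> carrier F" using a n by (simp add: mat_entries_def)
    then have "mat_cells F p k \<theta> n a i < p" using True kk by (simp add: mat_cells_def digits_less)
    then show ?thesis using pb by simp
  qed (simp add: mat_cells_def)
  have fp: "digits F p k \<theta> (\<theta> [^]\<^bsub>F\<^esub> k) i < 2 ^ b" if "i < k" for i
  proof -
    have "digits F p k \<theta> (\<theta> [^]\<^bsub>F\<^esub> k) i < p" using that theta by (intro digits_less) auto
    then show ?thesis using pb by simp
  qed
  have bnd: "bounded b ?s"
    unfolding bounded_def mmv_input_def using pb nb kb mc abc fp by auto
  have zero: "\<forall>x\<in>{''r'', ''j'', ''ra'', ''ca'', ''rb'', ''cb'', ''w'', ''J'', ''c'', ''bad''}. ?s x = (\<lambda>_. 0)"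
    by (simp add: mmv_input_def)
  have inp: "?s ''n'' 0 = n" "?s ''p'' 0 = p" "?s ''k'' 0 = k" "\<forall>u<k. ?s ''f'' u = fd u"
    "?s ''A'' = mat_cells F p k \<theta> n A" "?s ''B'' = mat_cells F p k \<theta> n B" "?s ''C'' = mat_cells F p k \<theta> n C"
    by (simp_all add: mmv_input_def fd_def)
  have ent: "\<forall>i<N ^ r. \<forall>j<N ^ r. \<forall>u<k. entry n k False (mat_cells F p k \<theta> n a) i j u = dig a i j u \<and> dig a i j u < p"
    if "mat_entries F n a" for a
    using entry_mat_cells [OF that] by blast
  from run_mmv_prog [OF bnd inp(1-4) zero r w J_def [unfolded P_def] q_def [unfolded P_def] bil
      ent [OF abc(1), folded inp(5)] ent [OF abc(2), folded inp(6)] ent [OF abc(3), folded inp(7)]]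
  obtain s where s: "costs (mmv_prog N M R G \<alpha> \<beta> \<gamma> g w) (mmv_cost N M R G \<alpha> \<beta> \<gamma> g w) ?s s"
    "s ''out'' 0 = of_bool (\<not> detected (dig A) (dig B) (dig C) \<and> \<not> detected (\<lambda>i j. dig B j i) (\<lambda>i j. dig A j i) (\<lambda>i j. dig C j i))"
    by (elim exE conjE) (rule that)
  have "s ''out'' 0 = (if mmv_yes F n A B C then 1 else 0)"
    unfolding s(2) detected_iff [OF iso g_def J_def [unfolded P_def] q_def [unfolded P_def] abc sparse] by simp
  then show ?thesis
    using s(1) [unfolded costs_def runs_def] unfolding g_def L_def b_def by blast
qed

text \<open>For positive \<open>r\<close>, \<open>2 ^ (r - 1) <= n\<close> bounds \<open>r\<close>
  by a logarithm. One factor \<open>r + 1\<close> stems from the rounds of the transformations, the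
  other from the word length.\<close>

lemma log_factor_bound:
  assumes \<eta>: "\<eta> > 0"
  shows "\<exists>c>0. \<forall>n r N. n \<ge> 1 \<longrightarrow> N \<ge> 2 \<longrightarrow> (\<forall>t<r. N ^ t < n) \<longrightarrow> (real r + 1)\<^sup>2 \<le> c * real (n::nat) powr \<eta>"
proof (intro exI conjI allI impI)
  let ?c = "2 + 2 / (\<eta> * ln 2)"
  show "?c\<^sup>2 > 0" using \<eta> by (intro zero_less_power add_pos_pos) auto
  fix n r N :: nat assume n: "n \<ge> 1" and N: "N \<ge> 2" and r: "\<forall>t<r. N ^ t < n"
  have "real r \<le> 1 + log 2 (real n)"
  proof (cases r)
    case (Suc t)
    then have "N ^ t < n" using r by simp
    moreover have "2 ^ t \<le> N ^ t" using N by (rule power_mono_nat)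
    ultimately have "2 ^ t \<le> n" by linarith
    then have "real (2 ^ t) \<le> real n" by (simp only: of_nat_le_iff)
    then have "real t \<le> log 2 (real n)" using n by (simp add: le_log_iff powr_realpow)
    then show ?thesis using Suc by simp
  qed (use n in simp)
  also have "log 2 (real n) = ln (real n) / ln 2" by (simp add: log_def)
  also have "\<dots> \<le> (real n powr (\<eta> / 2) / (\<eta> / 2)) / ln 2"
    using n \<eta> by (intro divide_right_mono ln_powr_bound) auto
  finally have "real r + 1 \<le> 2 * 1 + (2 / (\<eta> * ln 2)) * real n powr (\<eta> / 2)" by (simp add: field_simps)
  also have "\<dots> \<le> 2 * real n powr (\<eta> / 2) + (2 / (\<eta> * ln 2)) * real n powr (\<eta> / 2)"
    using n \<eta> by (intro add_mono mult_left_mono order_refl) (auto simp: ge_one_powr_ge_zero)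
  also have "\<dots> = ?c * real n powr (\<eta> / 2)" by (simp add: algebra_simps)
  finally have "(real r + 1)\<^sup>2 \<le> (?c * real n powr (\<eta> / 2))\<^sup>2" by (rule power_mono) simp
  also have "\<dots> = ?c\<^sup>2 * real n powr \<eta>"
    using n by (simp add: power_mult_distrib powr_power)
  finally show "(real r + 1)\<^sup>2 \<le> ?c\<^sup>2 * real n powr \<eta>" .
qed

text \<open>A positive power of \<open>2 ^ l\<close> outgrows constants and polynomials in
  \<open>l\<close>; the two bounds absorb the constant of the straight-line program and the sum of
  reciprocal weights.\<close>

lemma ex_large_base:
  fixes \<eta> K :: real
  assumes \<eta>: "\<eta> > 0"
  shows "\<exists>l::nat\<ge>1. K \<le> (2 ^ l) powr \<eta> \<and> 12 * real l * (real l + 1) \<le> (2 ^ l) powr \<eta>"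
proof -
  have "eventually (\<lambda>l::nat. K \<le> 2 powr (real l * \<eta>)) at_top" using \<eta> by real_asymp
  moreover have "eventually (\<lambda>l::nat. 12 * real l * (real l + 1) \<le> 2 powr (real l * \<eta>)) at_top" using \<eta> by real_asymp
  moreover have "eventually (\<lambda>l::nat. l \<ge> 1) at_top" by (rule eventually_ge_at_top)
  ultimately have "eventually (\<lambda>l::nat. l \<ge> 1 \<and> K \<le> 2 powr (real l * \<eta>) \<and> 12 * real l * (real l + 1) \<le> 2 powr (real l * \<eta>)) at_top"
    by eventually_elim auto
  then obtain l :: nat where "l \<ge> 1" "K \<le> 2 powr (real l * \<eta>)" "12 * real l * (real l + 1) \<le> 2 powr (real l * \<eta>)"
    by (auto simp: eventually_at_top_linorder)
  then show ?thesis by (intro exI [of _ l]) (simp add: powr_powr flip: powr_realpow)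
qed

text \<open>As \<open>X\<close> is at most \<open>N powr E\<close>, its \<open>r\<close>-th power is
  at most \<open>(N ^ r) powr E\<close>, and minimality of \<open>r\<close> gives
  \<open>N ^ r <= N * n\<close>, a loss of only a constant. Of \<open>lam ^ 3\<close>, two factors
  bound \<open>k * k\<close> and one the word length.\<close>

lemma mmv_time_bound:
  fixes n r N X k l e0 c0 m :: nat and E \<eta> lam c :: real
  assumes n: "n \<ge> 1" and N: "N \<ge> 2" and r: "\<forall>t<r. N ^ t < n"
    and m: "m \<le> (r + 1) * (2 * k * k * X ^ r + 1) * (c0 * (2 + 2 * l + e0 * r))"
    and X: "X > 0" "real X \<le> real N powr E" and E: "E \<ge> 0"
    and c: "(real r + 1)\<^sup>2 \<le> c * real n powr \<eta>" "c > 0"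
    and lam: "real k \<le> lam" "real l \<le> 2 * lam" "1 \<le> lam"
  shows "real m \<le> real n powr (E + \<eta>) * (3 * c * real c0 * (6 + real e0) * real N powr E * lam ^ 3)"
proof -
  have Nr: "real N ^ r \<le> real N * real n"
  proof (cases r)
    case 0
    have "1 * 1 \<le> real N * real n" using n N by (intro mult_mono) auto
    then show ?thesis using 0 by simp
  next
    case (Suc t)
    then have "N ^ t < n" using r by simp
    then have "N * N ^ t \<le> N * n" by simp
    then have "real (N * N ^ t) \<le> real (N * n)" by (simp only: of_nat_le_iff)
    then show ?thesis using Suc by simp
  qed
  have "real X ^ r \<le> (real N powr E) ^ r" using X(2) by (rule power_mono) simp
  also have "\<dots> = (real N ^ r) powr E" using N by (simp add: powr_powr mult.commute flip: powr_realpow)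
  also have "\<dots> \<le> (real N * real n) powr E" using Nr E by (intro powr_mono2) auto
  also have "\<dots> = real N powr E * real n powr E" by (simp add: powr_mult)
  finally have Xr: "real X ^ r \<le> real N powr E * real n powr E" .
  have X1: "1 \<le> real X ^ r" using X(1) by (intro one_le_power) simp
  have kk: "real k * real k \<le> lam\<^sup>2" using lam unfolding power2_eq_square by (intro mult_mono) auto
  have "1 * 1 \<le> lam\<^sup>2 * real X ^ r" using X1 lam(3) by (intro mult_mono) (auto simp: one_le_power)
  moreover have "real k * real k * real X ^ r \<le> lam\<^sup>2 * real X ^ r" using kk by (rule mult_right_mono) simp
  ultimately have f1: "2 * real k * real k * real X ^ r + 1 \<le> 3 * (lam\<^sup>2 * real X ^ r)" by simp
  have "real e0 * real r * 1 \<le> real e0 * real r * lam" using lam(3) by (intro mult_left_mono) auto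
  moreover have "0 \<le> real r * lam" "0 \<le> real e0 * lam" using lam(3) by auto
  moreover have "(6 + real e0) * (real r + 1) * lam = real e0 * real r * lam + 6 * (real r * lam) + real e0 * lam + 6 * lam"
    by (simp add: algebra_simps)
  ultimately have f2: "2 + 2 * real l + real e0 * real r \<le> (6 + real e0) * (real r + 1) * lam"
    using lam(2,3) by linarith
  have "real m \<le> real ((r + 1) * (2 * k * k * X ^ r + 1) * (c0 * (2 + 2 * l + e0 * r)))"
    using m by (simp only: of_nat_le_iff)
  also have "\<dots> = (real r + 1) * (2 * real k * real k * real X ^ r + 1) * (real c0 * (2 + 2 * real l + real e0 * real r))"
    by (simp only: of_nat_mult of_nat_add of_nat_power of_nat_1 of_nat_numeral)
  also have "\<dots> \<le> (real r + 1) * (3 * (lam\<^sup>2 * real X ^ r)) * (real c0 * ((6 + real e0) * (real r + 1) * lam))"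
    using f1 f2 lam(3) by (intro mult_mono) (auto intro!: mult_nonneg_nonneg add_nonneg_nonneg)
  also have "\<dots> = (real r + 1)\<^sup>2 * real X ^ r * (3 * real c0 * (6 + real e0) * lam ^ 3)"
    by (simp add: power2_eq_square power3_eq_cube mult_ac)
  also have "\<dots> \<le> (c * real n powr \<eta>) * (real N powr E * real n powr E) * (3 * real c0 * (6 + real e0) * lam ^ 3)"
    using c Xr lam(3) by (intro mult_right_mono mult_mono) auto
  also have "\<dots> = real n powr (E + \<eta>) * (3 * c * real c0 * (6 + real e0) * real N powr E * lam ^ 3)"
    by (simp add: powr_add mult_ac)
  finally show ?thesis .
qed

theorem theorem3p2:
  fixes \<delta> \<epsilon> :: real and \<F> :: "'a ring set"
  assumes "0 \<le> \<delta>" and "\<delta> \<le> 2" and "\<epsilon> > 0"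
    and "\<And>F. F \<in> \<F> \<Longrightarrow> field F \<and> finite (carrier F)"
  shows "\<exists>(P :: com) (h :: real poly). \<forall>F\<in>\<F>.
    solves_mmv_in_time P F (\<lambda>n. real n powr \<delta>)
      (\<lambda>n. real n powr (omega \<F> 1 1 (\<delta> / 2) + \<epsilon>) * poly h (log 2 (real (card (carrier F)))))"
\<comment> \<open>Without a presentation there are no inputs. Otherwise a presented field supplies
  the prime with which the rank is bounded from below.\<close>
proof (cases "\<exists>F\<in>\<F>. \<exists>p k \<theta>. presents F p k \<theta>")
  case False
  then show ?thesis unfolding solves_mmv_in_time_def by blast
next
  case True
  then obtain F1 p1 k1 \<theta>1 where F1: "F1 \<in> \<F>" "presents F1 p1 k1 \<theta>1" by blast
  define \<omega> where "\<omega> = omega \<F> 1 1 (\<delta> / 2)"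
  have e4: "\<epsilon> / 4 > 0" using assms(3) by simp
  have "\<omega> \<ge> 0" unfolding \<omega>_def by (rule omega_approx(2) [OF assms(1,2) e4])
  obtain v K where v: "v < \<omega> + \<epsilon> / 4" and
    alg: "\<forall>n\<ge>1. \<exists>S outs. computes_matmul \<F> n n (dim_pow n (\<delta> / 2)) S outs \<and> real (length S) \<le> K * real n powr v"
    using omega_approx(1) [OF assms(1,2) e4, of \<F>] unfolding \<omega>_def by blast
  \<comment> \<open>\<open>l\<close>, and with it \<open>N\<close>, is chosen after the constant
    \<open>K\<close> that belongs to \<open>v\<close>, so that both \<open>2 * max K 1\<close> and
    the weight bound are at most \<open>N powr (\<epsilon> / 4)\<close>.\<close>
  obtain l :: nat where l: "l \<ge> 1" "2 * max K 1 \<le> (2 ^ l) powr (\<epsilon> / 4)" "12 * real l * (real l + 1) \<le> (2 ^ l) powr (\<epsilon> / 4)"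
    using ex_large_base [OF e4] by blast
  define N :: nat where "N = 2 ^ l"
  define M where "M = dim_pow N (\<delta> / 2)"
  define LL :: nat where "LL = 12 * l * (l + 1)"
  have "(2::nat) ^ 1 \<le> 2 ^ l" using l(1) by (rule power_increasing) simp
  then have N2: "N \<ge> 2" by (simp add: N_def)
  then have N1: "N \<ge> 1" by simp
  have M: "M \<le> N" "1 \<le> M" unfolding M_def using N1 assms(1,2) by (intro dim_pow_le; simp)+
  obtain S outs where S: "computes_matmul \<F> N N M S outs" "real (length S) \<le> K * real N powr v"
    using alg N1 unfolding M_def by blast
  obtain R and \<alpha> \<beta> \<gamma> :: "nat \<Rightarrow> nat \<Rightarrow> int" where R: "R \<le> 2 * length S" and
    ident: "\<forall>F\<in>\<F>. \<forall>i<N. \<forall>j<N. \<forall>j'<N. \<forall>l<M. \<forall>i'<N. \<forall>l'<M.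
     [(\<Sum>\<rho><R. \<alpha> \<rho> (i * N + j) * \<beta> \<rho> (j' * M + l) * \<gamma> \<rho> (i' * M + l'))] \<cdot>\<^bsub>F\<^esub> \<one>\<^bsub>F\<^esub> =
     [(of_bool (j = j' \<and> i = i' \<and> l = l') :: int)] \<cdot>\<^bsub>F\<^esub> \<one>\<^bsub>F\<^esub>"
    using computes_matmul_bilinear [OF S(1)] by blast
  have pf: "presented_field F p k \<theta>" if "F \<in> \<F>" "presents F p k \<theta>" for F p k \<theta>
    using assms(4) [OF that(1)] that(2) by (simp add: presented_field_def presented_field_axioms_def)
  have bil: "bilinear_matmul (int p) N M R \<alpha> \<beta> \<gamma>" if F: "F \<in> \<F>" "presents F p k \<theta>" for F p k \<theta>
    unfolding bilinear_matmul_def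
  proof (intro allI impI)
    fix i j j' l i' l' assume lt: "i < N" "j < N" "j' < N" "l < M" "i' < N" "l' < M"
    show "[(\<Sum>\<rho><R. \<alpha> \<rho> (i * N + j) * \<beta> \<rho> (j' * M + l) * \<gamma> \<rho> (i' * M + l')) =
        of_bool (j = j' \<and> i = i' \<and> l = l')] (mod int p)"
      unfolding presented_field.int_one_eq_iff [OF pf [OF F], symmetric]
      by (rule ident [rule_format, OF F(1) lt])
  qed
  have "p1 > 1" by (rule presented_field.p_gt_1 [OF pf [OF F1]])
  \<comment> \<open>Keeps every round of the transformations by \<alpha>, \<beta> and \<gamma>
    within \<open>R ^ r\<close> cells per vector.\<close>
  then have NN: "N * N \<le> R" using bilinear_matmul_rank_ge [OF bil [OF F1]] M by simp
  obtain G w and T :: "nat \<Rightarrow> nat set" where w: "w 0 = 1" "2 \<le> G" "\<forall>j<G. 1 \<le> w j \<and> w j \<le> N"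
    and w_sum: "(\<Sum>j<G. 1 / real (w j)) \<le> 12 * real l * (real l + 1)"
    and iso: "\<forall>X. X \<subseteq> {..<N} \<and> X \<noteq> {} \<longrightarrow> (\<exists>j<G. w j \<le> card X \<and> card (T j \<inter> X) = 1)"
    using ex_isolating_family [OF l(1)] unfolding N_def by blast
  have LL_real: "real LL = 12 * real l * (real l + 1)" by (simp add: LL_def algebra_simps)
  have LL_pos: "LL > 0" using l(1) by (simp add: LL_def)
  have G_le: "G \<le> N * LL"
  proof -
    have "real G * (1 / real N) = (\<Sum>j<G. 1 / real N)" by simp
    also have "\<dots> \<le> (\<Sum>j<G. 1 / real (w j))" using w(3) N1 by (intro sum_mono divide_left_mono) auto
    also have "\<dots> \<le> real LL" using w_sum LL_real by simp
    finally have "real G \<le> real (N * LL)" using N1 by (simp add: field_simps)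
    then show ?thesis by (simp only: of_nat_le_iff)
  qed
  have sel_le: "card {j. j < G ^ r \<and> weight w G r j \<le> M ^ r} \<le> M ^ r * LL ^ r" for r
  proof -
    have "real (card {j. j < G ^ r \<and> weight w G r j \<le> M ^ r}) \<le> real (M ^ r) * (\<Sum>j<G. 1 / real (w j)) ^ r"
      using w(3) by (intro card_weight_le) auto
    also have "\<dots> \<le> real (M ^ r) * real LL ^ r"
      using w_sum LL_real by (intro mult_left_mono power_mono) (auto intro: sum_nonneg)
    finally have "real (card {j. j < G ^ r \<and> weight w G r j \<le> M ^ r}) \<le> real (M ^ r * LL ^ r)" by simp
    then show ?thesis by (simp only: of_nat_le_iff)
  qed
  \<comment> \<open>One quarter of \<epsilon> each for \<open>v\<close>, for
    \<open>2 * max K 1\<close> and for \<open>LL\<close>; the fourth is left for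
    \<open>(r + 1) ^ 2\<close>.\<close>
  define E where "E = \<omega> + 3 * \<epsilon> / 4"
  have E0: "E \<ge> 0" using \<open>\<omega> \<ge> 0\<close> assms(3) by (simp add: E_def)
  have N_real: "real N = 2 ^ l" by (simp add: N_def)
  have RLL: "real (R * LL) \<le> real N powr E"
  proof -
    have "real R \<le> 2 * real (length S)" using R by linarith
    also have "\<dots> \<le> 2 * (K * real N powr v)" using S(2) by simp
    also have "\<dots> \<le> 2 * max K 1 * real N powr v" by (simp add: mult_right_mono)
    also have "\<dots> \<le> real N powr (\<epsilon> / 4) * real N powr (\<omega> + \<epsilon> / 4)"
      using l(2) v N1 unfolding N_real by (intro mult_mono powr_mono) auto
    finally have "real R * real LL \<le> (real N powr (\<epsilon> / 4) * real N powr (\<omega> + \<epsilon> / 4)) * real N powr (\<epsilon> / 4)"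
      using l(3) LL_real unfolding N_real by (intro mult_mono) auto
    also have "\<dots> = real N powr E" by (simp add: E_def add.commute flip: powr_add)
    finally show ?thesis by simp
  qed
  have RLL_pos: "R * LL > 0" using NN N1 LL_pos by (auto intro!: Nat.gr0I)
  obtain c where c: "c > 0" "\<And>n r N. n \<ge> 1 \<Longrightarrow> N \<ge> 2 \<Longrightarrow> \<forall>t<r. N ^ t < n \<Longrightarrow> (real r + 1)\<^sup>2 \<le> c * real (n::nat) powr (\<epsilon> / 4)"
    using log_factor_bound [OF e4] by blast
  define g :: "nat \<Rightarrow> nat \<Rightarrow> int" where "g = (\<lambda>j x. of_bool (x \<in> T j))"
  define P where "P = mmv_prog N M R G \<alpha> \<beta> \<gamma> g w"
  define c0 where "c0 = mmv_cost N M R G \<alpha> \<beta> \<gamma> g w"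
  define h where "h = Polynomial.monom (3 * c * real c0 * (6 + real (R * LL)) * real N powr E) 3"
  have "solves_mmv_in_time P F (\<lambda>n. real n powr \<delta>)
      (\<lambda>n. real n powr (\<omega> + \<epsilon>) * poly h (log 2 (real (card (carrier F)))))" if F: "F \<in> \<F>" for F
    unfolding solves_mmv_in_time_def
  proof (intro allI impI)
    fix p k \<theta> n A B C
    assume pres: "presents F p k \<theta>" and inst: "mmv_instance F (\<lambda>n. real n powr \<delta>) n A B C"
    interpret presented_field F p k \<theta> by (rule pf [OF F pres])
    have n: "n \<ge> 1" and abc: "mat_entries F n A" "mat_entries F n B" "mat_entries F n C"
      and sparse: "real (card {(i, j). i < n \<and> j < n \<and> mat_prod F n A B i j \<ominus>\<^bsub>F\<^esub> C i j \<noteq> \<zero>\<^bsub>F\<^esub>}) \<le> real n powr \<delta>"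
      using inst by (auto simp: mmv_instance_def)
    define r where "r = (LEAST r. n \<le> N ^ r)"
    have "n \<le> N ^ n"
    proof -
      have "n < 2 ^ n" by (rule less_exp)
      also have "(2::nat) ^ n \<le> N ^ n" using N2 by (rule power_mono_nat)
      finally show ?thesis by simp
    qed
    then have r1: "n \<le> N ^ r" unfolding r_def by (rule LeastI)
    have r2: "\<forall>t<r. N ^ t < n" unfolding r_def using not_less_Least by (force simp: not_le)
    define lam where "lam = log 2 (real (card (carrier F)))"
    have lam_eq: "lam = real k * log 2 (real p)" unfolding lam_def card_carrier using p_gt_1 by (simp add: log_nat_power)
    have "1 \<le> log 2 (real p)" using p_gt_1 by (simp add: le_log_iff)
    then have "real k * 1 \<le> lam" unfolding lam_eq by (intro mult_left_mono) auto
    then have k_le: "real k \<le> lam" by simp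
    then have lam1: "1 \<le> lam" using k_pos by linarith
    define l' where "l' = nat \<lceil>lam\<rceil>"
    have l'_le: "real l' \<le> 2 * lam" unfolding l'_def using lam1 by linarith
    have "real (p ^ k) = 2 powr lam" unfolding lam_def card_carrier using p_gt_1 by simp
    also have "\<dots> \<le> 2 powr real l'" unfolding l'_def using lam1 by (intro powr_mono) linarith+
    also have "\<dots> = real (2 ^ l')" by (simp add: powr_realpow)
    finally have pk: "p ^ k \<le> 2 ^ l'" by (simp only: of_nat_le_iff)
    \<comment> \<open>\<open>M\<close> is rounded up, so \<open>M ^ r\<close> is at least
      \<open>n powr (\<delta> / 2)\<close>; the sparsity thus takes the form of a square, as
      \<open>ex_sparse_line\<close> expects.\<close>
    have "real n powr \<delta> \<le> real (M ^ r * M ^ r)"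
    proof -
      have "real n powr (\<delta> / 2) \<le> (real N ^ r) powr (\<delta> / 2)"
        using r1 assms(1) by (intro powr_mono2) (auto simp flip: of_nat_power)
      also have "\<dots> = (real N powr (\<delta> / 2)) ^ r" using N1 by (simp add: powr_powr mult.commute flip: powr_realpow)
      also have "\<dots> \<le> real M ^ r" unfolding M_def dim_pow_def by (intro power_mono) (auto simp: real_nat_ceiling_ge)
      finally have le: "real n powr (\<delta> / 2) \<le> real M ^ r" .
      have "real n powr \<delta> = real n powr (\<delta> / 2) * real n powr (\<delta> / 2)" by (simp flip: powr_add)
      also have "\<dots> \<le> real M ^ r * real M ^ r" using le by (intro mult_mono) auto
      finally show ?thesis by simp
    qed
    with sparse have sp: "card {(i, j). i < n \<and> j < n \<and> mat_prod F n A B i j \<ominus>\<^bsub>F\<^esub> C i j \<noteq> \<zero>\<^bsub>F\<^esub>} \<le> M ^ r * M ^ r"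
      by linarith
    have M0: "M > 0" using M(2) by simp
    have w': "\<forall>j<G. w j \<le> N" using w(3) by blast
    \<comment> \<open>A crude choice of \<open>e0\<close>, which enters the time bound only through
      the constant \<open>6 + e0\<close>.\<close>
    have e0: "R * LL \<le> 2 ^ (R * LL)" using less_exp [of "R * LL"] by simp
    have field: "field F" "finite (carrier F)" using assms(4) [OF F] by auto
    from mmv_run [OF field pres N2 M0 M(1) NN bil [OF F pres] w(1,2) w' iso G_le LL_pos sel_le e0 r1 r2 pk abc sp]
    obtain m s where ms: "exec P (mmv_input F p k \<theta> n A B C) m s"
      "m \<le> (r + 1) * (2 * k * k * (R * LL) ^ r + 1) * (c0 * (2 + 2 * l' + (R * LL) * r))"
      "s ''out'' 0 = (if mmv_yes F n A B C then 1 else 0)"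
      unfolding P_def c0_def g_def by blast
    have "real m \<le> real n powr (E + \<epsilon> / 4) * (3 * c * real c0 * (6 + real (R * LL)) * real N powr E * lam ^ 3)"
      by (rule mmv_time_bound [OF n N2 r2 ms(2) RLL_pos RLL E0 c(2) [OF n N2 r2] c(1) k_le l'_le lam1])
    also have "E + \<epsilon> / 4 = \<omega> + \<epsilon>" by (simp add: E_def)
    also have "3 * c * real c0 * (6 + real (R * LL)) * real N powr E * lam ^ 3 = poly h lam"
      by (simp add: h_def poly_monom)
    finally have "real m \<le> real n powr (\<omega> + \<epsilon>) * poly h lam" .
    then show "\<exists>m s. exec P (mmv_input F p k \<theta> n A B C) m s \<and>
        real m \<le> real n powr (\<omega> + \<epsilon>) * poly h (log 2 (real (card (carrier F)))) \<and>
        s ''out'' 0 = (if mmv_yes F n A B C then 1 else 0)"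
      using ms(1,3) unfolding lam_def by blast
  qed
  then show ?thesis unfolding \<omega>_def by blast
qed

end
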